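(* Let $1\le A\le\infty$, and let $\mathcal{C}(A)$, $\mathcal{C}^+(A)$, $\mathcal{A}^+$, $\mathcal{E}^+$ be as defined in the context. Then: (a) If $A=\infty$: (a.1) There exists $G\in\mathcal{E}^+$, $G\neq 0$, attaining the supremum defining $\mathcal{C}^+(\infty)$. (a.2) $\mathcal{C}(\infty)\le \mathcal{C}^+(\infty) < 1.2$. (b) If $A=1$, then $\mathcal{C}^+(1)=2$, but there is no nonzero $F\in\mathcal{A}^+$ attaining the supremum defining $\mathcal{C}^+(1)$. (c) If $1<A<\infty$: (c.1) There exists an even, real-valued $G\in\mathcal{A}^+$, $G\neq0$, attaining the supremum defining $\mathcal{C}^+(A)$. (c.2) $$\mathcal{C}(A)\le \mathcal{C}^+(A)\le \min\left\{\frac{1.2}{1-\frac{0.222}{A-1}},\ 2\right\},$$ where the term $\frac{1.2}{1-\frac{0.222}{A-1}}$ inside the minimum is only asserted in the range $1.222<A<\infty$ (otherwise the upper bound is $2$). (c.3) In particular, $\dfrac{25}{21} < \mathcal{C}^+\!\left(\dfrac{36}{11}\right)$.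
   Context: For $F\in L^1(\mathbb{R})$, $\widehat{F}(t)=\int_{-\infty}^{\infty} e^{-2\pi i x t}F(x)\,\mathrm{d}x$; $x_+=\max\{x,0\}$. Let $\mathcal{A}$ be the class of continuous $F:\mathbb{R}\to\mathbb{C}$ with $F\in L^1(\mathbb{R})$ and $\mathcal{E}\subset\mathcal{A}$ those with $\operatorname{supp}(\widehat F)\subset[-1,1]$. For $1\le A<\infty$, $\mathcal{C}(A):=\sup_{F\in\mathcal{A},F\ne0}\frac{1}{\|F\|_1}\big(|F(0)|-A\int_{[-1,1]^c}|\widehat F(t)|\,\mathrm{d}t\big)$ and $\mathcal{C}(\infty):=\sup_{F\in\mathcal{E},F\ne0}|F(0)|/\|F\|_1$. Let $\mathcal{A}^+$ be the class of even, continuous $F:\mathbb{R}\to\mathbb{R}$ with $F\in L^1(\mathbb{R})$, and $\mathcal{E}^+\subset\mathcal{A}^+$ the subclass of those with $\widehat{F}(t)\le 0$ for all $|t|\ge1$. For $1\le A<\infty$, $$\mathcal{C}^+(A):=\sup_{F\in\mathcal{A}^+,\,F\ne0}\frac{1}{\|F\|_1}\left(F(0)-A\int_{[-1,1]^c}\big(\widehat F(t)\big)_+\,\mathrm{d}t\right),$$ and $\mathcal{C}^+(\infty):=\sup_{F\in\mathcal{E}^+,\,F\neq0} F(0)/\|F\|_1$. *)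

theory Defs
  imports "HOL-Analysis.Analysis"
begin

definition fourier :: "(real \<Rightarrow> complex) \<Rightarrow> real \<Rightarrow> complex" where
  "fourier F t = (LINT x|lborel. cis (- 2 * pi * x * t) * F x)"

definition L1norm :: "(real \<Rightarrow> 'a::real_normed_vector) \<Rightarrow> real" where
  "L1norm F = (LINT x|lborel. norm (F x))"

definition classA :: "(real \<Rightarrow> complex) set" where
  "classA = {F. continuous_on UNIV F \<and> integrable lborel F}"

definition classE :: "(real \<Rightarrow> complex) set" where
  "classE = {F. F \<in> classA \<and> closure {t. fourier F t \<noteq> 0} \<subseteq> {-1..1}}"

definition classAp :: "(real \<Rightarrow> real) set" where
  "classAp = {F. (\<forall>x. F (-x) = F x) \<and> continuous_on UNIV F \<and> integrable lborel F}"

definition rfourier :: "(real \<Rightarrow> real) \<Rightarrow> real \<Rightarrow> complex" where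
  "rfourier F = fourier (\<lambda>x. complex_of_real (F x))"

text \<open>Class E+: those in A+ whose Fourier transform (real, since F is even and real)
  is nonpositive for |t| >= 1.\<close>
definition classEp :: "(real \<Rightarrow> real) set" where
  "classEp = {F. F \<in> classAp \<and> (\<forall>t. 1 \<le> \<bar>t\<bar> \<longrightarrow> Re (rfourier F t) \<le> 0)}"

text \<open>The functional for C(A), A finite, valued in the extended reals (the tail integral may be infinite).\<close>
definition ratioA :: "real \<Rightarrow> (real \<Rightarrow> complex) \<Rightarrow> ereal" where
  "ratioA A F = (ereal (norm (F 0))
      - ereal A * enn2ereal (\<integral>\<^sup>+ t. ennreal (norm (fourier F t)) * indicator {t. 1 < \<bar>t\<bar>} t \<partial>lborel))
      / ereal (L1norm F)"

definition CA :: "real \<Rightarrow> ereal" where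
  "CA A = (SUP F \<in> {F. F \<in> classA \<and> F \<noteq> (\<lambda>_. 0)}. ratioA A F)"

definition CA_inf :: ereal where
  "CA_inf = (SUP F \<in> {F. F \<in> classE \<and> F \<noteq> (\<lambda>_. 0)}. ereal (norm (F 0) / L1norm F))"

definition ratioAp :: "real \<Rightarrow> (real \<Rightarrow> real) \<Rightarrow> ereal" where
  "ratioAp A F = (ereal (F 0)
      - ereal A * enn2ereal (\<integral>\<^sup>+ t. ennreal (max 0 (Re (rfourier F t))) * indicator {t. 1 < \<bar>t\<bar>} t \<partial>lborel))
      / ereal (L1norm F)"

definition CAp :: "real \<Rightarrow> ereal" where
  "CAp A = (SUP F \<in> {F. F \<in> classAp \<and> F \<noteq> (\<lambda>_. 0)}. ratioAp A F)"

definition ratioEp :: "(real \<Rightarrow> real) \<Rightarrow> ereal" where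
  "ratioEp F = ereal (F 0 / L1norm F)"

definition CAp_inf :: ereal where
  "CAp_inf = (SUP F \<in> {F. F \<in> classEp \<and> F \<noteq> (\<lambda>_. 0)}. ratioEp F)"

end

theory Submission
  imports Defs "HOL-Probability.Probability"
begin

text \<open>Everything is phrased with the real cosine transform \<open>ct\<close>, which is the Fourier transform on
  even real functions. Upper bounds come from duality: if \<open>m = 1\<close> on \<open>[-1, 1]\<close> and
  \<open>1 - A \<le> m \<le> 1\<close> elsewhere, then the functional is at most \<open>\<integral> F \<cdot> ct m\<close>, hence at most
  \<open>sup \<bar>ct m\<bar>\<close> times the \<open>L\<^sup>1\<close> norm. The indicator of \<open>[-1, 1]\<close> gives \<open>2\<close>, never attained; a smoothed
  and dilated discrete measure gives \<open>1.2 / (1 - 0.222 / (A - 1))\<close>, and \<open>A \<rightarrow> \<infinity>\<close> gives the bound for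
  \<open>C\<^sup>+(\<infinity>)\<close>. Extremizers are limits of near-maximisers chosen to nearly minimise a weighted \<open>L\<^sup>2\<close>
  norm of the transform, so that the parallelogram law forces convergence; the limit is
  admissible by Fatou's lemma and Fourier inversion. The lower bound at \<open>A = 36/11\<close> uses
  \<open>F = (b\<^sup>2 + D\<^sup>2)(g * g)\<close> with \<open>g\<close> even and piecewise linear: its transform is
  \<open>(b\<^sup>2 - t\<^sup>2)\<close> times a square, and its \<open>L\<^sup>1\<close> norm is bounded through Bernstein coefficients.\<close>

section \<open>The cosine transform\<close>

text \<open>A function in A+ need not have an integrable transform, so \<open>F 0\<close> is not
  simply the integral of \<open>ct F\<close>. A finite penalty repairs this; an infinite one gives
  the ratio minus infinity. The number 0.222 is half of the point mass 0.444: averaging over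
  half-width e gives it the density 0.222 / e, which the constraint m \<ge> 1 - A admits for 0.222 /
  e = A - 1. Averaging spoils the value 1 near the ends of [-1, 1]; a dilation restores it at the
  cost of the factor 1 / (1 - e). The kernel bound proved is 1.199, and the slack up to 1.2 yields
  the strict inequality at infinity. Existence rests on A > 1: outside [-1, 1] the functional then
  charges x_- + (A - 1) x_+, which dominates a multiple of |x| and keeps limits of transforms
  integrable. At A = 1 this control is lost, and narrow tents approach 2. Limits are taken of
  transforms only; the extremizer is rebuilt as the transform of the limit. In the lower bound b =
  4/3, so that only 1 < |t| < 4/3 is penalised and the square has to be small just there.\<close>

abbreviation outer :: "real set" where
  "outer \<equiv> {t. 1 < \<bar>t\<bar>}"

abbreviation midpoint_fun :: "(real \<Rightarrow> real) \<Rightarrow> (real \<Rightarrow> real) \<Rightarrow> real \<Rightarrow> real" where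
  "midpoint_fun F G \<equiv> \<lambda>x. (1/2) * F x + (1/2) * G x"

definition ct :: "(real \<Rightarrow> real) \<Rightarrow> real \<Rightarrow> real" where
  "ct f t = (LINT x|lborel. cos (2 * pi * x * t) * f x)"

lemma integrable_cos_mult:
  assumes "integrable lborel (f :: real \<Rightarrow> real)"
  shows "integrable lborel (\<lambda>x. cos (2 * pi * x * t) * f x)"
proof (rule Bochner_Integration.integrable_bound[OF assms])
  show "(\<lambda>x. cos (2 * pi * x * t) * f x) \<in> borel_measurable lborel"
    using assms by measurable
  show "AE x in lborel. norm (cos (2 * pi * x * t) * f x) \<le> norm (f x)"
    by (auto simp: abs_mult mult_left_le_one_le)
qed

lemma integrable_sin_mult:
  assumes "integrable lborel (f :: real \<Rightarrow> real)"
  shows "integrable lborel (\<lambda>x. sin (s * x) * f x)"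
proof (rule Bochner_Integration.integrable_bound[OF assms])
  show "(\<lambda>x. sin (s * x) * f x) \<in> borel_measurable lborel"
    using assms by measurable
  show "AE x in lborel. norm (sin (s * x) * f x) \<le> norm (f x)"
    by (auto simp: abs_mult mult_left_le_one_le)
qed

lemma abs_ct_le:
  assumes "integrable lborel f"
  shows "\<bar>ct f t\<bar> \<le> (LINT x|lborel. \<bar>f x\<bar>)"
proof -
  have "\<bar>ct f t\<bar> \<le> (LINT x|lborel. \<bar>cos (2 * pi * x * t) * f x\<bar>)"
    unfolding ct_def by (rule integral_abs_bound)
  also have "\<dots> \<le> (LINT x|lborel. \<bar>f x\<bar>)"
    using integrable_abs[OF integrable_cos_mult[OF assms, of t]] integrable_abs[OF assms]
    by (rule integral_mono) (auto simp: abs_mult mult_left_le_one_le)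
  finally show ?thesis .
qed

lemma ct_minus: "ct f (- t) = ct f t"
  by (simp add: ct_def)

lemma continuous_ct:
  assumes "integrable lborel f"
  shows "continuous_on UNIV (ct f)"
proof (rule continuous_at_imp_continuous_on, safe)
  fix t
  show "isCont (ct f) t"
    unfolding continuous_at_sequentially comp_def
  proof safe
    fix u :: "nat \<Rightarrow> real" assume u: "u \<longlonglongrightarrow> t"
    show "(\<lambda>n. ct f (u n)) \<longlonglongrightarrow> ct f t"
      unfolding ct_def
    proof (rule integral_dominated_convergence[where w = "\<lambda>x. \<bar>f x\<bar>"])
      show "AE x in lborel. (\<lambda>n. cos (2 * pi * x * u n) * f x) \<longlonglongrightarrow> cos (2 * pi * x * t) * f x"
        by (intro always_eventually allI tendsto_intros u)
      show "integrable lborel (\<lambda>x. \<bar>f x\<bar>)" using assms by simp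
      show "AE x in lborel. norm (cos (2 * pi * x * u n) * f x) \<le> \<bar>f x\<bar>" for n
        by (auto simp: abs_mult mult_left_le_one_le)
    qed (use assms in measurable)
  qed
qed

lemma borel_measurable_ct [measurable]:
  assumes "integrable lborel f"
  shows "ct f \<in> borel_measurable borel"
  using continuous_ct[OF assms] by (rule borel_measurable_continuous_onI)

lemma ct_add:
  assumes "integrable lborel f" "integrable lborel g"
  shows "ct (\<lambda>x. f x + g x) t = ct f t + ct g t"
  using integrable_cos_mult[OF assms(1)] integrable_cos_mult[OF assms(2)]
  by (simp add: ct_def distrib_left)

lemma ct_diff:
  assumes "integrable lborel f" "integrable lborel g"
  shows "ct (\<lambda>x. f x - g x) t = ct f t - ct g t"
  using integrable_cos_mult[OF assms(1)] integrable_cos_mult[OF assms(2)]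
  by (simp add: ct_def right_diff_distrib)

lemma ct_cmult: "ct (\<lambda>x. c * f x) t = c * ct f t"
  by (simp add: ct_def mult.left_commute[of _ c])

lemma ct_sum:
  assumes "\<And>i. i \<in> I \<Longrightarrow> integrable lborel (f i)"
  shows "ct (\<lambda>x. \<Sum>i\<in>I. f i x) t = (\<Sum>i\<in>I. ct (f i) t)"
  using assms by (simp add: ct_def sum_distrib_left Bochner_Integration.integral_sum integrable_cos_mult)

lemma ct_dilate:
  assumes "c > 0"
  shows "ct (\<lambda>x. f (c * x)) t = ct f (t / c) / c"
proof -
  have "ct f (t / c) = \<bar>c\<bar> *\<^sub>R (LINT x|lborel. cos (2 * pi * (0 + c * x) * (t / c)) * f (0 + c * x))"
    unfolding ct_def using assms by (subst lborel_integral_real_affine[where c = c and t = 0]) auto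
  thus ?thesis using assms by (simp add: ct_def field_simps)
qed

lemma Re_rfourier:
  assumes "integrable lborel F"
  shows "Re (rfourier F t) = ct F t"
proof -
  have i: "integrable lborel (\<lambda>x. cis (- 2 * pi * x * t) * complex_of_real (F x))"
  proof (rule Bochner_Integration.integrable_bound[OF assms])
    show "(\<lambda>x. cis (- 2 * pi * x * t) * complex_of_real (F x)) \<in> borel_measurable lborel"
      using assms unfolding cis_conv_exp by measurable
  qed (auto simp: norm_mult)
  show ?thesis
    unfolding rfourier_def fourier_def ct_def integral_Re[OF i, symmetric] by simp
qed

text \<open>Fubini for the kernel cos (2 pi x t), which is symmetric in x and t. This is what moves
  the transform from \<open>F\<close> onto a dual function or a Gaussian, and it applies even when
  \<open>ct f\<close> is not integrable.\<close>

lemma ct_mult_formula: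
  assumes f: "integrable lborel f" and g: "integrable lborel g"
  shows "(LINT t|lborel. ct f t * g t) = (LINT x|lborel. f x * ct g x)"
    and "integrable lborel (\<lambda>t. ct f t * g t)"
proof -
  note [measurable] = borel_measurable_integrable[OF f] borel_measurable_integrable[OF g]
  have ip: "integrable (lborel \<Otimes>\<^sub>M lborel) (\<lambda>(x, t). f x * g t)"
  proof (rule lborel_pair.Fubini_integrable)
    show "AE x in lborel. integrable lborel (\<lambda>t. case (x, t) of (x, t) \<Rightarrow> f x * g t)"
      using g by simp
    have "(\<lambda>x. LINT y|lborel. norm (case (x, y) of (x, t) \<Rightarrow> f x * g t)) = (\<lambda>x. \<bar>f x\<bar> * (LINT y|lborel. \<bar>g y\<bar>))"
      by (simp add: abs_mult)
    thus "integrable lborel (\<lambda>x. LINT y|lborel. norm (case (x, y) of (x, t) \<Rightarrow> f x * g t))"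
      using f by simp
  qed measurable
  have i: "integrable (lborel \<Otimes>\<^sub>M lborel) (\<lambda>(x, t). cos (2 * pi * x * t) * f x * g t)"
  proof (rule Bochner_Integration.integrable_bound[OF ip])
    show "AE x in lborel \<Otimes>\<^sub>M lborel. norm (case x of (x, t) \<Rightarrow> cos (2 * pi * x * t) * f x * g t)
        \<le> norm (case x of (x, t) \<Rightarrow> f x * g t)"
      by (auto simp: abs_mult mult.assoc mult_left_le_one_le)
  qed measurable
  have "(LINT t|lborel. (LINT x|lborel. cos (2 * pi * x * t) * f x * g t))
      = (LINT x|lborel. (LINT t|lborel. cos (2 * pi * x * t) * f x * g t))"
    by (rule lborel_pair.Fubini_integral[OF i])
  thus "(LINT t|lborel. ct f t * g t) = (LINT x|lborel. f x * ct g x)"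
    by (simp add: ct_def mult.commute mult.left_commute flip: integral_mult_right_zero integral_mult_left_zero)
  show "integrable lborel (\<lambda>t. ct f t * g t)"
  proof (rule Bochner_Integration.integrable_bound[OF integrable_mult_left[OF integrable_abs[OF g], of "LINT x|lborel. \<bar>f x\<bar>"]])
    show "AE x in lborel. norm (ct f x * g x) \<le> norm (\<bar>g x\<bar> * (LINT x|lborel. \<bar>f x\<bar>))"
    proof (intro always_eventually allI)
      fix x
      have "\<bar>ct f x\<bar> * \<bar>g x\<bar> \<le> (LINT x|lborel. \<bar>f x\<bar>) * \<bar>g x\<bar>"
        by (rule mult_right_mono[OF abs_ct_le[OF f]]) simp
      thus "norm (ct f x * g x) \<le> norm (\<bar>g x\<bar> * (LINT x|lborel. \<bar>f x\<bar>))"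
        by (simp add: abs_mult mult.commute)
    qed
  qed (use f in measurable)
qed

section \<open>Gaussians, uniqueness and inversion\<close>

lemma ct_normal_density:
  assumes "\<sigma> > 0"
  shows "ct (normal_density 0 \<sigma>) t = exp (- (2 * pi * \<sigma> * t)\<^sup>2 / 2)"
proof -
  have std: "(LINT x|lborel. cos (s * x) * std_normal_density x) = exp (- s\<^sup>2 / 2)" for s
  proof -
    have i: "integrable lborel (\<lambda>x. iexp (s * x) * complex_of_real (std_normal_density x))"
    proof (rule Bochner_Integration.integrable_bound[where f = std_normal_density])
      show "integrable lborel std_normal_density" by simp
    qed (auto simp: norm_mult)
    have "Re (char std_normal_distribution s) = Re (LINT x|lborel. iexp (s * x) * complex_of_real (std_normal_density x))"
      unfolding char_def by (subst integral_density) (auto simp: scaleR_conv_of_real mult.commute)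
    also have "\<dots> = (LINT x|lborel. cos (s * x) * std_normal_density x)"
      unfolding integral_Re[OF i, symmetric] by (simp flip: cis_conv_exp of_real_mult)
    finally show ?thesis by (simp add: char_std_normal_distribution)
  qed
  have "ct (normal_density 0 \<sigma>) t = \<bar>\<sigma>\<bar> *\<^sub>R (LINT x|lborel. cos (2 * pi * (0 + \<sigma> * x) * t) * normal_density 0 \<sigma> (0 + \<sigma> * x))"
    unfolding ct_def using assms by (subst lborel_integral_real_affine[where c = \<sigma> and t = 0]) auto
  also have "\<dots> = (LINT x|lborel. cos (2 * pi * \<sigma> * t * x) * std_normal_density x)"
    using assms by (simp add: normal_density_def power_mult_distrib real_sqrt_mult field_simps flip: integral_mult_right_zero)
  finally show ?thesis by (simp add: std)
qed

text \<open>Normalised by the value 1 at 0 rather than by mass: it serves as a summability factor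
  tending to 1 as e tends to 0, and its transform is a probability density of standard deviation e /
  (2 pi).\<close>

definition gauss :: "real \<Rightarrow> real \<Rightarrow> real" where
  "gauss e t = exp (- (e * t)\<^sup>2 / 2)"

lemma gauss_conv_density:
  assumes "e > 0"
  shows "gauss e = (\<lambda>t. sqrt (2 * pi) / e * normal_density 0 (1 / e) t)"
  using assms by (auto simp: gauss_def normal_density_def fun_eq_iff real_sqrt_mult real_sqrt_divide power_mult_distrib field_simps)

lemma integrable_gauss: "e > 0 \<Longrightarrow> integrable lborel (gauss e)"
  by (simp add: gauss_conv_density)

lemma gauss_bounds: "0 < gauss e t" "gauss e t \<le> 1"
  by (auto simp: gauss_def)

lemma gauss_minus [simp]: "gauss e (- t) = gauss e t"
  by (simp add: gauss_def)

lemma borel_measurable_gauss [measurable]: "gauss e \<in> borel_measurable borel"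
  unfolding gauss_def by measurable

lemma ct_gauss:
  assumes "e > 0"
  shows "ct (gauss e) = normal_density 0 (e / (2 * pi))"
proof
  fix x
  have "ct (gauss e) x = sqrt (2 * pi) / e * exp (- (2 * pi * (1 / e) * x)\<^sup>2 / 2)"
    using assms by (simp only: gauss_conv_density ct_cmult) (simp add: ct_normal_density)
  also have "sqrt (2 * pi) / e = 1 / sqrt (2 * pi * (e / (2 * pi))\<^sup>2)"
  proof -
    have "2 * pi * (e / (2 * pi))\<^sup>2 = e\<^sup>2 / (2 * pi)" by (simp add: power2_eq_square field_simps)
    thus ?thesis using assms by (simp add: real_sqrt_divide)
  qed
  also have "- (2 * pi * (1 / e) * x)\<^sup>2 / 2 = - x\<^sup>2 / (2 * (e / (2 * pi))\<^sup>2)"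
    using assms by (simp add: field_simps power2_eq_square)
  finally show "ct (gauss e) x = normal_density 0 (e / (2 * pi)) x"
    by (simp add: normal_density_def)
qed

lemma ct_ct_gauss:
  assumes "e > 0"
  shows "ct (ct (gauss e)) = gauss e"
  using assms by (auto simp: ct_gauss ct_normal_density gauss_def fun_eq_iff)

text \<open>Averaging two opposite translates keeps an even function even and merely multiplies its
  transform by a cosine, so translations can be handled within real cosine transforms.\<close>

definition sym_shift :: "real \<Rightarrow> (real \<Rightarrow> real) \<Rightarrow> real \<Rightarrow> real" where
  "sym_shift x f y = (f (y + x) + f (y - x)) / 2"

lemma integrable_sym_shift:
  assumes "integrable lborel f"
  shows "integrable lborel (sym_shift x f)"
  unfolding sym_shift_def
  using lborel_integrable_real_affine[OF assms, of 1 x] lborel_integrable_real_affine[OF assms, of 1 "-x"]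
  by (simp add: add.commute)

lemma integral_sin_even:
  assumes "\<And>x. f (- x) = f x"
  shows "(LINT x|lborel. sin (s * x) * f x) = (0 :: real)"
proof -
  have "(LINT x|lborel. sin (s * x) * f x) = \<bar>-1\<bar> *\<^sub>R (LINT x|lborel. sin (s * (0 + -1 * x)) * f (0 + -1 * x))"
    by (rule lborel_integral_real_affine) simp
  also have "\<dots> = - (LINT x|lborel. sin (s * x) * f x)"
    using assms by simp
  finally show ?thesis by simp
qed

text \<open>After the translation the addition formula leaves a cosine and a sine integral; the sine
  integral vanishes because \<open>f\<close> is even.\<close>

lemma ct_sym_shift:
  assumes f: "integrable lborel f" and ev: "\<And>x. f (- x) = f x"
  shows "ct (sym_shift x f) t = cos (2 * pi * x * t) * ct f t"
proof -
  have sh: "(LINT y|lborel. cos (2 * pi * y * t) * f (y + a)) = cos (2 * pi * a * t) * ct f t" for a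
  proof -
    have "(LINT y|lborel. cos (2 * pi * y * t) * f (y + a))
        = \<bar>1\<bar> *\<^sub>R (LINT y|lborel. cos (2 * pi * (- a + 1 * y) * t) * f (- a + 1 * y + a))"
      by (rule lborel_integral_real_affine) simp
    also have "\<dots> = (LINT y|lborel. cos (2 * pi * a * t) * (cos (2 * pi * y * t) * f y)
        + sin (2 * pi * a * t) * (sin (2 * pi * t * y) * f y))"
      unfolding abs_one scaleR_one by (intro Bochner_Integration.integral_cong refl)
        (simp add: algebra_simps cos_diff)
    also have "\<dots> = cos (2 * pi * a * t) * ct f t"
      using integrable_cos_mult[OF f] integrable_sin_mult[OF f] integral_sin_even[of f "2 * pi * t"] ev
      by (simp add: ct_def)
    finally show ?thesis .
  qed
  have i: "integrable lborel (\<lambda>y. cos (2 * pi * y * t) * f (y + a))" for a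
    using lborel_integrable_real_affine[OF f, of 1 a]
    by (intro integrable_cos_mult) (simp add: add.commute)
  have "ct (sym_shift x f) t = (LINT y|lborel. (1/2) * (cos (2 * pi * y * t) * f (y + x)) + (1/2) * (cos (2 * pi * y * t) * f (y + - x)))"
    unfolding ct_def sym_shift_def by (intro Bochner_Integration.integral_cong refl) (simp add: field_simps)
  also have "\<dots> = (1/2) * (LINT y|lborel. (cos (2 * pi * y * t) * f (y + x))) + (1/2) * (LINT y|lborel. (cos (2 * pi * y * t) * f (y + - x)))"
    using i[of x] i[of "-x"] by simp
  also have "\<dots> = cos (2 * pi * x * t) * ct f t" unfolding sh by simp
  finally show ?thesis .
qed

lemma ct_gauss_cos:
  assumes "e > 0"
  shows "ct (\<lambda>t. cos (2 * pi * x * t) * gauss e t) y = sym_shift x (ct (gauss e)) y"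
proof -
  have i: "integrable lborel (\<lambda>u. cos (2 * pi * u * t) * gauss e u)" for t
    by (rule integrable_cos_mult[OF integrable_gauss[OF assms]])
  have "ct (\<lambda>t. cos (2 * pi * x * t) * gauss e t) y
      = (LINT u|lborel. (1/2) * (cos (2 * pi * u * (y + x)) * gauss e u) + (1/2) * (cos (2 * pi * u * (y - x)) * gauss e u))"
    unfolding ct_def by (intro Bochner_Integration.integral_cong refl)
      (simp add: algebra_simps cos_diff cos_add)
  also have "\<dots> = sym_shift x (ct (gauss e)) y"
    using i[of "y + x"] i[of "y - x"] by (simp add: sym_shift_def ct_def)
  finally show ?thesis .
qed

text \<open>Since \<open>ct f 0 = 0\<close>, the positive and negative parts have the same mass. If
  it is nonzero, both normalise to probability densities; evenness makes their characteristic
  functions real and equal to rescaled cosine transforms, and Levy's uniqueness theorem identifies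
  the two.\<close>

lemma ct_inj_even:
  assumes f: "integrable lborel f" and ev: "\<And>x. f (- x) = f x" and z: "\<And>t. ct f t = 0"
  shows "AE x in lborel. f x = 0"
proof -
  note [measurable] = borel_measurable_integrable[OF f]
  define p where "p x = max 0 (f x)" for x
  define n where "n x = max 0 (- f x)" for x
  have [measurable]: "p \<in> borel_measurable borel" "n \<in> borel_measurable borel" unfolding p_def n_def by measurable
  have fpn: "f x = p x - n x" for x by (simp add: p_def n_def)
  have ip: "integrable lborel p" and inn: "integrable lborel n"
    unfolding p_def n_def by (auto intro!: integrable_max f)
  have "ct f 0 = (LINT x|lborel. p x) - (LINT x|lborel. n x)"
    using ip inn by (simp add: ct_def fpn)
  hence m: "(LINT x|lborel. n x) = (LINT x|lborel. p x)" using z[of 0] by simp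
  define m where "m = (LINT x|lborel. p x)"
  have m0: "m \<ge> 0" unfolding m_def by (intro Bochner_Integration.integral_nonneg) (simp add: p_def)
  show ?thesis
  proof (cases "m = 0")
    case True
    have "AE x in lborel. p x = 0"
      using True integral_nonneg_eq_0_iff_AE[OF ip] unfolding m_def by (simp add: p_def[THEN arg_cong[where f = "\<lambda>z. 0 \<le> z"]])
    moreover have "AE x in lborel. n x = 0"
      using True m integral_nonneg_eq_0_iff_AE[OF inn] unfolding m_def by (simp add: n_def[THEN arg_cong[where f = "\<lambda>z. 0 \<le> z"]])
    ultimately show ?thesis by eventually_elim (simp add: fpn)
  next
    case False
    hence mpos: "m > 0" using m0 by simp
    have rd: "real_distribution (density lborel (\<lambda>x. ennreal (q x / m)))"
      if q: "integrable lborel q" "\<And>x. q x \<ge> 0" "(LINT x|lborel. q x) = m" for q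
    proof -
      note [measurable] = borel_measurable_integrable[OF q(1)]
      have "(\<integral>\<^sup>+x. ennreal (q x / m) \<partial>lborel) = ennreal (LINT x|lborel. q x / m)"
        using q mpos by (intro nn_integral_eq_integral) auto
      also have "\<dots> = 1" using q mpos by simp
      finally show ?thesis
        by (intro real_distribution.intro prob_spaceI real_distribution_axioms.intro)
          (auto simp: emeasure_density)
    qed
    define M1 where "M1 = density lborel (\<lambda>x. ennreal (p x / m))"
    define M2 where "M2 = density lborel (\<lambda>x. ennreal (n x / m))"
    have 1: "real_distribution M1" unfolding M1_def m_def[symmetric]
      by (rule rd[OF ip]) (simp_all add: m_def, simp add: p_def)
    have 2: "real_distribution M2" unfolding M2_def
      by (rule rd[OF inn]) (simp_all add: m m_def, simp add: n_def)
    have ch: "char (density lborel (\<lambda>x. ennreal (q x / m))) s = Complex (ct q (s / (2 * pi)) / m) 0"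
      if q: "integrable lborel q" "\<And>x. q x \<ge> 0" "\<And>x. q (- x) = q x" for q s
    proof -
      note [measurable] = borel_measurable_integrable[OF q(1)]
      have i: "integrable lborel (\<lambda>x. (q x / m) *\<^sub>R iexp (s * x))"
        by (rule Bochner_Integration.integrable_bound[where f = "\<lambda>x. q x / m"]) (auto simp: q)
      have e: "char (density lborel (\<lambda>x. ennreal (q x / m))) s = (LINT x|lborel. (q x / m) *\<^sub>R iexp (s * x))"
        unfolding char_def using q mpos by (subst integral_density) auto
      have "Re (LINT x|lborel. (q x / m) *\<^sub>R iexp (s * x)) = (LINT x|lborel. (cos (s * x) * q x) / m)"
        unfolding integral_Re[OF i, symmetric]
        by (simp add: mult.commute flip: cis_conv_exp of_real_mult)
      also have "\<dots> = ct q (s / (2 * pi)) / m" by (simp add: ct_def mult.commute)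
      finally have re: "Re (LINT x|lborel. (q x / m) *\<^sub>R iexp (s * x)) = ct q (s / (2 * pi)) / m" .
      have "Im (LINT x|lborel. (q x / m) *\<^sub>R iexp (s * x)) = (LINT x|lborel. (sin (s * x) * q x) / m)"
        unfolding integral_Im[OF i, symmetric]
        by (simp add: mult.commute flip: cis_conv_exp of_real_mult)
      also have "\<dots> = 0" using integral_sin_even[of q s] q(3) by simp
      finally show ?thesis using re e by (simp add: complex_eq_iff)
    qed
    have "ct p t = ct n t" for t
      using z[of t] ct_diff[OF ip inn, of t] by (simp add: fpn[abs_def])
    moreover have "p x \<ge> 0" "n x \<ge> 0" "p (- x) = p x" "n (- x) = n x" for x
      by (simp_all add: p_def n_def ev)
    ultimately have "char M1 = char M2"
      unfolding M1_def M2_def by (simp add: fun_eq_iff ch ip inn)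
    hence "M1 = M2" by (rule Levy_uniqueness[OF 1 2])
    hence "AE x in lborel. ennreal (p x / m) = ennreal (n x / m)"
      unfolding M1_def M2_def by (subst (asm) sigma_finite_measure.density_unique_iff[OF lborel.sigma_finite_measure_axioms]) auto
    thus ?thesis
    proof eventually_elim
      case (elim x)
      hence "p x / m = n x / m" using mpos by (subst (asm) ennreal_inj) (auto simp: p_def n_def)
      thus ?case using mpos by (simp add: fpn)
    qed
  qed
qed

text \<open>\<open>ct (ct g)\<close> is bounded but not known to be integrable, so both sides are
  multiplied by a Gaussian. The products have equal transforms by repeated use of the multiplication
  formula, and uniqueness applies.\<close>

lemma ct_inversion_AE:
  assumes g: "integrable lborel g" and ev: "\<And>x. g (- x) = g x" and G: "integrable lborel (ct g)"
  shows "AE t in lborel. ct (ct g) t = g t"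
proof -
  note [measurable] = borel_measurable_integrable[OF g] borel_measurable_ct[OF G]
  let ?\<gamma> = "gauss 1"
  have g\<gamma>: "integrable lborel (\<lambda>t. ?\<gamma> t * g t)"
    by (rule Bochner_Integration.integrable_bound[OF g])
      (auto simp: abs_mult gauss_bounds less_imp_le mult_left_le_one_le)
  have G\<gamma>: "integrable lborel (\<lambda>t. ?\<gamma> t * ct (ct g) t)"
    using ct_mult_formula(2)[OF G integrable_gauss[of 1]] by (simp add: mult.commute)
  have ik: "integrable lborel (ct ?\<gamma>)" by (simp add: ct_gauss)
  have "ct (\<lambda>t. ?\<gamma> t * ct (ct g) t) x = ct (\<lambda>t. ?\<gamma> t * g t) x" for x
  proof -
    have "ct (\<lambda>t. ?\<gamma> t * ct (ct g) t) x = (LINT t|lborel. ct (ct g) t * (cos (2 * pi * x * t) * ?\<gamma> t))"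
      unfolding ct_def[of "\<lambda>t. ?\<gamma> t * ct (ct g) t"] by (simp add: mult_ac)
    \<comment> \<open>A Gaussian times a cosine has the symmetrised translate of a normal density as
      its transform. This is integrable, so the formula can be used once more, and the Gaussian
      times the cosine comes back.\<close>
    also have "\<dots> = (LINT y|lborel. ct g y * sym_shift x (ct ?\<gamma>) y)"
      using integrable_cos_mult[OF integrable_gauss[of 1], of x]
      by (subst ct_mult_formula(1)[OF G]) (use ct_gauss_cos[of 1 x] in \<open>simp_all add: mult.commute[of x] mult.left_commute[of x] mult.assoc\<close>)
    also have "\<dots> = (LINT t|lborel. g t * ct (sym_shift x (ct ?\<gamma>)) t)"
      by (rule ct_mult_formula(1)[OF g integrable_sym_shift[OF ik]])
    also have "\<dots> = (LINT t|lborel. g t * (cos (2 * pi * x * t) * ?\<gamma> t))"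
      by (subst ct_sym_shift[OF ik]) (auto simp: ct_ct_gauss ct_minus)
    also have "\<dots> = ct (\<lambda>t. ?\<gamma> t * g t) x" unfolding ct_def by (simp add: mult_ac)
    finally show ?thesis .
  qed
  hence "AE t in lborel. ?\<gamma> t * ct (ct g) t - ?\<gamma> t * g t = 0"
    using g\<gamma> G\<gamma> by (intro ct_inj_even) (auto simp: ct_diff ct_minus ev)
  thus ?thesis
  proof eventually_elim
    case (elim t)
    thus ?case using gauss_bounds(1)[of 1 t] by (simp flip: right_diff_distrib)
  qed
qed

section \<open>Summability and integrability of the transform\<close>

lemma classApD:
  assumes "F \<in> classAp"
  shows "integrable lborel F" "F (- x) = F x" "isCont F x"
  using assms by (auto simp: classAp_def continuous_on_eq_continuous_at)

text \<open>Follows from exp u \<ge> u and sqrt (2 pi) \<ge> 1. Its purpose is a bound, uniform away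
  from the origin, that tends to 0 with the deviation.\<close>

lemma normal_density_tail:
  assumes "\<sigma> > 0" "\<bar>x\<bar> \<ge> d" "d > 0"
  shows "normal_density 0 \<sigma> x \<le> 2 * \<sigma> / d\<^sup>2"
proof -
  have "1 + x\<^sup>2 / (2 * \<sigma>\<^sup>2) \<le> exp (x\<^sup>2 / (2 * \<sigma>\<^sup>2))" by (rule exp_ge_add_one_self)
  hence e: "x\<^sup>2 / (2 * \<sigma>\<^sup>2) \<le> exp (x\<^sup>2 / (2 * \<sigma>\<^sup>2))" by linarith
  have "d\<^sup>2 \<le> x\<^sup>2" using assms by (simp add: abs_le_square_iff[symmetric])
  hence "d\<^sup>2 / (2 * \<sigma>\<^sup>2) \<le> x\<^sup>2 / (2 * \<sigma>\<^sup>2)" using assms by (simp add: divide_right_mono)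
  hence e2: "d\<^sup>2 / (2 * \<sigma>\<^sup>2) \<le> exp (x\<^sup>2 / (2 * \<sigma>\<^sup>2))" using e by simp
  have "exp (- x\<^sup>2 / (2 * \<sigma>\<^sup>2)) = inverse (exp (x\<^sup>2 / (2 * \<sigma>\<^sup>2)))" by (simp add: exp_minus)
  also have "\<dots> \<le> inverse (d\<^sup>2 / (2 * \<sigma>\<^sup>2))"
    using assms by (intro le_imp_inverse_le e2) auto
  finally have le: "exp (- x\<^sup>2 / (2 * \<sigma>\<^sup>2)) \<le> 2 * \<sigma>\<^sup>2 / d\<^sup>2" by (simp add: field_simps)
  have "1 \<le> sqrt (2 * pi)" using pi_gt3 by simp
  hence "\<sigma> * 1 \<le> \<sigma> * sqrt (2 * pi)" using assms by (intro mult_left_mono) auto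
  hence s: "\<sigma> \<le> sqrt (2 * pi * \<sigma>\<^sup>2)" using assms by (simp add: real_sqrt_mult mult.commute)
  have "normal_density 0 \<sigma> x = exp (- x\<^sup>2 / (2 * \<sigma>\<^sup>2)) / sqrt (2 * pi * \<sigma>\<^sup>2)" by (simp add: normal_density_def)
  also have "\<dots> \<le> (2 * \<sigma>\<^sup>2 / d\<^sup>2) / \<sigma>"
    using assms s le by (intro frac_le) auto
  also have "\<dots> = 2 * \<sigma> / d\<^sup>2" using assms by (simp add: power2_eq_square)
  finally show ?thesis .
qed

lemma normal_density_approx_identity:
  assumes F: "integrable lborel F" and c: "isCont F 0"
    and s: "\<And>n. \<sigma> n > 0" "\<sigma> \<longlonglongrightarrow> 0"
  shows "(\<lambda>n. LINT x|lborel. F x * normal_density 0 (\<sigma> n) x) \<longlonglongrightarrow> F 0"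
proof (rule LIMSEQ_I)
  fix e :: real assume e: "e > 0"
  note [measurable] = borel_measurable_integrable[OF F]
  obtain d where d: "d > 0" "\<And>x. \<bar>x\<bar> < d \<Longrightarrow> \<bar>F x - F 0\<bar> < e / 2"
    using c e unfolding continuous_at_eps_delta dist_real_def by (metis diff_zero half_gt_zero)
  define I where "I = (LINT x|lborel. \<bar>F x\<bar>)"
  have I0: "I \<ge> 0" by (simp add: I_def)
  \<comment> \<open>Near 0, continuity gives e / 2. Away from 0, \<open>F\<close> is paired with the
    uniform tail bound of the density, and the constant \<open>F 0\<close> with a Chebyshev estimate
    through the second moment.\<close>
  have bnd: "\<bar>(LINT x|lborel. F x * normal_density 0 (\<sigma> n) x) - F 0\<bar> \<le> e / 2 + I * (2 * \<sigma> n / d\<^sup>2) + \<bar>F 0\<bar> * (\<sigma> n)\<^sup>2 / d\<^sup>2" for n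
  proof -
    let ?k = "normal_density 0 (\<sigma> n)"
    have ik: "integrable lborel ?k" "(LINT x|lborel. ?k x) = 1" "\<And>x. ?k x \<ge> 0"
      using s(1)[of n] by (auto intro: normal_density_nonneg)
    have kb: "?k x \<le> 1 / sqrt (2 * pi * (\<sigma> n)\<^sup>2)" for x
      by (simp add: normal_density_def divide_right_mono)
    have iFk: "integrable lborel (\<lambda>x. F x * ?k x)"
      by (rule Bochner_Integration.integrable_bound[OF integrable_mult_left[OF F, of "1 / sqrt (2 * pi * (\<sigma> n)\<^sup>2)"]])
        (use kb ik(3) in \<open>auto simp: abs_mult simp del: times_divide_eq_right intro!: mult_left_mono\<close>)
    have ii: "integrable lborel (\<lambda>x. ?k x * x\<^sup>2)" and i2: "(LINT x|lborel. ?k x * x\<^sup>2) = (\<sigma> n)\<^sup>2"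
      using normal_moment_even[OF s(1), of 0 n 1] by (auto simp: has_bochner_integral_iff)
    have "(LINT x|lborel. F x * ?k x) - F 0 = (LINT x|lborel. F x * ?k x) - (LINT x|lborel. F 0 * ?k x)"
      using ik by simp
    also have "\<dots> = (LINT x|lborel. (F x - F 0) * ?k x)"
      using iFk ik by (simp add: left_diff_distrib)
    finally have "\<bar>(LINT x|lborel. F x * ?k x) - F 0\<bar> \<le> (LINT x|lborel. \<bar>(F x - F 0) * ?k x\<bar>)"
      by (simp add: integral_abs_bound)
    also have "\<dots> \<le> (LINT x|lborel. e / 2 * ?k x + \<bar>F x\<bar> * (2 * \<sigma> n / d\<^sup>2) + \<bar>F 0\<bar> * (?k x * x\<^sup>2 / d\<^sup>2))"
    proof (rule integral_mono)
      show "integrable lborel (\<lambda>x. \<bar>(F x - F 0) * ?k x\<bar>)"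
        using iFk ik by (simp add: left_diff_distrib)
      show "integrable lborel (\<lambda>x. e / 2 * ?k x + \<bar>F x\<bar> * (2 * \<sigma> n / d\<^sup>2) + \<bar>F 0\<bar> * (?k x * x\<^sup>2 / d\<^sup>2))"
        using F ik ii by auto
      fix x
      have sn: "2 * \<sigma> n / d\<^sup>2 \<ge> 0" using s(1)[of n] by simp
      show "\<bar>(F x - F 0) * ?k x\<bar> \<le> e / 2 * ?k x + \<bar>F x\<bar> * (2 * \<sigma> n / d\<^sup>2) + \<bar>F 0\<bar> * (?k x * x\<^sup>2 / d\<^sup>2)"
      proof (cases "\<bar>x\<bar> < d")
        case True
        have "\<bar>F x - F 0\<bar> * ?k x \<le> e / 2 * ?k x" using d(2)[OF True] ik(3) by (intro mult_right_mono) auto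
        moreover have "0 \<le> \<bar>F x\<bar> * (2 * \<sigma> n / d\<^sup>2)" by (rule mult_nonneg_nonneg[OF abs_ge_zero sn])
        moreover have "0 \<le> \<bar>F 0\<bar> * (?k x * x\<^sup>2 / d\<^sup>2)" using ik(3)[of x] by simp
        moreover have "\<bar>(F x - F 0) * ?k x\<bar> = \<bar>F x - F 0\<bar> * ?k x" using ik(3)[of x] by (simp add: abs_mult)
        ultimately show ?thesis by linarith
      next
        case False
        have "\<bar>F x - F 0\<bar> * ?k x \<le> (\<bar>F x\<bar> + \<bar>F 0\<bar>) * ?k x" using ik(3) by (intro mult_right_mono) auto
        also have "\<dots> \<le> \<bar>F x\<bar> * (2 * \<sigma> n / d\<^sup>2) + \<bar>F 0\<bar> * ?k x"
          using mult_left_mono[OF normal_density_tail[of "\<sigma> n" d x], of "\<bar>F x\<bar>"] False d(1) s(1)[of n]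
          by (simp only: distrib_right) simp
        also have "\<bar>F 0\<bar> * ?k x \<le> \<bar>F 0\<bar> * (?k x * x\<^sup>2 / d\<^sup>2)"
        proof (rule mult_left_mono)
          have "d\<^sup>2 \<le> x\<^sup>2" using False d(1) by (simp add: abs_le_square_iff[symmetric])
          hence "?k x * d\<^sup>2 \<le> ?k x * x\<^sup>2" using ik(3)[of x] by (intro mult_left_mono) auto
          thus "?k x \<le> ?k x * x\<^sup>2 / d\<^sup>2" using d(1) by (simp add: field_simps)
        qed simp
        finally have "\<bar>F x - F 0\<bar> * ?k x \<le> \<bar>F x\<bar> * (2 * \<sigma> n / d\<^sup>2) + \<bar>F 0\<bar> * (?k x * x\<^sup>2 / d\<^sup>2)"
          by simp
        moreover have "0 \<le> e / 2 * ?k x" using e ik(3)[of x] by simp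
        moreover have "\<bar>(F x - F 0) * ?k x\<bar> = \<bar>F x - F 0\<bar> * ?k x" using ik(3)[of x] by (simp add: abs_mult)
        ultimately show ?thesis by linarith
      qed
    qed
    also have "\<dots> = e / 2 + I * (2 * \<sigma> n / d\<^sup>2) + \<bar>F 0\<bar> * (\<sigma> n)\<^sup>2 / d\<^sup>2"
      using F ik ii i2 by (simp add: I_def)
    finally show ?thesis .
  qed
  have "(\<lambda>n. e / 2 + I * (2 * \<sigma> n / d\<^sup>2) + \<bar>F 0\<bar> * (\<sigma> n)\<^sup>2 / d\<^sup>2) \<longlonglongrightarrow> e / 2 + I * (2 * 0 / d\<^sup>2) + \<bar>F 0\<bar> * 0\<^sup>2 / d\<^sup>2"
    using d(1) by (intro tendsto_intros s) auto
  hence "(\<lambda>n. e / 2 + I * (2 * \<sigma> n / d\<^sup>2) + \<bar>F 0\<bar> * (\<sigma> n)\<^sup>2 / d\<^sup>2) \<longlonglongrightarrow> e / 2" by simp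
  hence "eventually (\<lambda>n. e / 2 + I * (2 * \<sigma> n / d\<^sup>2) + \<bar>F 0\<bar> * (\<sigma> n)\<^sup>2 / d\<^sup>2 < e) sequentially"
    by (rule order_tendstoD(2)) (use e in simp)
  then obtain N where N: "\<And>n. n \<ge> N \<Longrightarrow> e / 2 + I * (2 * \<sigma> n / d\<^sup>2) + \<bar>F 0\<bar> * (\<sigma> n)\<^sup>2 / d\<^sup>2 < e"
    unfolding eventually_sequentially by blast
  show "\<exists>no. \<forall>n\<ge>no. norm ((LINT x|lborel. F x * normal_density 0 (\<sigma> n) x) - F 0) < e"
  proof (intro exI allI impI)
    fix n assume "n \<ge> N"
    from le_less_trans[OF bnd N[OF this]]
    show "norm ((LINT x|lborel. F x * normal_density 0 (\<sigma> n) x) - F 0) < e" by simp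
  qed
qed

text \<open>By the multiplication formula these are integrals of \<open>F\<close> against normal
  densities concentrating at 0, where \<open>F\<close> is continuous.\<close>

lemma ct_gauss_summable:
  assumes "F \<in> classAp"
  shows "(\<lambda>n. LINT t|lborel. ct F t * gauss (1 / real (Suc n)) t) \<longlonglongrightarrow> F 0"
proof -
  have "(\<lambda>n. LINT x|lborel. F x * normal_density 0 (1 / real (Suc n) / (2 * pi)) x) \<longlonglongrightarrow> F 0"
  proof (rule normal_density_approx_identity[OF classApD(1,3)[OF assms]])
    have "(\<lambda>n. 1 / real (Suc n) / (2 * pi)) \<longlonglongrightarrow> 0 / (2 * pi)"
      by (intro tendsto_divide LIMSEQ_Suc[OF lim_1_over_n] tendsto_const) auto
    thus "(\<lambda>n. 1 / real (Suc n) / (2 * pi)) \<longlonglongrightarrow> 0" by simp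
  qed simp
  thus ?thesis
    by (simp add: ct_mult_formula(1)[OF classApD(1)[OF assms] integrable_gauss] ct_gauss)
qed

lemma gauss_tendsto_1: "(\<lambda>n. gauss (1 / real (Suc n)) t) \<longlonglongrightarrow> 1"
proof -
  have "(\<lambda>n. gauss (1 / real (Suc n)) t) \<longlonglongrightarrow> gauss 0 t"
    unfolding gauss_def by (intro tendsto_intros LIMSEQ_Suc[OF lim_1_over_n]) auto
  thus ?thesis by (simp add: gauss_def)
qed

lemma integral_ct_eq_at_0:
  assumes F: "F \<in> classAp" and i: "integrable lborel (ct F)"
  shows "(LINT t|lborel. ct F t) = F 0"
proof -
  note [measurable] = borel_measurable_ct[OF classApD(1)[OF F]]
  have "(\<lambda>n. LINT t|lborel. ct F t * gauss (1 / real (Suc n)) t) \<longlonglongrightarrow> (LINT t|lborel. ct F t)"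
  proof (rule integral_dominated_convergence[where w = "\<lambda>t. \<bar>ct F t\<bar>"])
    show "integrable lborel (\<lambda>t. \<bar>ct F t\<bar>)" using i by simp
    show "AE t in lborel. (\<lambda>n. ct F t * gauss (1 / real (Suc n)) t) \<longlonglongrightarrow> ct F t"
      using tendsto_mult[OF tendsto_const gauss_tendsto_1] by (auto intro!: always_eventually)
    show "AE t in lborel. norm (ct F t * gauss (1 / real (Suc n)) t) \<le> \<bar>ct F t\<bar>" for n
      by (auto intro!: always_eventually simp: abs_mult mult_left_le gauss_bounds less_imp_le)
  qed measurable
  thus ?thesis using ct_gauss_summable[OF F] LIMSEQ_unique by blast
qed

text \<open>By Gaussian summation the negative part of the transform has mass at most that of the
  positive part minus \<open>F 0\<close>.\<close>

lemma integrable_ct_if_pos_part: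
  assumes F: "F \<in> classAp" and p: "integrable lborel (\<lambda>t. max 0 (ct F t))"
  shows "integrable lborel (ct F)"
proof -
  note [measurable] = borel_measurable_ct[OF classApD(1)[OF F]]
  define P where "P = (LINT t|lborel. max 0 (ct F t))"
  define g where "g n t = gauss (1 / real (Suc n)) t" for n t
  have g: "g n t > 0" "g n t \<le> 1" for n t by (simp_all add: g_def gauss_bounds)
  have [measurable]: "g n \<in> borel_measurable borel" for n unfolding g_def by measurable
  define q where "q t = max 0 (- ct F t)" for t
  have [measurable]: "q \<in> borel_measurable borel" unfolding q_def by measurable
  have q0: "q t \<ge> 0" for t by (simp add: q_def)
  have iq: "integrable lborel (\<lambda>t. q t * g n t)" for n
  proof (rule Bochner_Integration.integrable_bound)
    show "integrable lborel (\<lambda>t. ct F t * g n t)"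
      unfolding g_def by (rule ct_mult_formula(2)[OF classApD(1)[OF F] integrable_gauss]) simp
  qed (auto simp: q_def abs_mult intro!: mult_right_mono)
  have le: "(LINT t|lborel. q t * g n t) \<le> P - (LINT t|lborel. ct F t * g n t)" for n
  proof -
    have ip: "integrable lborel (\<lambda>t. max 0 (ct F t) * g n t)"
      by (rule Bochner_Integration.integrable_bound[OF p]) (auto simp: abs_mult mult_left_le g less_imp_le)
    have "(LINT t|lborel. ct F t * g n t) = (LINT t|lborel. max 0 (ct F t) * g n t - q t * g n t)"
      by (intro Bochner_Integration.integral_cong refl) (auto simp: q_def max_def)
    also have "\<dots> = (LINT t|lborel. max 0 (ct F t) * g n t) - (LINT t|lborel. q t * g n t)"
      using ip iq by simp
    also have "(LINT t|lborel. max 0 (ct F t) * g n t) \<le> P"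
      unfolding P_def by (intro integral_mono ip p) (auto simp: mult_left_le g)
    finally show ?thesis by simp
  qed
  have "(\<lambda>n. P - (LINT t|lborel. ct F t * g n t)) \<longlonglongrightarrow> P - F 0"
    unfolding g_def by (intro tendsto_intros ct_gauss_summable F)
  \<comment> \<open>A convergent sequence is bounded. This gives one bound for all Gaussian-weighted
    masses of the negative part, from which Fatou's lemma removes the weight.\<close>
  hence "Bseq (\<lambda>n. P - (LINT t|lborel. ct F t * g n t))"
    by (intro convergent_imp_Bseq) (auto simp: convergent_def)
  then obtain B where B: "\<And>n. \<bar>P - (LINT t|lborel. ct F t * g n t)\<bar> \<le> B"
    by (auto simp: Bseq_def)
  have "(\<integral>\<^sup>+t. ennreal (q t) \<partial>lborel) = (\<integral>\<^sup>+t. liminf (\<lambda>n. ennreal (q t * g n t)) \<partial>lborel)"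
  proof (rule nn_integral_cong)
    fix t
    have "(\<lambda>n. q t * g n t) \<longlonglongrightarrow> q t"
      using tendsto_mult[OF tendsto_const gauss_tendsto_1] by (simp add: g_def)
    hence "(\<lambda>n. ennreal (q t * g n t)) \<longlonglongrightarrow> ennreal (q t)" by (rule tendsto_ennrealI)
    thus "ennreal (q t) = liminf (\<lambda>n. ennreal (q t * g n t))"
      by (rule lim_imp_Liminf[symmetric, OF sequentially_bot])
  qed
  also have "\<dots> \<le> liminf (\<lambda>n. \<integral>\<^sup>+t. ennreal (q t * g n t) \<partial>lborel)"
    by (rule nn_integral_liminf) measurable
  also have "\<dots> \<le> limsup (\<lambda>n. \<integral>\<^sup>+t. ennreal (q t * g n t) \<partial>lborel)"
    by (rule Liminf_le_Limsup) simp
  also have "\<dots> \<le> ennreal B"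
  proof (rule Limsup_bounded, intro always_eventually allI)
    fix n
    have "(\<integral>\<^sup>+t. ennreal (q t * g n t) \<partial>lborel) = ennreal (LINT t|lborel. q t * g n t)"
      using q0 g by (intro nn_integral_eq_integral iq) (auto simp: less_imp_le)
    also have "\<dots> \<le> ennreal B" using le[of n] B[of n] by (intro ennreal_leI) linarith
    finally show "(\<integral>\<^sup>+t. ennreal (q t * g n t) \<partial>lborel) \<le> ennreal B" .
  qed
  finally have "(\<integral>\<^sup>+t. ennreal (q t) \<partial>lborel) < \<infinity>" by (rule le_less_trans) simp
  hence "integrable lborel q" using q0 by (intro integrableI_nonneg) auto
  hence "integrable lborel (\<lambda>t. max 0 (ct F t) - q t)" using p by simp
  moreover have "(\<lambda>t. max 0 (ct F t) - q t) = ct F" by (auto simp: q_def fun_eq_iff max_def)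
  ultimately show ?thesis by simp
qed

definition penalty :: "(real \<Rightarrow> real) \<Rightarrow> ennreal" where
  "penalty F = (\<integral>\<^sup>+ t. ennreal (max 0 (ct F t)) * indicator outer t \<partial>lborel)"

lemma integrable_ct_on_bounded:
  assumes "integrable lborel F" "S \<in> sets borel" "S \<subseteq> {-b..b}"
  shows "integrable lborel (\<lambda>t. ct F t * indicator S t)"
proof (rule ct_mult_formula(2)[OF assms(1)])
  have "emeasure lborel S \<le> emeasure lborel {-b..b}" by (rule emeasure_mono) (use assms in auto)
  also have "\<dots> < \<infinity>" by (simp add: emeasure_lborel_Icc_eq)
  finally show "integrable lborel (indicator S :: real \<Rightarrow> real)"
    using assms(2) by (simp add: integrable_indicator_iff)
qed

text \<open>On [-1, 1] the continuous bounded transform is integrable anyway, so a finite penalty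
  makes its positive part integrable on the whole line, and with it the transform itself.\<close>

lemma integrable_ct_if_penalty:
  assumes F: "F \<in> classAp" and p: "penalty F \<noteq> \<infinity>"
  shows "integrable lborel (ct F)"
    and "penalty F = ennreal (LINT t|lborel. max 0 (ct F t) * indicator outer t)"
    and "integrable lborel (\<lambda>t. max 0 (ct F t) * indicator outer t)"
proof -
  note [measurable] = borel_measurable_ct[OF classApD(1)[OF F]]
  have eq: "ennreal (max 0 (ct F t)) * indicator outer t = ennreal (max 0 (ct F t) * indicator outer t)" for t
    by (simp split: split_indicator)
  show o: "integrable lborel (\<lambda>t. max 0 (ct F t) * indicator outer t)"
    using p unfolding penalty_def eq by (intro integrableI_nonneg) (auto simp: less_top)
  show "penalty F = ennreal (LINT t|lborel. max 0 (ct F t) * indicator outer t)"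
    unfolding penalty_def eq by (rule nn_integral_eq_integral[OF o]) auto
  have i: "integrable lborel (\<lambda>t. ct F t * indicator {-1..1} t)"
    by (rule integrable_ct_on_bounded[OF classApD(1)[OF F]]) auto
  have "integrable lborel (\<lambda>t. max 0 (ct F t * indicator {-1..1} t) + max 0 (ct F t) * indicator outer t)"
    using i o by simp
  moreover have "(\<lambda>t. max 0 (ct F t * indicator {-1..1} t) + max 0 (ct F t) * indicator outer t) = (\<lambda>t. max 0 (ct F t))"
    by (auto simp: fun_eq_iff indicator_def)
  ultimately show "integrable lborel (ct F)"
    by (intro integrable_ct_if_pos_part[OF F]) simp
qed

section \<open>Duality and the upper bounds\<close>

text \<open>Outside [-1, 1] the integrand x - A x_+ is at most m x for both signs of x because 1 - A
  \<le> m \<le> 1; inside there is equality. The multiplication formula then moves the transform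
  onto \<open>m\<close>.\<close>

lemma duality_bound:
  fixes m :: "real \<Rightarrow> real"
  assumes F: "F \<in> classAp" and iF: "integrable lborel (ct F)"
    and m: "integrable lborel m" "\<And>t. \<bar>t\<bar> \<le> 1 \<Longrightarrow> m t = 1" "\<And>t. 1 - A \<le> m t" "\<And>t. m t \<le> 1"
  shows "F 0 - A * (LINT t|lborel. max 0 (ct F t) * indicator outer t) \<le> (LINT x|lborel. F x * ct m x)"
proof -
  note iF0 = classApD(1)[OF F]
  note [measurable] = borel_measurable_ct[OF iF0] borel_measurable_integrable[OF m(1)]
  have o: "integrable lborel (\<lambda>t. max 0 (ct F t) * indicator outer t)"
    by (rule Bochner_Integration.integrable_bound[OF iF]) (auto split: split_indicator)
  have "F 0 - A * (LINT t|lborel. max 0 (ct F t) * indicator outer t)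
      = (LINT t|lborel. ct F t - A * (max 0 (ct F t) * indicator outer t))"
    using iF o by (simp add: integral_ct_eq_at_0[OF F iF])
  also have "\<dots> \<le> (LINT t|lborel. ct F t * m t)"
  proof (rule integral_mono)
    show "integrable lborel (\<lambda>t. ct F t - A * (max 0 (ct F t) * indicator outer t))"
      using iF o by simp
    show "integrable lborel (\<lambda>t. ct F t * m t)" by (rule ct_mult_formula(2)[OF iF0 m(1)])
    fix t
    have "ct F t - A * max 0 (ct F t) \<le> ct F t * m t"
    proof (cases "ct F t \<ge> 0")
      case True
      have "ct F t * (1 - A) \<le> ct F t * m t" by (rule mult_left_mono[OF m(3) True])
      thus ?thesis using True by (simp add: algebra_simps)
    next
      case False
      hence "ct F t * 1 \<le> ct F t * m t" by (intro mult_left_mono_neg m) simp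
      thus ?thesis using False by simp
    qed
    thus "ct F t - A * (max 0 (ct F t) * indicator outer t) \<le> ct F t * m t"
      using m(2)[of t] by (auto split: split_indicator)
  qed
  also have "\<dots> = (LINT x|lborel. F x * ct m x)" by (rule ct_mult_formula(1)[OF iF0 m(1)])
  finally show ?thesis .
qed

lemma integral_mult_le_L1norm:
  fixes F \<psi> :: "real \<Rightarrow> real"
  assumes F: "integrable lborel F" and p: "\<psi> \<in> borel_measurable borel" "AE x in lborel. \<bar>\<psi> x\<bar> \<le> K"
  shows "(LINT x|lborel. F x * \<psi> x) \<le> K * L1norm F"
proof -
  have ae: "AE x in lborel. \<bar>F x * \<psi> x\<bar> \<le> K * \<bar>F x\<bar>"
    using p(2) by eventually_elim (auto simp: abs_mult mult.commute[of K] intro: mult_left_mono)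
  have "(LINT x|lborel. F x * \<psi> x) \<le> (LINT x|lborel. K * \<bar>F x\<bar>)"
  proof (rule integral_mono_AE)
    show "integrable lborel (\<lambda>x. K * \<bar>F x\<bar>)" using F by simp
    have "integrable lborel (\<lambda>x. K * F x)" using F by simp
    thus "integrable lborel (\<lambda>x. F x * \<psi> x)"
    proof (rule Bochner_Integration.integrable_bound)
      show "AE x in lborel. norm (F x * \<psi> x) \<le> norm (K * F x)"
        using ae by eventually_elim (auto simp: abs_mult intro: order_trans[OF _ mult_right_mono[OF abs_ge_self]])
    qed (use p F in measurable)
    show "AE x in lborel. F x * \<psi> x \<le> K * \<bar>F x\<bar>" using ae by eventually_elim auto
  qed
  thus ?thesis by (simp add: L1norm_def)
qed

section \<open>Explicit transforms of even functions with compact support\<close>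

lemma integral_even_eq_double:
  fixes f :: "real \<Rightarrow> real"
  assumes f: "integrable lborel f" and ev: "\<And>x. f (- x) = f x"
  shows "(LINT x|lborel. f x) = 2 * (LINT x|lborel. indicator {0..} x * f x)"
proof -
  note [measurable] = borel_measurable_integrable[OF f]
  have i: "integrable lborel (\<lambda>x. indicator S x * f x)" if "S \<in> sets borel" for S
    by (rule Bochner_Integration.integrable_bound[OF f]) (use that in \<open>auto split: split_indicator\<close>)
  have "(LINT x|lborel. indicator {..<0} x * f x)
      = \<bar>-1\<bar> *\<^sub>R (LINT x|lborel. indicator {..<0} (0 + -1 * x) * f (0 + -1 * x))"
    by (rule lborel_integral_real_affine) simp
  also have "\<dots> = (LINT x|lborel. indicator {0<..} x * f x)"
    using ev by (simp add: indicator_def)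
  also have "\<dots> = (LINT x|lborel. indicator {0..} x * f x)"
  proof (rule integral_cong_AE)
    show "AE x in lborel. indicator {0<..} x * f x = indicator {0..} x * f x"
      using AE_lborel_singleton[of 0] by eventually_elim (auto split: split_indicator)
  qed measurable
  finally have e: "(LINT x|lborel. indicator {..<0} x * f x) = (LINT x|lborel. indicator {0..} x * f x)" .
  have "(LINT x|lborel. f x) = (LINT x|lborel. indicator {..<0} x * f x + indicator {0..} x * f x)"
    by (intro Bochner_Integration.integral_cong refl) (auto split: split_indicator)
  also have "\<dots> = 2 * (LINT x|lborel. indicator {0..} x * f x)"
    using i e by simp
  finally show ?thesis .
qed

text \<open>Reduces an explicit transform to finding one antiderivative \<open>H\<close> on the
  positive half; evenness and the fundamental theorem of calculus do the rest.\<close>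

lemma ct_radial_compact:
  fixes p H :: "real \<Rightarrow> real"
  assumes b: "b \<ge> 0" and p: "continuous_on {0..b} p"
    and H: "\<And>t. 0 \<le> t \<Longrightarrow> t \<le> b \<Longrightarrow> (H has_real_derivative cos (2 * pi * t * x) * p t) (at t)"
  shows "ct (\<lambda>t. if \<bar>t\<bar> \<le> b then p \<bar>t\<bar> else 0) x = 2 * (H b - H 0)"
    and "integrable lborel (\<lambda>t. if \<bar>t\<bar> \<le> b then p \<bar>t\<bar> else 0)"
proof -
  have "continuous_on {-b..b} (\<lambda>t. p \<bar>t\<bar>)"
    by (rule continuous_on_compose2[OF p]) (auto intro!: continuous_intros)
  hence "integrable lborel (\<lambda>t. indicator {-b..b} t *\<^sub>R p \<bar>t\<bar>)"
    using borel_integrable_atLeastAtMost' unfolding set_integrable_def by blast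
  moreover have eq: "(\<lambda>t. indicator {-b..b} t *\<^sub>R p \<bar>t\<bar>) = (\<lambda>t. if \<bar>t\<bar> \<le> b then p \<bar>t\<bar> else 0)"
    by (auto simp: fun_eq_iff indicator_def)
  ultimately show i: "integrable lborel (\<lambda>t. if \<bar>t\<bar> \<le> b then p \<bar>t\<bar> else 0)" by simp
  have "ct (\<lambda>t. if \<bar>t\<bar> \<le> b then p \<bar>t\<bar> else 0) x
      = 2 * (LINT t|lborel. indicator {0..} t * (cos (2 * pi * t * x) * (if \<bar>t\<bar> \<le> b then p \<bar>t\<bar> else 0)))"
    unfolding ct_def by (rule integral_even_eq_double[OF integrable_cos_mult[OF i]]) simp
  also have "(LINT t|lborel. indicator {0..} t * (cos (2 * pi * t * x) * (if \<bar>t\<bar> \<le> b then p \<bar>t\<bar> else 0)))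
      = (LINT t|lborel. (cos (2 * pi * t * x) * p t) * indicator {0..b} t)"
    using b by (intro Bochner_Integration.integral_cong refl) (auto simp: indicator_def)
  also have "\<dots> = H b - H 0"
  proof -
    have "(\<integral>t. indicator {0..b} t *\<^sub>R (cos (2 * pi * t * x) * p t) \<partial>lborel) = H b - H 0"
      by (rule integral_FTC_Icc[OF b])
        (auto intro!: continuous_intros p has_vector_derivative_at_within DERIV_subset[OF H]
          simp: has_real_derivative_iff_has_vector_derivative[symmetric])
    thus ?thesis by (simp add: mult.commute)
  qed
  finally show "ct (\<lambda>t. if \<bar>t\<bar> \<le> b then p \<bar>t\<bar> else 0) x = 2 * (H b - H 0)" .
qed

lemma integrable_indicator_Icc: "integrable lborel (indicator {-b..b} :: real \<Rightarrow> real)"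
  by (simp add: integrable_indicator_iff emeasure_lborel_Icc_eq)

lemma ct_indicator:
  assumes "b \<ge> 0" "x \<noteq> 0"
  shows "ct (indicator {-b..b}) x = sin (2 * pi * b * x) / (pi * x)"
proof -
  have "ct (\<lambda>t. if \<bar>t\<bar> \<le> b then 1 else 0) x = 2 * (sin (2 * pi * b * x) / (2 * pi * x) - sin (2 * pi * 0 * x) / (2 * pi * x))"
    by (rule ct_radial_compact(1)[OF assms(1), where p = "\<lambda>_. 1" and H = "\<lambda>t. sin (2 * pi * t * x) / (2 * pi * x)"])
      (use assms in \<open>auto intro!: derivative_eq_intros simp: field_simps\<close>)
  moreover have "(\<lambda>t. if \<bar>t\<bar> \<le> b then 1 else 0 :: real) = indicator {-b..b}"
    by (auto simp: fun_eq_iff indicator_def)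
  ultimately show ?thesis using assms by (simp add: field_simps)
qed

text \<open>Unnormalised, with height b and mass b^2: the autocorrelation of an interval of length
  b. Its transform is therefore nonnegative, a Fejer kernel.\<close>

definition tent :: "real \<Rightarrow> real \<Rightarrow> real" where
  "tent b t = max 0 (b - \<bar>t\<bar>)"

lemma tent_conv: "tent b = (\<lambda>t. if \<bar>t\<bar> \<le> b then b - \<bar>t\<bar> else 0)"
  by (auto simp: tent_def fun_eq_iff)

lemma continuous_tent: "continuous_on S (tent b)"
  unfolding tent_def by (intro continuous_intros)

lemma
  assumes "b \<ge> 0"
  shows integrable_tent: "integrable lborel (tent b)"
    and integral_tent: "(LINT t|lborel. tent b t) = b\<^sup>2"
proof -
  show "integrable lborel (tent b)"
    unfolding tent_conv by (rule ct_radial_compact(2)[OF assms, where x = 0 and H = "\<lambda>t. b * t - t\<^sup>2 / 2"])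
      (auto intro!: derivative_eq_intros continuous_intros)
  have "ct (tent b) 0 = 2 * ((b * b - b\<^sup>2 / 2) - (b * 0 - 0\<^sup>2 / 2))"
    unfolding tent_conv by (rule ct_radial_compact(1)[OF assms])
      (auto intro!: derivative_eq_intros continuous_intros)
  thus "(LINT t|lborel. tent b t) = b\<^sup>2" by (simp add: ct_def power2_eq_square)
qed

lemma ct_tent:
  assumes "b \<ge> 0" "x \<noteq> 0"
  shows "ct (tent b) x = (1 - cos (2 * pi * b * x)) / (2 * pi\<^sup>2 * x\<^sup>2)"
proof -
  let ?H = "\<lambda>t. (b - t) * sin (2 * pi * t * x) / (2 * pi * x) - cos (2 * pi * t * x) / (4 * pi\<^sup>2 * x\<^sup>2)"
  have "ct (tent b) x = 2 * (?H b - ?H 0)"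
    unfolding tent_conv by (rule ct_radial_compact(1)[OF assms(1)])
      (use assms in \<open>auto intro!: derivative_eq_intros continuous_intros simp: field_simps power2_eq_square\<close>)
  thus ?thesis by (simp add: diff_divide_distrib)
qed

section \<open>Sup bound for the transform of the dual measure\<close>

definition sin_poly :: "nat \<Rightarrow> real \<Rightarrow> real" where
  "sin_poly n u = (\<Sum>k<n. (-1)^k / fact (2 * k + 1) * u^k)"

definition cos_poly :: "nat \<Rightarrow> real \<Rightarrow> real" where
  "cos_poly n u = (\<Sum>k<n. (-1)^k / fact (2 * k) * u^k)"

text \<open>\<open>sin_poly\<close> and \<open>cos_poly\<close> are the Maclaurin polynomials of sin
  x / x and cos x in the variable x^2; the error is bounded by the first omitted term.\<close>

lemma sin_poly_error: "\<bar>sin x - x * sin_poly n (x\<^sup>2)\<bar> \<le> \<bar>x\<bar> ^ (2 * n + 1) / fact (2 * n + 1)"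
proof -
  have "(\<Sum>m<2 * n + 1. sin_coeff m * x ^ m) = x * sin_poly n (x\<^sup>2)"
  proof (induction n)
    case (Suc n)
    have "(\<Sum>m<2 * Suc n + 1. sin_coeff m * x ^ m) = (\<Sum>m<2 * n + 1. sin_coeff m * x ^ m)
        + (-1)^n / fact (2 * n + 1) * x ^ (2 * n + 1)"
      by (simp add: sin_coeff_def)
    also have "(-1)^n / fact (2 * n + 1) * x ^ (2 * n + 1) = x * ((-1)^n / fact (2 * n + 1) * (x\<^sup>2)^n)"
      by (simp add: power_mult)
    finally show ?case unfolding Suc.IH by (simp add: sin_poly_def distrib_left)
  qed (simp add: sin_poly_def sin_coeff_def)
  thus ?thesis using Maclaurin_sin_bound[of x "2 * n + 1"] by (simp add: field_simps)
qed

lemma cos_poly_error: "\<bar>cos x - cos_poly n (x\<^sup>2)\<bar> \<le> \<bar>x\<bar> ^ (2 * n) / fact (2 * n)"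
proof -
  have e: "(\<Sum>m<2 * n. cos_coeff m * x ^ m) = cos_poly n (x\<^sup>2)"
  proof (induction n)
    case (Suc n)
    have "(\<Sum>m<2 * Suc n. cos_coeff m * x ^ m) = (\<Sum>m<2 * n. cos_coeff m * x ^ m)
        + (-1)^n / fact (2 * n) * x ^ (2 * n)"
      by (simp add: cos_coeff_def)
    thus ?case unfolding Suc.IH by (simp add: cos_poly_def power_mult)
  qed (simp add: cos_poly_def)
  obtain t where "cos x = (\<Sum>m<2 * n. cos_coeff m * x ^ m) + (cos (t + 1/2 * real (2 * n) * pi) / fact (2 * n)) * x ^ (2 * n)"
    using Maclaurin_cos_expansion by blast
  hence "\<bar>cos x - cos_poly n (x\<^sup>2)\<bar> = \<bar>cos (t + 1/2 * real (2 * n) * pi)\<bar> * (\<bar>x\<bar> ^ (2 * n) / fact (2 * n))"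
    unfolding e by (simp add: abs_mult power_abs)
  also have "\<dots> \<le> 1 * (\<bar>x\<bar> ^ (2 * n) / fact (2 * n))"
    by (intro mult_right_mono) auto
  finally show ?thesis by simp
qed

text \<open>The transform of the dual measure, before averaging, in the variable \<theta> = 2 pi x.
  A symmetric pair of point masses contributes twice its weight times a cosine, hence 0.888 = 2 *
  0.444 and 0.0065 = 2 * 0.00325.\<close>

definition dual_kernel :: "real \<Rightarrow> real" where
  "dual_kernel \<theta> = 2 * sin \<theta> / \<theta> - 888/1000 * cos \<theta>
     + 9/100 * (2 * sin (2 * \<theta>) / \<theta> - 2 * sin (3/2 * \<theta>) / \<theta>) - 65/10000 * cos (3 * \<theta>)"

text \<open>Taylor approximation, in v = \<theta>^2, of 1.197 minus the kernel. The gap of 0.002 to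
  the bound 1.199 is reserved for the Taylor remainders.\<close>

definition dual_poly :: "real \<Rightarrow> real" where
  "dual_poly v = 1197/1000 - (2 * sin_poly 12 v - 888/1000 * cos_poly 12 v
     + 9/100 * (4 * sin_poly 12 (4 * v) - 3 * sin_poly 12 (9/4 * v)) - 65/10000 * cos_poly 12 (9 * v))"

lemma dual_poly_expand: "dual_poly v = (3/2000) * v^0 + (-7/6000) * v^1 + (1087/192000) * v^2 + (-557471/161280000) * v^3 + (38984999/46448640000) * v^4 + (-180442813/1857945600000) * v^5 + (89040445463/12752938598400000) * v^6 + (-754534610371/2142493684531200000) * v^7 + (155099468710727/11655165643849728000000) * v^8 + (-329421687870053/839171926357180416000000) * v^9 + (249335380885539191/26786367889321198878720000000) * v^10 + (-9835560043802449199/54215608607986106530529280000000) * v^11"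
proof -
  define c :: "nat \<Rightarrow> real" where "c k = (-1)^k * ((888/1000 + 65/10000 * 9^k) / fact (2 * k)
     - (2 + 9/100 * (4 * 4^k - 3 * (9/4)^k)) / fact (2 * k + 1))" for k :: nat
  have "2 * sin_poly 12 v - 888/1000 * cos_poly 12 v
     + 9/100 * (4 * sin_poly 12 (4 * v) - 3 * sin_poly 12 (9/4 * v)) - 65/10000 * cos_poly 12 (9 * v)
     = (\<Sum>k<12. - c k * v^k)"
    unfolding sin_poly_def cos_poly_def sum_distrib_left sum_subtractf[symmetric] sum.distrib[symmetric]
  proof (rule sum.cong[OF refl])
    fix k :: nat
    have nz: "(fact (2 * k) :: real) \<noteq> 0" "(fact (2 * k + 1) :: real) \<noteq> 0" by simp_all
    show "2 * ((- 1) ^ k / fact (2 * k + 1) * v ^ k) - 888 / 1000 * ((- 1) ^ k / fact (2 * k) * v ^ k)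
        + 9 / 100 * (4 * ((- 1) ^ k / fact (2 * k + 1) * (4 * v) ^ k) - 3 * ((- 1) ^ k / fact (2 * k + 1) * (9 / 4 * v) ^ k))
        - 65 / 10000 * ((- 1) ^ k / fact (2 * k) * (9 * v) ^ k) = - c k * v ^ k"
      unfolding c_def power_mult_distrib using nz by (simp only: divide_inverse) algebra
  qed
  hence "dual_poly v = 1197/1000 + (\<Sum>k<12. c k * v^k)"
    by (simp add: dual_poly_def sum_negf)
  also have "\<dots> = (3/2000) * v^0 + (-7/6000) * v^1 + (1087/192000) * v^2 + (-557471/161280000) * v^3 + (38984999/46448640000) * v^4 + (-180442813/1857945600000) * v^5 + (89040445463/12752938598400000) * v^6 + (-754534610371/2142493684531200000) * v^7 + (155099468710727/11655165643849728000000) * v^8 + (-329421687870053/839171926357180416000000) * v^9 + (249335380885539191/26786367889321198878720000000) * v^10 + (-9835560043802449199/54215608607986106530529280000000) * v^11"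
    by (simp add: c_def lessThan_nat_numeral fact_numeral power_divide)
  finally show ?thesis .
qed

text \<open>Certificate by expansion in the Bernstein basis of degree 11 on [0, 5] and on [5, 10],
  with all coefficients positive. The range of \<open>v\<close> comes from 3.1^2 = 9.61.\<close>

lemma dual_poly_nonneg:
  assumes "0 \<le> v" "v \<le> 961/100"
  shows "0 \<le> dual_poly v"
proof (cases "v \<le> 5")
  case True
  have "dual_poly v = 3/97656250000 * ((v - 0)^0 * (5 - v)^11) + 4/18310546875 * ((v - 0)^1 * (5 - v)^10) + 2121/625000000000 * ((v - 0)^2 * (5 - v)^9) + 5333597/315000000000000 * ((v - 0)^3 * (5 - v)^8) + 3638493647/90720000000000000 * ((v - 0)^4 * (5 - v)^7) + 65094194869/1209600000000000000 * ((v - 0)^5 * (5 - v)^6) + 1104355151644103/24908083200000000000000 * ((v - 0)^6 * (5 - v)^5) + 20299284651562757/836911595520000000000000 * ((v - 0)^7 * (5 - v)^4) + 3212919048072168221/303519938641920000000000000 * ((v - 0)^8 * (5 - v)^3) + 297554162945768757887/65560306746654720000000000000 * ((v - 0)^9 * (5 - v)^2) + 3258235934196639556751183/2092684991353218662400000000000000 * ((v - 0)^10 * (5 - v)^1) + 355684695432682037207540039/1411864807499638190899200000000000000 * ((v - 0)^11 * (5 - v)^0)" unfolding dual_poly_expand by algebra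
  also have "\<dots> \<ge> 0" using assms True by (intro add_nonneg_nonneg mult_nonneg_nonneg zero_le_power) simp_all
  finally show ?thesis .
next
  case False
  have "dual_poly v = 355684695432682037207540039/1411864807499638190899200000000000000 * ((v - 5)^0 * (10 - v)^11) + 40384020018523961705342699/10133001010762953523200000000000000 * ((v - 5)^1 * (10 - v)^10) + 554919620113170669696530413/19252701920449611694080000000000000 * ((v - 5)^2 * (10 - v)^9) + 2693585944528584734717107/21828460227267133440000000000000 * ((v - 5)^3 * (10 - v)^8) + 275899505847078322957360517/802195913352067153920000000000000 * ((v - 5)^4 * (10 - v)^7) + 186992027778493955131685281/286498540482881126400000000000000 * ((v - 5)^5 * (10 - v)^6) + 1244859178306161054567167/1446962325671116800000000000000 * ((v - 5)^6 * (10 - v)^5) + 79107599343341155267900409/100274489169008394240000000000000 * ((v - 5)^7 * (10 - v)^4) + 49564240552605279661247797/100274489169008394240000000000000 * ((v - 5)^8 * (10 - v)^3) + 10126352984931382529897627/50137244584504197120000000000000 * ((v - 5)^9 * (10 - v)^2) + 18230928736435084027333/375653680703078400000000000000 * ((v - 5)^10 * (10 - v)^1) + 10756005113096841607209769/2068161339110798131200000000000000 * ((v - 5)^11 * (10 - v)^0)" unfolding dual_poly_expand by algebra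
  also have "\<dots> \<ge> 0" using assms False by (intro add_nonneg_nonneg mult_nonneg_nonneg zero_le_power) simp_all
  finally show ?thesis .
qed

lemma dual_kernel_upper_small:
  assumes "0 < \<theta>" "\<theta> \<le> 31/10"
  shows "dual_kernel \<theta> \<le> 1199/1000"
proof -
  define v where "v = \<theta>\<^sup>2"
  have v: "0 \<le> v" "v \<le> 961/100"
    using power_mono[OF assms(2), of 2] assms(1) by (auto simp: v_def power2_eq_square)
  have th: "\<theta> ^ 24 \<le> (31/10) ^ 24" using assms by (intro power_mono) auto
  have S: "\<bar>sin (b * \<theta>) / \<theta> - b * sin_poly 12 (b\<^sup>2 * v)\<bar> \<le> b ^ 25 * (31/10) ^ 24 / fact 25" if "b > 0" for b
  proof -
    have "\<bar>sin (b * \<theta>) / \<theta> - b * sin_poly 12 (b\<^sup>2 * v)\<bar> = \<bar>sin (b * \<theta>) - (b * \<theta>) * sin_poly 12 ((b * \<theta>)\<^sup>2)\<bar> / \<theta>"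
      using assms by (simp add: v_def power_mult_distrib field_simps abs_divide flip: abs_divide[of _ \<theta>])
    also have "\<dots> \<le> (\<bar>b * \<theta>\<bar> ^ 25 / fact 25) / \<theta>"
      using sin_poly_error[of "b * \<theta>" 12] assms by (intro divide_right_mono) auto
    also have "\<dots> = b ^ 25 * \<theta> ^ 24 / fact 25"
      using assms that by (simp add: power_mult_distrib abs_mult eval_nat_numeral)
    also have "\<dots> \<le> b ^ 25 * (31/10) ^ 24 / fact 25"
      using that by (intro divide_right_mono mult_left_mono th) auto
    finally show ?thesis .
  qed
  have C: "\<bar>cos (b * \<theta>) - cos_poly 12 (b\<^sup>2 * v)\<bar> \<le> b ^ 24 * (31/10) ^ 24 / fact 24" if "b > 0" for b
  proof -
    have "\<bar>cos (b * \<theta>) - cos_poly 12 (b\<^sup>2 * v)\<bar> \<le> \<bar>b * \<theta>\<bar> ^ 24 / fact 24"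
      using cos_poly_error[of "b * \<theta>" 12] by (simp add: v_def power_mult_distrib)
    also have "\<dots> = b ^ 24 * \<theta> ^ 24 / fact 24"
      using assms that by (simp add: power_mult_distrib abs_mult)
    also have "\<dots> \<le> b ^ 24 * (31/10) ^ 24 / fact 24"
      using that by (intro divide_right_mono mult_left_mono th) auto
    finally show ?thesis .
  qed
  \<comment> \<open>Only cos (3 \<theta>) has a large remainder, at most 0.283, and its weight
    0.0065 brings that down to less than 0.0019. All weighted remainders together stay below
    0.002.\<close>
  have "\<bar>sin \<theta> / \<theta> - sin_poly 12 v\<bar> \<le> 1/100000"
    using S[of 1] by (simp add: fact_numeral power_divide)
  moreover have "\<bar>sin (2 * \<theta>) / \<theta> - 2 * sin_poly 12 (4 * v)\<bar> \<le> 1/100000"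
    using S[of 2] by (simp add: fact_numeral power_divide)
  moreover have "\<bar>sin (3/2 * \<theta>) / \<theta> - 3/2 * sin_poly 12 (9/4 * v)\<bar> \<le> 1/100000"
    using S[of "3/2"] by (simp add: fact_numeral power_divide)
  moreover have "\<bar>cos \<theta> - cos_poly 12 v\<bar> \<le> 1/100000"
    using C[of 1] by (simp add: fact_numeral power_divide)
  moreover have "\<bar>cos (3 * \<theta>) - cos_poly 12 (9 * v)\<bar> \<le> 283/1000"
    using C[of 3] by (simp add: fact_numeral power_divide)
  moreover have "dual_kernel \<theta> = 2 * (sin \<theta> / \<theta>) - 888/1000 * cos \<theta>
     + 9/100 * (2 * (sin (2 * \<theta>) / \<theta>) - 2 * (sin (3/2 * \<theta>) / \<theta>)) - 65/10000 * cos (3 * \<theta>)"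
    by (simp add: dual_kernel_def)
  ultimately show ?thesis
    using dual_poly_nonneg[OF v] unfolding dual_poly_def by argo
qed

text \<open>This is the transform of the indicator of 1.5 \<le> |t| \<le> 2, a set of measure 1. The
  bound is obtained from the product formula for a difference of sines.\<close>

lemma dual_box_bound:
  fixes \<theta> :: real
  assumes "\<theta> > 0"
  shows "\<bar>2 * sin (2 * \<theta>) / \<theta> - 2 * sin (3/2 * \<theta>) / \<theta>\<bar> \<le> 1"
proof -
  have "sin (2 * \<theta>) - sin (3/2 * \<theta>) = 2 * sin (\<theta> / 4) * cos (7 * \<theta> / 4)"
    using sin_diff_sin[of "2 * \<theta>" "3/2 * \<theta>"] by (simp add: field_simps)
  hence "\<bar>sin (2 * \<theta>) - sin (3/2 * \<theta>)\<bar> = 2 * (\<bar>sin (\<theta> / 4)\<bar> * \<bar>cos (7 * \<theta> / 4)\<bar>)"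
    by (simp add: abs_mult)
  also have "\<dots> \<le> 2 * (\<bar>\<theta> / 4\<bar> * 1)"
    by (intro mult_left_mono mult_mono abs_sin_x_le_abs_x) auto
  finally have "\<bar>sin (2 * \<theta>) - sin (3/2 * \<theta>)\<bar> \<le> \<theta> / 2" using assms by simp
  hence "2 * \<bar>sin (2 * \<theta>) - sin (3/2 * \<theta>)\<bar> / \<theta> \<le> 1"
    using assms by (simp add: field_simps)
  moreover have "2 * sin (2 * \<theta>) / \<theta> - 2 * sin (3/2 * \<theta>) / \<theta> = 2 * (sin (2 * \<theta>) - sin (3/2 * \<theta>)) / \<theta>"
    by (simp add: diff_divide_distrib)
  ultimately show ?thesis using assms by (simp only: abs_divide abs_mult)
qed

text \<open>Beyond 3.1 the two main terms are bounded by their common amplitude sqrt ((2 /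
  \<theta>)^2 + 0.888^2) \<le> 1.1, and the two corrections add at most 0.09 + 0.0065.\<close>

lemma dual_kernel_abs_large:
  assumes "31/10 \<le> \<theta>"
  shows "\<bar>dual_kernel \<theta>\<bar> \<le> 1199/1000"
proof -
  let ?a = "2 / \<theta>"
  have a: "0 \<le> ?a" "?a \<le> 20/31" using assms by (auto simp: field_simps)
  have "(?a * sin \<theta> - 888/1000 * cos \<theta>)\<^sup>2 + (?a * cos \<theta> + 888/1000 * sin \<theta>)\<^sup>2 = (?a\<^sup>2 + (888/1000)\<^sup>2) * ((sin \<theta>)\<^sup>2 + (cos \<theta>)\<^sup>2)"
    by algebra
  hence "(?a * sin \<theta> - 888/1000 * cos \<theta>)\<^sup>2 \<le> ?a\<^sup>2 + (888/1000)\<^sup>2"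
    using zero_le_power2[of "?a * cos \<theta> + 888/1000 * sin \<theta>"] by (simp only: sin_cos_squared_add mult_1_right)
  also have "\<dots> \<le> (20/31)\<^sup>2 + (888/1000)\<^sup>2" using power_mono[OF a(2,1), of 2] by simp
  also have "\<dots> \<le> (11/10)\<^sup>2" by (simp add: power2_eq_square)
  finally have 1: "\<bar>?a * sin \<theta> - 888/1000 * cos \<theta>\<bar> \<le> 11/10" by (subst (asm) abs_le_square_iff[symmetric]) simp
  have "\<bar>2 * sin (2 * \<theta>) / \<theta> - 2 * sin (3/2 * \<theta>) / \<theta>\<bar> \<le> 1" using assms by (intro dual_box_bound) simp
  moreover have "\<bar>cos (3 * \<theta>)\<bar> \<le> 1" by simp
  moreover have "2 * sin \<theta> / \<theta> = ?a * sin \<theta>" by simp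
  ultimately show ?thesis using 1 unfolding dual_kernel_def by argo
qed

lemma dual_kernel_bound:
  assumes "\<theta> \<noteq> 0"
  shows "\<bar>dual_kernel \<theta>\<bar> \<le> 1199/1000"
proof -
  have pos: "\<bar>dual_kernel \<theta>\<bar> \<le> 1199/1000" if "\<theta> > 0" for \<theta>
  proof (cases "\<theta> \<le> 31/10")
    case True
    \<comment> \<open>Since 3.1 < pi, the leading sine term is nonnegative; the remaining terms
      cannot go below minus 0.888 + 0.09 + 0.0065.\<close>
    have "sin \<theta> \<ge> 0" using that True pi_approx by (intro sin_ge_zero) auto
    hence s: "2 * sin \<theta> / \<theta> \<ge> 0" using that by simp
    note d = dual_box_bound[OF that]
    have "cos \<theta> \<le> 1" "cos (3 * \<theta>) \<le> 1" by simp_all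
    hence "dual_kernel \<theta> \<ge> - (1199/1000)" using s d unfolding dual_kernel_def by argo
    thus ?thesis using dual_kernel_upper_small[OF that True] by simp
  next
    case False
    thus ?thesis using dual_kernel_abs_large[of \<theta>] by simp
  qed
  have "dual_kernel (- \<theta>) = dual_kernel \<theta>" by (simp add: dual_kernel_def)
  thus ?thesis using pos[of \<theta>] pos[of "- \<theta>"] assms by (cases "\<theta> > 0") auto
qed

text \<open>Real-valued counterpart of \<open>penalty\<close>. As a Bochner integral it defaults to
  0 when the penalty is infinite, so it is meaningful only together with finiteness.\<close>

definition pen :: "(real \<Rightarrow> real) \<Rightarrow> real" where
  "pen F = (LINT t|lborel. max 0 (ct F t) * indicator outer t)"

lemma pen_nonneg: "0 \<le> pen F"
  unfolding pen_def by (intro Bochner_Integration.integral_nonneg) auto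

text \<open>The set where \<open>F\<close> does not vanish is open and null, hence empty.\<close>

lemma continuous_AE_0:
  fixes F :: "real \<Rightarrow> 'a :: real_normed_vector"
  assumes "continuous_on UNIV F" "AE x in lborel. F x = 0"
  shows "F = (\<lambda>_. 0)"
proof -
  have op: "open {x. F x \<noteq> 0}"
    using open_Collect_neq[OF assms(1) continuous_on_const] by simp
  have "{x. F x \<noteq> 0} \<in> null_sets lborel"
    using assms(2) op by (subst (asm) AE_iff_null) auto
  hence "negligible {x. F x \<noteq> 0}"
    using negligible_iff_null_sets null_sets_completionI by blast
  hence "{x. F x \<noteq> 0} = {}" using op open_not_negligible by blast
  thus ?thesis by (auto simp: fun_eq_iff)
qed

lemma L1norm_pos:
  fixes F :: "real \<Rightarrow> 'a :: {banach, second_countable_topology}"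
  assumes "continuous_on UNIV F" "integrable lborel F" "F \<noteq> (\<lambda>_. 0)"
  shows "L1norm F > 0"
proof -
  have "L1norm F \<ge> 0" by (simp add: L1norm_def)
  moreover have "L1norm F \<noteq> 0"
  proof
    assume "L1norm F = 0"
    hence "AE x in lborel. norm (F x) = 0"
      unfolding L1norm_def using integral_nonneg_eq_0_iff_AE[OF integrable_norm[OF assms(2)]] by simp
    hence "AE x in lborel. F x = 0" by simp
    thus False using continuous_AE_0 assms by blast
  qed
  ultimately show ?thesis by simp
qed

lemma L1norm_pos_Ap:
  assumes "F \<in> classAp" "F \<noteq> (\<lambda>_. 0)"
  shows "L1norm F > 0"
  using assms by (intro L1norm_pos) (auto simp: classAp_def)

lemma penalty_eq:
  assumes "F \<in> classAp"
  shows "(\<integral>\<^sup>+ t. ennreal (max 0 (Re (rfourier F t))) * indicator outer t \<partial>lborel) = penalty F"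
  unfolding penalty_def by (simp add: Re_rfourier[OF classApD(1)[OF assms]])

lemma ratioAp_infinite:
  assumes "F \<in> classAp" "F \<noteq> (\<lambda>_. 0)" "A > 0" "penalty F = \<infinity>"
  shows "ratioAp A F = - \<infinity>"
  using assms L1norm_pos_Ap[OF assms(1,2)] unfolding ratioAp_def penalty_eq[OF assms(1)]
  by simp

lemma ratioAp_finite:
  assumes "F \<in> classAp" "F \<noteq> (\<lambda>_. 0)" "penalty F \<noteq> \<infinity>"
  shows "ratioAp A F = ereal ((F 0 - A * pen F) / L1norm F)"
  using L1norm_pos_Ap[OF assms(1,2)] pen_nonneg[of F] integrable_ct_if_penalty(2)[OF assms(1,3)]
  unfolding ratioAp_def penalty_eq[OF assms(1)] pen_def[symmetric] by simp

lemma duality_pen: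
  fixes m :: "real \<Rightarrow> real"
  assumes "F \<in> classAp" "integrable lborel (ct F)"
    "integrable lborel m" "\<And>t. \<bar>t\<bar> \<le> 1 \<Longrightarrow> m t = 1" "\<And>t. 1 - A \<le> m t" "\<And>t. m t \<le> 1"
  shows "F 0 - A * pen F \<le> (LINT x|lborel. F x * ct m x)"
  unfolding pen_def by (rule duality_bound) (use assms in auto)

section \<open>The bound 2 and its strictness\<close>

lemma abs_sin_less:
  assumes "x \<noteq> (0::real)"
  shows "\<bar>sin x\<bar> < \<bar>x\<bar>"
proof (cases "sin x = 0")
  case False
  have "sin x = 2 * sin (x / 2) * cos (x / 2)" using sin_double[of "x / 2"] by simp
  with False have n: "sin (x / 2) \<noteq> 0" by auto
  hence "(sin (x / 2))\<^sup>2 > 0" by simp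
  hence "(cos (x / 2))\<^sup>2 < 1" using sin_cos_squared_add[of "x / 2"] by linarith
  hence c: "\<bar>cos (x / 2)\<bar> < 1" by (simp add: abs_square_less_1)
  have "\<bar>sin x\<bar> = 2 * \<bar>sin (x / 2)\<bar> * \<bar>cos (x / 2)\<bar>" using \<open>sin x = _\<close> by (simp add: abs_mult)
  also have "\<dots> < 2 * \<bar>sin (x / 2)\<bar> * 1" using c n by (intro mult_strict_left_mono) auto
  also have "\<dots> \<le> \<bar>x\<bar>" using abs_sin_x_le_abs_x[of "x / 2"] by simp
  finally show ?thesis .
qed (use assms in auto)

lemma abs_ct_indicator_less_2:
  assumes "x \<noteq> 0"
  shows "\<bar>ct (indicator {-1..1}) x\<bar> < 2"
  using abs_sin_less[of "2 * pi * x"] assms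
  by (simp add: ct_indicator abs_mult field_simps)

text \<open>The dual function is the indicator of [-1, 1]. Its transform stays strictly below 2 in
  absolute value off the origin, so equality would force \<open>F\<close> to vanish almost
  everywhere, hence everywhere by continuity. This strictness is what rules out an extremizer at A =
  1.\<close>

lemma functional_less_2:
  assumes F: "F \<in> classAp" "F \<noteq> (\<lambda>_. 0)" and i: "integrable lborel (ct F)" and A: "A \<ge> 1"
  shows "F 0 - A * pen F < 2 * L1norm F"
proof -
  note iF = classApD(1)[OF F(1)]
  let ?\<psi> = "ct (indicator {-1..1})"
  note [measurable] = borel_measurable_integrable[OF iF] borel_measurable_ct[OF integrable_indicator_Icc]
  have ae: "AE x in lborel. \<bar>?\<psi> x\<bar> < 2"
    using AE_lborel_singleton[of 0] by eventually_elim (rule abs_ct_indicator_less_2)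
  have le: "F 0 - A * pen F \<le> (LINT x|lborel. F x * ?\<psi> x)"
    by (rule duality_pen[OF F(1) i integrable_indicator_Icc]) (use A in \<open>auto split: split_indicator\<close>)
  have iFp: "integrable lborel (\<lambda>x. F x * ?\<psi> x)"
    using ct_mult_formula(2)[OF integrable_indicator_Icc iF] by (simp add: mult.commute)
  have "(LINT x|lborel. F x * ?\<psi> x) \<le> 2 * L1norm F"
    by (rule integral_mult_le_L1norm[OF iF]) (use ae in \<open>auto elim: eventually_mono\<close>)
  moreover have "(LINT x|lborel. F x * ?\<psi> x) \<noteq> 2 * L1norm F"
  proof
    assume eq: "(LINT x|lborel. F x * ?\<psi> x) = 2 * L1norm F"
    have i2: "integrable lborel (\<lambda>x. 2 * \<bar>F x\<bar> - F x * ?\<psi> x)" using iF iFp by simp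
    have nn: "AE x in lborel. 0 \<le> 2 * \<bar>F x\<bar> - F x * ?\<psi> x"
      using ae
    proof eventually_elim
      case (elim x)
      have "F x * ?\<psi> x \<le> \<bar>F x\<bar> * \<bar>?\<psi> x\<bar>" by (metis abs_ge_self abs_mult)
      also have "\<dots> \<le> \<bar>F x\<bar> * 2" using elim by (intro mult_left_mono) auto
      finally show ?case by simp
    qed
    have "(LINT x|lborel. 2 * \<bar>F x\<bar> - F x * ?\<psi> x) = 0"
      using eq iF iFp by (simp add: L1norm_def)
    hence "AE x in lborel. 2 * \<bar>F x\<bar> - F x * ?\<psi> x = 0"
      using integral_nonneg_eq_0_iff_AE[OF i2 nn] by simp
    hence "AE x in lborel. F x = 0"
      using ae
    proof eventually_elim
      case (elim x)
      show ?case
      proof (rule ccontr)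
        assume "F x \<noteq> 0"
        hence "\<bar>F x\<bar> * \<bar>?\<psi> x\<bar> < \<bar>F x\<bar> * 2" using elim by (intro mult_strict_left_mono) auto
        moreover have "F x * ?\<psi> x \<le> \<bar>F x\<bar> * \<bar>?\<psi> x\<bar>" by (metis abs_ge_self abs_mult)
        ultimately show False using elim by simp
      qed
    qed
    thus False using continuous_AE_0 F by (auto simp: classAp_def)
  qed
  ultimately show ?thesis using le by simp
qed

lemma ratioAp_less_2:
  assumes "F \<in> classAp" "F \<noteq> (\<lambda>_. 0)" "A \<ge> 1"
  shows "ratioAp A F < 2"
proof (cases "penalty F = \<infinity>")
  case True
  thus ?thesis using ratioAp_infinite assms by simp
next
  case False
  have "(F 0 - A * pen F) / L1norm F < 2"
    using functional_less_2[OF assms(1,2) integrable_ct_if_penalty(1)[OF assms(1) False] assms(3)]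
      L1norm_pos_Ap[OF assms(1,2)] by (simp add: field_simps)
  thus ?thesis using ratioAp_finite[OF assms(1,2) False] by simp
qed

lemma CAp_le_2: "A \<ge> 1 \<Longrightarrow> CAp A \<le> 2"
  unfolding CAp_def using ratioAp_less_2 by (intro SUP_least less_imp_le) blast

text \<open>The indicator of [-b, b] averaged over a window of half-width e. It is written as a
  difference of tents because their transforms are at hand.\<close>

definition trap :: "real \<Rightarrow> real \<Rightarrow> real \<Rightarrow> real" where
  "trap e b t = (tent (b + e) t - tent (b - e) t) / (2 * e)"

lemma trap_props:
  assumes "0 < e" "e \<le> b"
  shows "0 \<le> trap e b t" "trap e b t \<le> 1" "\<bar>t\<bar> \<le> b - e \<Longrightarrow> trap e b t = 1"
  using assms by (auto simp: trap_def tent_def field_simps)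

lemma trap_mono:
  assumes "0 < e" "b \<le> c"
  shows "trap e b t \<le> trap e c t"
  using assms unfolding trap_def by (intro divide_right_mono) (auto simp: tent_def max_def)

lemma
  assumes "0 < e" "e \<le> b"
  shows integrable_trap: "integrable lborel (trap e b)"
    and ct_trap: "x \<noteq> 0 \<Longrightarrow> ct (trap e b) x = sin (2 * pi * b * x) / (pi * x) * (sin (2 * pi * e * x) / (2 * pi * e * x))"
proof -
  have i: "integrable lborel (tent (b + e))" "integrable lborel (tent (b - e))"
    using assms by (auto intro!: integrable_tent)
  have eq: "trap e b = (\<lambda>t. 1 / (2 * e) * (tent (b + e) t - tent (b - e) t))"
    by (simp add: trap_def fun_eq_iff)
  show "integrable lborel (trap e b)" unfolding eq using i by simp
  assume x: "x \<noteq> 0"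
  have "ct (trap e b) x = 1 / (2 * e) * ((cos (2 * pi * (b - e) * x) - cos (2 * pi * (b + e) * x)) / (2 * pi\<^sup>2 * x\<^sup>2))"
    unfolding eq ct_cmult using i assms x by (subst ct_diff) (auto simp: ct_tent diff_divide_distrib)
  also have "cos (2 * pi * (b - e) * x) - cos (2 * pi * (b + e) * x) = 2 * sin (2 * pi * b * x) * sin (2 * pi * e * x)"
    by (simp add: algebra_simps cos_add cos_diff)
  finally show "ct (trap e b) x = sin (2 * pi * b * x) / (pi * x) * (sin (2 * pi * e * x) / (2 * pi * e * x))"
    using x assms by (simp add: field_simps power2_eq_square)
qed

text \<open>Unit masses at b and -b, each spread with density 1 / (2 e) over a window of half-width
  e.\<close>

definition shell :: "real \<Rightarrow> real \<Rightarrow> real \<Rightarrow> real" where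
  "shell e b t = (indicator {-(b + e)..b + e} t - indicator {-(b - e)..b - e} t) / (2 * e)"

lemma
  assumes "0 < e" "e \<le> b"
  shows integrable_shell: "integrable lborel (shell e b)"
    and ct_shell: "x \<noteq> 0 \<Longrightarrow> ct (shell e b) x = 2 * cos (2 * pi * b * x) * (sin (2 * pi * e * x) / (2 * pi * e * x))"
proof -
  have eq: "shell e b = (\<lambda>t. 1 / (2 * e) * (indicator {-(b + e)..b + e} t - indicator {-(b - e)..b - e} t))"
    by (simp add: shell_def fun_eq_iff)
  show "integrable lborel (shell e b)"
    unfolding eq by (intro integrable_mult_right Bochner_Integration.integrable_diff integrable_indicator_Icc)
  assume x: "x \<noteq> 0"
  have "ct (shell e b) x = 1 / (2 * e) * ((sin (2 * pi * (b + e) * x) - sin (2 * pi * (b - e) * x)) / (pi * x))"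
  proof -
    have 1: "ct (indicator {-(b + e)..b + e}) x = sin (2 * pi * (b + e) * x) / (pi * x)"
      by (rule ct_indicator) (use assms x in auto)
    have 2: "ct (indicator {-(b - e)..b - e}) x = sin (2 * pi * (b - e) * x) / (pi * x)"
      by (rule ct_indicator) (use assms x in auto)
    show ?thesis
      unfolding eq ct_cmult ct_diff[OF integrable_indicator_Icc integrable_indicator_Icc] 1 2
      by (simp only: diff_divide_distrib)
  qed
  also have "sin (2 * pi * (b + e) * x) - sin (2 * pi * (b - e) * x) = 2 * cos (2 * pi * b * x) * sin (2 * pi * e * x)"
    by (simp add: algebra_simps sin_add sin_diff)
  finally show "ct (shell e b) x = 2 * cos (2 * pi * b * x) * (sin (2 * pi * e * x) / (2 * pi * e * x))"
    using x assms by (simp add: field_simps)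
qed

text \<open>The dual measure: Lebesgue measure on \<open>[-1, 1]\<close>, plus a box of density \<open>0.09\<close> on
  \<open>1.5 \<le> \<bar>t\<bar> \<le> 2\<close>, minus point masses \<open>0.444\<close> at \<open>\<plusminus>1\<close> and \<open>0.00325\<close> at \<open>\<plusminus>3\<close>, all averaged over a
  window of half-width \<open>e\<close> so that it has a density.\<close>

definition dual_density :: "real \<Rightarrow> real \<Rightarrow> real" where
  "dual_density e t = trap e 1 t + 9/100 * (trap e 2 t - trap e (3/2) t)
     - (444/1000 * shell e 1 t + 325/100000 * shell e 3 t)"

lemma ct_dual_density:
  assumes "0 < e" "e < 1" "x \<noteq> 0"
  shows "ct (dual_density e) x = dual_kernel (2 * pi * x) * (sin (2 * pi * e * x) / (2 * pi * e * x))"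
    and "integrable lborel (dual_density e)"
proof -
  have i: "integrable lborel (trap e 1)" "integrable lborel (trap e 2)" "integrable lborel (trap e (3/2))"
    "integrable lborel (shell e 1)" "integrable lborel (shell e 3)"
    using assms by (auto intro!: integrable_trap integrable_shell)
  show "integrable lborel (dual_density e)" unfolding dual_density_def using i by simp
  define \<sigma> where "\<sigma> = sin (2 * pi * e * x) / (2 * pi * e * x)"
  have "ct (dual_density e) x = ct (trap e 1) x + 9/100 * (ct (trap e 2) x - ct (trap e (3/2)) x)
     - (444/1000 * ct (shell e 1) x + 325/100000 * ct (shell e 3) x)"
    unfolding dual_density_def
    by (simp only: ct_diff ct_add ct_cmult i Bochner_Integration.integrable_diff Bochner_Integration.integrable_add integrable_mult_right)
  also have "\<dots> = dual_kernel (2 * pi * x) * \<sigma>"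
  proof -
    have T: "ct (trap e b) x = sin (2 * pi * b * x) / (pi * x) * \<sigma>" if "b \<ge> 1" for b
      unfolding \<sigma>_def by (rule ct_trap) (use assms that in auto)
    have R: "ct (shell e b) x = 2 * cos (2 * pi * b * x) * \<sigma>" if "b \<ge> 1" for b
      unfolding \<sigma>_def by (rule ct_shell) (use assms that in auto)
    have k: "dual_kernel (2 * pi * x) = sin (2 * pi * 1 * x) / (pi * x) - 888/1000 * cos (2 * pi * 1 * x)
       + 9/100 * (sin (2 * pi * 2 * x) / (pi * x) - sin (2 * pi * (3/2) * x) / (pi * x)) - 65/10000 * cos (2 * pi * 3 * x)"
      by (simp add: dual_kernel_def mult_ac)
    show ?thesis
      unfolding k T[of 1, simplified] T[of 2, simplified] T[of "3/2", simplified] R[of 1, simplified] R[of 3, simplified]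
      by (simp add: algebra_simps)
  qed
  finally show "ct (dual_density e) x = dual_kernel (2 * pi * x) * (sin (2 * pi * e * x) / (2 * pi * e * x))"
    unfolding \<sigma>_def .
qed

text \<open>Upper bound: traps increase with their width, so the trap at 1 plus a fraction of the
  step from 3/2 to 2 stays below the trap at 2. Lower bound: the two shells are disjoint because e <
  1, so the heavier one decides, with density 0.444 / (2 e) = 0.222 / e.\<close>

lemma dual_density_bounds:
  assumes "0 < e" "e < 1"
  shows "\<bar>t\<bar> \<le> 1 - e \<Longrightarrow> dual_density e t = 1" "dual_density e t \<le> 1" "- (222/1000 / e) \<le> dual_density e t"
proof -
  have t: "0 \<le> trap e 1 t" "trap e 1 t \<le> trap e (3/2) t" "trap e (3/2) t \<le> trap e 2 t" "trap e 2 t \<le> 1"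
    using assms by (auto intro!: trap_props trap_mono)
  have r: "0 \<le> shell e 1 t" "0 \<le> shell e 3 t" using assms by (auto simp: shell_def indicator_def)
  have r2: "444/1000 * shell e 1 t + 325/100000 * shell e 3 t \<le> 222/1000 / e"
    using assms by (auto simp: shell_def indicator_def field_simps)
  show "dual_density e t \<le> 1" "- (222/1000 / e) \<le> dual_density e t"
    using t r r2 unfolding dual_density_def by argo+
  assume a: "\<bar>t\<bar> \<le> 1 - e"
  have "trap e 1 t = 1" "trap e (3/2) t = 1" "trap e 2 t = 1"
    using assms a by (auto intro!: trap_props(3))
  moreover have "shell e 1 t = 0" "shell e 3 t = 0" using assms a by (auto simp: shell_def indicator_def)
  ultimately show "dual_density e t = 1" by (simp add: dual_density_def)
qed

lemma functional_le_dual: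
  assumes F: "F \<in> classAp" and i: "integrable lborel (ct F)" and A: "A > 1222/1000"
  shows "F 0 - A * pen F \<le> (1199/1000) / (1 - 222/1000 / (A - 1)) * L1norm F"
proof -
  \<comment> \<open>Chosen so that the spread point mass just meets the constraint; the requirement
    e < 1 is exactly A > 1.222.\<close>
  define e where "e = 222/1000 / (A - 1)"
  have e: "0 < e" "e < 1" "222/1000 / e = A - 1" using A by (auto simp: e_def field_simps)
  \<comment> \<open>The dilation carries [-1, 1] into [-(1 - e), 1 - e], where the averaged density
    is exactly 1. It multiplies the bound on the transform by 1 / (1 - e).\<close>
  define m where "m t = dual_density e ((1 - e) * t)" for t
  have im: "integrable lborel m"
    using lborel_integrable_real_affine[OF ct_dual_density(2)[OF e(1,2), of 1], of "1 - e" 0] e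
    by (simp add: m_def[abs_def])
  have "F 0 - A * pen F \<le> (LINT x|lborel. F x * ct m x)"
  proof (rule duality_pen[OF F i im])
    fix t :: real
    show "m t \<le> 1" "1 - A \<le> m t" using dual_density_bounds(2,3)[OF e(1,2), of "(1 - e) * t"] e(3) by (auto simp: m_def)
    assume "\<bar>t\<bar> \<le> 1"
    hence "\<bar>(1 - e) * t\<bar> \<le> 1 - e" using e by (simp add: abs_mult mult_left_le)
    thus "m t = 1" unfolding m_def by (rule dual_density_bounds(1)[OF e(1,2)])
  qed
  also have "\<dots> \<le> (1199/1000) / (1 - e) * L1norm F"
  proof (rule integral_mult_le_L1norm[OF classApD(1)[OF F]])
    show "ct m \<in> borel_measurable borel" by (rule borel_measurable_ct[OF im])
    show "AE x in lborel. \<bar>ct m x\<bar> \<le> (1199/1000) / (1 - e)"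
      using AE_lborel_singleton[of 0]
    proof eventually_elim
      case (elim x)
      define y where "y = x / (1 - e)"
      have y: "y \<noteq> 0" using elim e by (simp add: y_def)
      have "ct m x = ct (dual_density e) y / (1 - e)"
        unfolding m_def y_def using e by (subst ct_dilate) auto
      moreover have "\<bar>ct (dual_density e) y\<bar> \<le> 1199/1000"
      proof -
        have "\<bar>sin (2 * pi * e * y) / (2 * pi * e * y)\<bar> \<le> 1"
          using abs_sin_x_le_abs_x[of "2 * pi * e * y"] y e by (simp add: abs_divide divide_le_eq_1)
        hence "\<bar>dual_kernel (2 * pi * y)\<bar> * \<bar>sin (2 * pi * e * y) / (2 * pi * e * y)\<bar> \<le> 1199/1000 * 1"
          using dual_kernel_bound[of "2 * pi * y"] y by (intro mult_mono) auto
        thus ?thesis by (simp add: ct_dual_density(1)[OF e(1,2) y] abs_mult)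
      qed
      moreover have "\<bar>ct (dual_density e) y / (1 - e)\<bar> = \<bar>ct (dual_density e) y\<bar> / (1 - e)" using e by (simp add: abs_divide)
      ultimately show ?case using e divide_right_mono[of "\<bar>ct (dual_density e) y\<bar>" "1199/1000" "1 - e"] by argo
    qed
  qed
  finally show ?thesis by (simp add: e_def)
qed

lemma CAp_le_dual:
  assumes "1222/1000 < A"
  shows "CAp A \<le> ereal (1199/1000 / (1 - 222/1000 / (A - 1)))"
  unfolding CAp_def
proof (intro SUP_least, safe)
  fix F assume F: "F \<in> classAp" "F \<noteq> (\<lambda>_. 0)"
  show "ratioAp A F \<le> ereal (1199/1000 / (1 - 222/1000 / (A - 1)))"
  proof (cases "penalty F = \<infinity>")
    case True
    thus ?thesis using ratioAp_infinite F assms by simp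
  next
    case False
    show ?thesis
      using ratioAp_finite[OF F False] functional_le_dual[OF F(1) integrable_ct_if_penalty(1)[OF F(1) False] assms]
        L1norm_pos_Ap[OF F] by (simp add: pos_divide_le_eq)
  qed
qed

section \<open>The upper bound at A = infinity\<close>

lemma penalty_Ep:
  assumes "F \<in> classEp"
  shows "penalty F = 0"
proof -
  have F: "F \<in> classAp" using assms by (simp add: classEp_def)
  have "ct F t \<le> 0" if "1 < \<bar>t\<bar>" for t
    using assms that by (auto simp: classEp_def Re_rfourier[OF classApD(1)[OF F], symmetric])
  hence "ennreal (max 0 (ct F t)) * indicator outer t = 0" for t
    by (cases "1 < \<bar>t\<bar>") (auto simp: max_absorb1)
  hence "penalty F = (\<integral>\<^sup>+ t. 0 \<partial>(lborel :: real measure))" unfolding penalty_def by (intro nn_integral_cong)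
  thus ?thesis by simp
qed

lemma ratioEp_eq:
  assumes "F \<in> classEp" "F \<noteq> (\<lambda>_. 0)"
  shows "ratioEp F = ratioAp A F"
proof -
  have F: "F \<in> classAp" using assms by (simp add: classEp_def)
  have "pen F = 0"
    using penalty_Ep[OF assms(1)] integrable_ct_if_penalty(2)[OF F] pen_nonneg[of F] by (simp add: pen_def[symmetric])
  thus ?thesis using ratioAp_finite[OF F assms(2)] penalty_Ep[OF assms(1)] by (simp add: ratioEp_def)
qed

text \<open>Functions in E+ carry no penalty, so the dual bound for any A applies to them; A = 1000
  is large enough to give 1.199 / (1 - 0.222 / 999) < 1.2.\<close>

lemma CAp_inf_less: "CAp_inf < ereal 1.2"
proof -
  have "CAp_inf \<le> ereal (1199/1000 / (1 - 222/1000 / (1000 - 1)))"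
    unfolding CAp_inf_def
  proof (intro SUP_least, safe)
    fix F assume F: "F \<in> classEp" "F \<noteq> (\<lambda>_. 0)"
    have "ratioEp F = ratioAp 1000 F" by (rule ratioEp_eq[OF F])
    also have "\<dots> \<le> CAp 1000" unfolding CAp_def using F by (intro SUP_upper) (auto simp: classEp_def)
    also have "\<dots> \<le> ereal (1199/1000 / (1 - 222/1000 / (1000 - 1)))" by (rule CAp_le_dual) simp
    finally show "ratioEp F \<le> ereal (1199/1000 / (1 - 222/1000 / (1000 - 1)))" .
  qed
  also have "\<dots> < ereal 1.2" by simp
  finally show ?thesis .
qed

section \<open>Reduction to real even functions and the case \<open>A = 1\<close>\<close>

text \<open>Quadratic decay of the Fejer kernel, for its integrability: the mass of the tent bounds
  it for |x| \<le> 1, the explicit formula beyond.\<close>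

lemma abs_ct_tent_le:
  shows "\<bar>ct (tent 1) x\<bar> \<le> 2 * inverse (1 + x\<^sup>2)"
proof (cases "\<bar>x\<bar> \<le> 1")
  case True
  have "\<bar>ct (tent 1) x\<bar> \<le> (LINT t|lborel. \<bar>tent 1 t\<bar>)" by (rule abs_ct_le) (simp add: integrable_tent)
  also have "\<dots> = 1" using integral_tent[of 1] by (simp add: tent_def)
  also have "\<dots> \<le> 2 * inverse (1 + x\<^sup>2)"
    using True by (simp add: field_simps abs_square_le_1 add_pos_nonneg)
  finally show ?thesis .
next
  case False
  hence x: "x \<noteq> 0" "1 \<le> x\<^sup>2" using abs_square_le_1[of x] by auto
  have "\<bar>ct (tent 1) x\<bar> = \<bar>1 - cos (2 * pi * x)\<bar> / (2 * pi\<^sup>2 * x\<^sup>2)"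
    using x by (simp add: ct_tent abs_divide abs_mult)
  also have "\<dots> \<le> 2 / (2 * pi\<^sup>2 * x\<^sup>2)"
    using cos_ge_minus_one[of "2 * pi * x"] cos_le_one[of "2 * pi * x"] by (intro divide_right_mono) (auto simp: abs_le_iff)
  also have "\<dots> \<le> 1 / x\<^sup>2"
  proof -
    have "1\<^sup>2 \<le> pi\<^sup>2" using pi_gt3 by (intro power_mono) auto
    thus ?thesis using x by (simp add: field_simps)
  qed
  also have "\<dots> \<le> 2 * inverse (1 + x\<^sup>2)" using x by (simp add: field_simps add_pos_nonneg)
  finally show ?thesis .
qed

lemma integrable_inverse_one_plus_square: "integrable lborel (\<lambda>x::real. inverse (1 + x\<^sup>2))"
  using integrable_inverse_1_plus_square unfolding set_integrable_def by simp

lemma integrable_ct_tent: "integrable lborel (ct (tent 1))"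
proof (rule Bochner_Integration.integrable_bound)
  show "integrable lborel (\<lambda>x::real. 2 * inverse (1 + x\<^sup>2))"
    using integrable_inverse_one_plus_square by simp
  show "AE x in lborel. norm (ct (tent 1) x) \<le> norm (2 * inverse (1 + x\<^sup>2))"
    using abs_ct_tent_le by (auto intro!: always_eventually order_trans[OF _ abs_ge_self] simp del: inverse_eq_divide)
qed (simp add: borel_measurable_ct integrable_tent)

lemma tent_classAp: "b \<ge> 0 \<Longrightarrow> tent b \<in> classAp"
  by (simp add: classAp_def continuous_tent integrable_tent) (simp add: tent_def)

lemma continuous_AE_eq:
  fixes f g :: "real \<Rightarrow> real"
  assumes "continuous_on UNIV f" "continuous_on UNIV g" "AE x in lborel. f x = g x"
  shows "f = g"
proof -
  have "(\<lambda>x. f x - g x) = (\<lambda>_. 0)"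
    by (rule continuous_AE_0) (use assms in \<open>auto intro!: continuous_intros\<close>)
  thus ?thesis by (simp add: fun_eq_iff)
qed

lemma ct_ct_tent: "ct (ct (tent 1)) = tent 1"
  by (rule continuous_AE_eq[OF continuous_ct[OF integrable_ct_tent] continuous_tent])
    (rule ct_inversion_AE[OF integrable_tent _ integrable_ct_tent], auto simp: tent_def)

text \<open>The Fejer kernel is nonnegative and its transform \<open>tent 1\<close> vanishes for |t|
  \<ge> 1, so its norm is the transform at 0. The resulting ratio 1 makes all the suprema positive
  and supplies the starting function for the existence proofs.\<close>

lemma fejer_classEp:
  shows "ct (tent 1) \<in> classEp" "ct (tent 1) 0 = 1" "L1norm (ct (tent 1)) = 1" "ct (tent 1) \<noteq> (\<lambda>_. 0)"
proof -
  have Ap: "ct (tent 1) \<in> classAp"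
    by (simp add: classAp_def ct_minus integrable_ct_tent continuous_ct integrable_tent)
  show "ct (tent 1) \<in> classEp"
    unfolding classEp_def using Ap by (auto simp: Re_rfourier[OF integrable_ct_tent] ct_ct_tent tent_def)
  show 0: "ct (tent 1) 0 = 1" using integral_tent[of 1] by (simp add: ct_def)
  thus "ct (tent 1) \<noteq> (\<lambda>_. 0)" by auto
  have "ct (tent 1) x \<ge> 0" for x
    by (cases "x = 0") (auto simp: 0 ct_tent)
  hence "L1norm (ct (tent 1)) = ct (ct (tent 1)) 0" by (simp add: L1norm_def ct_def)
  thus "L1norm (ct (tent 1)) = 1" unfolding ct_ct_tent by (simp add: tent_def)
qed

lemma CAp_inf_ge_1: "1 \<le> CAp_inf"
proof -
  have "ratioEp (ct (tent 1)) = 1" using fejer_classEp by (simp add: ratioEp_def)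
  moreover have "ratioEp (ct (tent 1)) \<le> CAp_inf"
    unfolding CAp_inf_def using fejer_classEp by (intro SUP_upper) auto
  ultimately show ?thesis by simp
qed

lemma CAp_inf_le_CAp: "CAp_inf \<le> CAp A"
  unfolding CAp_inf_def
proof (intro SUP_least, safe)
  fix F assume F: "F \<in> classEp" "F \<noteq> (\<lambda>_. 0)"
  have "ratioEp F = ratioAp A F" by (rule ratioEp_eq[OF F])
  also have "\<dots> \<le> CAp A" unfolding CAp_def using F by (intro SUP_upper) (auto simp: classEp_def)
  finally show "ratioEp F \<le> CAp A" .
qed

lemma CAp_ge_1: "1 \<le> CAp A"
  using CAp_inf_ge_1 CAp_inf_le_CAp order_trans by blast

lemma penalty_finite_if_integrable:
  assumes "integrable lborel (ct F)" "integrable lborel F"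
  shows "penalty F \<noteq> \<infinity>"
proof -
  note [measurable] = borel_measurable_ct[OF assms(2)]
  have "penalty F \<le> (\<integral>\<^sup>+ t. ennreal (norm (ct F t)) \<partial>lborel)"
    unfolding penalty_def by (intro nn_integral_mono) (auto split: split_indicator intro!: ennreal_leI)
  also have "\<dots> < \<infinity>" using assms(1) unfolding integrable_iff_bounded by blast
  finally show ?thesis by simp
qed

text \<open>The transform of a tent is nonnegative, so at A = 1 the functional is its integral over
  [-1, 1]. For small b the transform is nearly b^2 there, because cos y \<ge> 1 - y^2 / 2; division
  by the norm b^2 gives nearly the length 2.\<close>

lemma tent_ratio:
  assumes b: "0 < b"
  shows "ereal (2 * (1 - 2 * pi\<^sup>2 * b\<^sup>2)) \<le> ratioAp 1 (tent b)"
proof -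
  have Ap: "tent b \<in> classAp" using b by (simp add: tent_classAp)
  have ti: "integrable lborel (tent b)" using b by (simp add: integrable_tent)
  have nz: "tent b \<noteq> (\<lambda>_. 0)" using b by (auto simp: tent_def fun_eq_iff intro!: exI[of _ 0])
  have sc: "tent b = (\<lambda>t. b * tent 1 (1 / b * t))"
    using b by (auto simp: tent_def fun_eq_iff max_def field_simps abs_mult)
  have ctb: "ct (tent b) = (\<lambda>x. b\<^sup>2 * ct (tent 1) (b * x))"
    unfolding sc using b by (simp only: fun_eq_iff ct_cmult ct_dilate[of "1 / b"] zero_less_divide_1_iff) (simp add: power2_eq_square mult.commute)
  have i: "integrable lborel (ct (tent b))"
    unfolding ctb using lborel_integrable_real_affine[OF integrable_ct_tent, of b 0] b by simp
  note fin = penalty_finite_if_integrable[OF i ti]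
  have nn: "ct (tent b) x \<ge> 0" for x
  proof (cases "x = 0")
    case True
    thus ?thesis using b integral_tent[of b] by (simp add: ct_def)
  next
    case False
    thus ?thesis using b by (simp add: ct_tent)
  qed
  have "tent b 0 - 1 * pen (tent b) = (LINT t|lborel. ct (tent b) t - max 0 (ct (tent b) t) * indicator outer t)"
    unfolding pen_def using i integrable_ct_if_penalty(3)[OF Ap fin] integral_ct_eq_at_0[OF Ap i] by simp
  also have "\<dots> = (LINT t|lborel. ct (tent b) t * indicator {-1..1} t)"
    using nn by (intro Bochner_Integration.integral_cong refl) (auto split: split_indicator simp: max_absorb2)
  also have "\<dots> \<ge> (LINT t|lborel. (b\<^sup>2 * (1 - 2 * pi\<^sup>2 * b\<^sup>2)) * indicator {-1..1::real} t)"
  proof (rule integral_mono)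
    show "integrable lborel (\<lambda>t. (b\<^sup>2 * (1 - 2 * pi\<^sup>2 * b\<^sup>2)) * indicator {-1..1::real} t)"
      using integrable_indicator_Icc[of 1] by simp
    show "integrable lborel (\<lambda>t. ct (tent b) t * indicator {-1..1} t)"
      by (rule integrable_ct_on_bounded[OF ti, of _ 1]) auto
    fix t :: real
    have "(b\<^sup>2 * (1 - 2 * pi\<^sup>2 * b\<^sup>2)) \<le> ct (tent b) t" if t: "\<bar>t\<bar> \<le> 1"
    proof -
      have "(LINT x|lborel. (1 - 2 * pi\<^sup>2 * b\<^sup>2) * tent b x) \<le> ct (tent b) t"
        unfolding ct_def
      proof (rule integral_mono)
        show "integrable lborel (\<lambda>x. (1 - 2 * pi\<^sup>2 * b\<^sup>2) * tent b x)" using ti by simp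
        show "integrable lborel (\<lambda>x. cos (2 * pi * x * t) * tent b x)" by (rule integrable_cos_mult[OF ti])
        fix x
        show "(1 - 2 * pi\<^sup>2 * b\<^sup>2) * tent b x \<le> cos (2 * pi * x * t) * tent b x"
        proof (cases "\<bar>x\<bar> \<le> b")
          case True
          have "\<bar>x * t\<bar> \<le> b * 1" unfolding abs_mult using True t by (intro mult_mono) auto
          hence "(x * t)\<^sup>2 \<le> b\<^sup>2" using b by (simp add: abs_le_square_iff[symmetric])
          hence "2 * pi\<^sup>2 * (x * t)\<^sup>2 \<le> 2 * pi\<^sup>2 * b\<^sup>2" by (intro mult_left_mono) auto
          moreover have "1 - cos (2 * pi * x * t) = 2 * (sin (pi * x * t))\<^sup>2"
            using cos_double_sin[of "pi * x * t"] by (simp add: mult.assoc)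
          moreover have "(sin (pi * x * t))\<^sup>2 \<le> (pi * x * t)\<^sup>2"
            using abs_sin_x_le_abs_x[of "pi * x * t"] by (simp add: abs_le_square_iff[symmetric])
          moreover have "(pi * x * t)\<^sup>2 = pi\<^sup>2 * (x * t)\<^sup>2" by (simp add: power_mult_distrib)
          ultimately have "1 - 2 * pi\<^sup>2 * b\<^sup>2 \<le> cos (2 * pi * x * t)" by argo
          thus ?thesis by (intro mult_right_mono) (auto simp: tent_def)
        qed (auto simp: tent_def)
      qed
      thus ?thesis using integral_tent[of b] b by (simp add: mult.commute)
    qed
    thus "(b\<^sup>2 * (1 - 2 * pi\<^sup>2 * b\<^sup>2)) * indicator {-1..1} t \<le> ct (tent b) t * indicator {-1..1} t"
      by (auto split: split_indicator)
  qed
  also have "(LINT t|lborel. (b\<^sup>2 * (1 - 2 * pi\<^sup>2 * b\<^sup>2)) * indicator {-1..1::real} t) = b\<^sup>2 * (2 * (1 - 2 * pi\<^sup>2 * b\<^sup>2))"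
    by simp
  finally have "b\<^sup>2 * (2 * (1 - 2 * pi\<^sup>2 * b\<^sup>2)) \<le> tent b 0 - 1 * pen (tent b)" .
  moreover have "L1norm (tent b) = b\<^sup>2" using integral_tent[of b] b by (simp add: L1norm_def tent_def)
  ultimately have "2 * (1 - 2 * pi\<^sup>2 * b\<^sup>2) \<le> (tent b 0 - 1 * pen (tent b)) / L1norm (tent b)"
    using b by (simp add: field_simps)
  thus ?thesis using ratioAp_finite[OF Ap nz fin, of 1] by simp
qed

lemma CAp_1: "CAp 1 = 2"
proof (rule antisym[OF CAp_le_2])
  have le: "ereal (2 * (1 - 2 * pi\<^sup>2 * (1 / real (Suc n))\<^sup>2)) \<le> CAp 1" for n
  proof -
    have "tent (1 / real (Suc n)) \<in> classAp" by (rule tent_classAp) simp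
    moreover have "tent (1 / real (Suc n)) \<noteq> (\<lambda>_. 0)" by (auto simp: tent_def fun_eq_iff intro!: exI[of _ 0])
    ultimately have "ratioAp 1 (tent (1 / real (Suc n))) \<le> CAp 1"
      unfolding CAp_def by (intro SUP_upper) auto
    thus ?thesis using tent_ratio[of "1 / real (Suc n)"] order_trans by fastforce
  qed
  have lim: "(\<lambda>n. ereal (2 * (1 - 2 * pi\<^sup>2 * (1 / real (Suc n))\<^sup>2))) \<longlonglongrightarrow> ereal (2 * (1 - 2 * pi\<^sup>2 * 0\<^sup>2))"
    unfolding lim_ereal by (intro tendsto_intros LIMSEQ_Suc[OF lim_1_over_n])
  have "ereal (2 * (1 - 2 * pi\<^sup>2 * 0\<^sup>2)) \<le> CAp 1"
    by (rule LIMSEQ_le_const2[OF lim]) (use le in blast)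
  thus "2 \<le> CAp 1" by simp
qed simp

section \<open>Passage from complex functions to real even ones\<close>

lemma integrable_cis_mult:
  assumes "integrable lborel (F :: real \<Rightarrow> complex)"
  shows "integrable lborel (\<lambda>x. cis (- 2 * pi * x * t) * F x)"
proof (rule Bochner_Integration.integrable_bound[OF assms])
  show "(\<lambda>x. cis (- 2 * pi * x * t) * F x) \<in> borel_measurable lborel"
    using assms unfolding cis_conv_exp by measurable
qed (auto simp: norm_mult)

definition real_even_part :: "(real \<Rightarrow> complex) \<Rightarrow> real \<Rightarrow> real" where
  "real_even_part F x = (Re (F x) + Re (F (- x))) / 2"

text \<open>The transform of the real even part at t is the real part of the mean of
  \<open>fourier F\<close> at t and -t; the estimates are triangle inequalities.\<close>

lemma real_even_part:
  assumes F: "F \<in> classA"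
  shows "real_even_part F \<in> classAp" "L1norm (real_even_part F) \<le> L1norm F"
    "\<bar>ct (real_even_part F) t\<bar> \<le> (norm (fourier F t) + norm (fourier F (- t))) / 2"
proof -
  have iF: "integrable lborel F" and cF: "continuous_on UNIV F" using F by (auto simp: classA_def)
  have iF': "integrable lborel (\<lambda>x. F (- x))" using lborel_integrable_real_affine[OF iF, of "-1" 0] by simp
  have cF': "continuous_on UNIV (\<lambda>x. F (- x))"
    by (rule continuous_on_compose2[OF cF]) (auto intro!: continuous_intros)
  have iR: "integrable lborel (\<lambda>x. Re (F x))" "integrable lborel (\<lambda>x. Re (F (- x)))"
    using iF iF' by auto
  have i: "integrable lborel (real_even_part F)"
    unfolding real_even_part_def using iR by simp
  show "real_even_part F \<in> classAp"
    unfolding classAp_def using i cF cF'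
    by (auto simp: real_even_part_def[abs_def] intro!: continuous_intros)
  have "L1norm (real_even_part F) \<le> (LINT x|lborel. (norm (F x) + norm (F (- x))) / 2)"
    unfolding L1norm_def
  proof (rule integral_mono)
    show "integrable lborel (\<lambda>x. (norm (F x) + norm (F (- x))) / 2)" using iF iF' by simp
    show "integrable lborel (\<lambda>x. norm (real_even_part F x))" using i by simp
    show "norm (real_even_part F x) \<le> (norm (F x) + norm (F (- x))) / 2" for x
      unfolding real_even_part_def using abs_Re_le_cmod[of "F x"] abs_Re_le_cmod[of "F (- x)"] by simp
  qed
  also have "\<dots> = ((LINT x|lborel. norm (F x)) + (LINT x|lborel. norm (F (- x)))) / 2"
    using iF iF' by simp
  also have "(LINT x|lborel. norm (F (- x))) = (LINT x|lborel. norm (F x))"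
    using lborel_integral_real_affine[of "-1" "\<lambda>x. norm (F x)" 0] by simp
  finally show "L1norm (real_even_part F) \<le> L1norm F" by (simp add: L1norm_def)
  have "ct (real_even_part F) t = (ct (\<lambda>x. Re (F x)) t + ct (\<lambda>x. Re (F (- x))) t) / 2"
    using ct_cmult[of "1/2" "\<lambda>x. Re (F x) + Re (F (- x))" t] ct_add[OF iR, of t]
    by (simp add: real_even_part_def[abs_def])
  also have "ct (\<lambda>x. Re (F (- x))) t = ct (\<lambda>x. Re (F x)) t"
    unfolding ct_def using lborel_integral_real_affine[of "-1" "\<lambda>x. cos (2 * pi * x * t) * Re (F x)" 0] by simp
  also have "(ct (\<lambda>x. Re (F x)) t + ct (\<lambda>x. Re (F x)) t) / 2 = Re ((fourier F t + fourier F (- t)) / 2)"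
  proof -
    have "Re (fourier F t) + Re (fourier F (- t)) = (LINT x|lborel. Re (cis (- 2 * pi * x * t) * F x) + Re (cis (- 2 * pi * x * (- t)) * F x))"
      unfolding fourier_def integral_Re[OF integrable_cis_mult[OF iF], symmetric]
      by (rule Bochner_Integration.integral_add[symmetric]) (intro integrable_Re integrable_cis_mult iF)+
    also have "\<dots> = (LINT x|lborel. 2 * (cos (2 * pi * x * t) * Re (F x)))" by (simp add: mult.commute)
    also have "\<dots> = 2 * ct (\<lambda>x. Re (F x)) t" by (simp add: ct_def)
    finally show ?thesis by simp
  qed
  finally have "\<bar>ct (real_even_part F) t\<bar> \<le> norm ((fourier F t + fourier F (- t)) / 2)"
    using abs_Re_le_cmod[of "(fourier F t + fourier F (- t)) / 2"] by simp
  also have "\<dots> \<le> (norm (fourier F t) + norm (fourier F (- t))) / 2"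
    using norm_triangle_ineq[of "fourier F t" "fourier F (- t)"] by (simp add: norm_divide)
  finally show "\<bar>ct (real_even_part F) t\<bar> \<le> (norm (fourier F t) + norm (fourier F (- t))) / 2" .
qed

lemma continuous_fourier:
  assumes "integrable lborel F"
  shows "continuous_on UNIV (fourier F)"
proof (rule continuous_at_imp_continuous_on, safe)
  fix t
  show "isCont (fourier F) t"
    unfolding continuous_at_sequentially comp_def
  proof safe
    fix u :: "nat \<Rightarrow> real" assume u: "u \<longlonglongrightarrow> t"
    show "(\<lambda>n. fourier F (u n)) \<longlonglongrightarrow> fourier F t"
      unfolding fourier_def
    proof (rule integral_dominated_convergence[where w = "\<lambda>x. norm (F x)"])
      show "AE x in lborel. (\<lambda>n. cis (- 2 * pi * x * u n) * F x) \<longlonglongrightarrow> cis (- 2 * pi * x * t) * F x"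
        unfolding cis_conv_exp by (intro always_eventually allI tendsto_intros u)
      show "integrable lborel (\<lambda>x. norm (F x))" using assms by simp
      show "AE x in lborel. norm (cis (- 2 * pi * x * u n) * F x) \<le> norm (F x)" for n
        by (auto simp: norm_mult)
    qed (use borel_measurable_integrable[OF integrable_cis_mult[OF assms]] in auto)
  qed
qed

text \<open>Rotating \<open>F\<close> so that \<open>F 0 \<ge> 0\<close> and passing to the real even part loses nothing.\<close>

lemma real_even_reduction:
  assumes F: "F \<in> classA"
  obtains G where "G \<in> classAp" "G 0 = norm (F 0)" "L1norm G \<le> L1norm F"
    "\<And>t. \<bar>ct G t\<bar> \<le> (norm (fourier F t) + norm (fourier F (- t))) / 2"
proof -
  obtain z :: complex where z: "norm z = 1" "z * F 0 = of_real (norm (F 0))"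
  proof (cases "F 0 = 0")
    case True
    thus ?thesis using that[of 1] by simp
  next
    case False
    show ?thesis
      by (rule that[of "of_real (norm (F 0)) / F 0"]) (use False in \<open>auto simp: norm_divide\<close>)
  qed
  define H where "H x = z * F x" for x
  have H: "H \<in> classA" using F by (auto simp: classA_def H_def[abs_def] intro!: continuous_intros)
  have fH: "fourier H t = z * fourier F t" for t
    by (simp add: fourier_def H_def mult.left_commute[of _ z])
  have nH: "L1norm H = L1norm F" by (simp add: L1norm_def H_def norm_mult z)
  show ?thesis
    by (rule that[of "real_even_part H"])
      (use real_even_part[OF H] in \<open>auto simp: fH nH norm_mult z(1)\<close>, simp add: real_even_part_def H_def z(2))
qed

text \<open>The outer region is symmetric, so passing to the real even part does not increase the
  penalty, while it keeps the value at 0 and does not increase the norm.\<close>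

lemma CA_le_CAp:
  assumes A: "A > 1"
  shows "CA A \<le> CAp A"
  unfolding CA_def
proof (intro SUP_least, safe)
  fix F assume F: "F \<in> classA" "F \<noteq> (\<lambda>_. 0)"
  have iF: "integrable lborel F" using F by (simp add: classA_def)
  note [measurable] = borel_measurable_continuous_onI[OF continuous_fourier[OF iF]]
  have N: "L1norm F > 0" using F by (intro L1norm_pos) (auto simp: classA_def)
  define P where "P = (\<integral>\<^sup>+ t. ennreal (norm (fourier F t)) * indicator outer t \<partial>lborel)"
  obtain G where G: "G \<in> classAp" "G 0 = norm (F 0)" "L1norm G \<le> L1norm F"
    "\<And>t. \<bar>ct G t\<bar> \<le> (norm (fourier F t) + norm (fourier F (- t))) / 2"
    using real_even_reduction[OF F(1)] by blast
  note [measurable] = borel_measurable_ct[OF classApD(1)[OF G(1)]]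
  show "ratioA A F \<le> CAp A"
  proof (cases "P = \<infinity>")
    case True
    thus ?thesis using N A unfolding ratioA_def P_def[symmetric] by simp
  next
    case False
    have refl: "(\<integral>\<^sup>+ t. ennreal (norm (fourier F (- t))) * indicator outer t \<partial>lborel) = P"
      unfolding P_def
      by (subst nn_integral_real_affine[where c = "-1" and t = 0, of "\<lambda>t. ennreal (norm (fourier F t)) * indicator outer t"])
        (auto simp: indicator_def)
    have "penalty G \<le> (\<integral>\<^sup>+ t. ennreal (1/2) * (ennreal (norm (fourier F t)) * indicator outer t
        + ennreal (norm (fourier F (- t))) * indicator outer t) \<partial>lborel)"
      unfolding penalty_def
    proof (intro nn_integral_mono)
      fix t
      have "ennreal (max 0 (ct G t)) \<le> ennreal ((norm (fourier F t) + norm (fourier F (- t))) / 2)"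
        using G(4)[of t] by (intro ennreal_leI) auto
      also have "\<dots> = ennreal (1/2 * (norm (fourier F t) + norm (fourier F (- t))))" by simp
      also have "\<dots> = ennreal (1/2) * ennreal (norm (fourier F t) + norm (fourier F (- t)))" by (rule ennreal_mult) auto
      also have "ennreal (norm (fourier F t) + norm (fourier F (- t))) = ennreal (norm (fourier F t)) + ennreal (norm (fourier F (- t)))"
        by (rule ennreal_plus) auto
      finally show "ennreal (max 0 (ct G t)) * indicator outer t \<le> ennreal (1/2) * (ennreal (norm (fourier F t)) * indicator outer t
        + ennreal (norm (fourier F (- t))) * indicator outer t)"
        by (auto split: split_indicator)
    qed
    also have "\<dots> = ennreal (1/2) * (P + P)"
      by (subst nn_integral_cmult, measurable) (subst nn_integral_add, measurable, simp add: refl P_def[symmetric])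
    also have "\<dots> = P"
    proof -
      obtain r where r: "r \<ge> 0" "P = ennreal r" using False by (cases P) auto
      have "ennreal (1/2) * (P + P) = ennreal (1/2) * ennreal (r + r)" unfolding r(2) ennreal_plus[OF r(1) r(1)] ..
      also have "\<dots> = ennreal (1/2 * (r + r))" by (rule ennreal_mult[symmetric]) (use r in auto)
      finally show ?thesis using r by simp
    qed
    finally have le: "penalty G \<le> P" .
    hence fin: "penalty G \<noteq> \<infinity>" using False by (auto simp: top_unique)
    have rA: "ratioA A F = ereal ((norm (F 0) - A * enn2real P) / L1norm F)"
      using False N unfolding ratioA_def P_def[symmetric] by (cases P) auto
    have "pen G \<le> enn2real P"
      using le False integrable_ct_if_penalty(2)[OF G(1) fin] pen_nonneg[of G]
      by (cases P) (auto simp: pen_def[symmetric])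
    hence num: "norm (F 0) - A * enn2real P \<le> G 0 - A * pen G" using A G(2) by simp
    show ?thesis
    \<comment> \<open>Replacing the norm of \<open>F\<close> by the smaller norm of \<open>G\<close>
      raises the quotient only for a positive numerator; otherwise nonnegativity of
      \<open>CAp A\<close> suffices.\<close>
    proof (cases "G 0 - A * pen G > 0")
      case True
      hence Gnz: "G \<noteq> (\<lambda>_. 0)" using pen_nonneg[of G] A by (auto simp: zero_less_mult_iff mult_less_0_iff)
      have "(norm (F 0) - A * enn2real P) / L1norm F \<le> (G 0 - A * pen G) / L1norm F"
        using num N by (intro divide_right_mono) auto
      also have "\<dots> \<le> (G 0 - A * pen G) / L1norm G"
        using True G(3) N L1norm_pos_Ap[OF G(1) Gnz] by (intro divide_left_mono) auto
      finally have "ratioA A F \<le> ratioAp A G" unfolding rA using ratioAp_finite[OF G(1) Gnz fin] by simp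
      also have "\<dots> \<le> CAp A" unfolding CAp_def using G(1) Gnz by (intro SUP_upper) auto
      finally show ?thesis .
    next
      case False
      hence "(norm (F 0) - A * enn2real P) / L1norm F \<le> 0" using num N by (simp add: divide_le_0_iff)
      hence "ratioA A F \<le> 0" unfolding rA by simp
      also have "0 \<le> CAp A" using CAp_ge_1[of A] by (rule order_trans[rotated]) simp
      finally show ?thesis .
    qed
  qed
qed

text \<open>Points with |t| = 1 are limits of points further out. This bridges the open region |t| >
  1 of the penalty and the closed condition |t| \<ge> 1 in E+.\<close>

lemma nonpos_boundary:
  fixes f :: "real \<Rightarrow> real"
  assumes "continuous_on UNIV f" "\<And>t. 1 < \<bar>t\<bar> \<Longrightarrow> f t \<le> 0" "1 \<le> \<bar>t\<bar>"
  shows "f t \<le> 0"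
proof -
  have lim: "(\<lambda>n. f (t * (1 + 1 / real (Suc n)))) \<longlonglongrightarrow> f (t * (1 + 0))"
    using assms(1) by (intro isCont_tendsto_compose[where g = f] tendsto_intros LIMSEQ_Suc[OF lim_1_over_n])
      (simp add: continuous_on_eq_continuous_at)
  have "f (t * (1 + 1 / real (Suc n))) \<le> 0" for n
  proof (rule assms(2))
    have "1 * 1 < \<bar>t\<bar> * (1 + 1 / real (Suc n))" using assms(3) by (intro mult_le_less_imp_less) auto
    thus "1 < \<bar>t * (1 + 1 / real (Suc n))\<bar>" by (simp add: abs_mult)
  qed
  hence "f (t * (1 + 0)) \<le> 0" by (intro LIMSEQ_le_const2[OF lim]) blast
  thus ?thesis by simp
qed

lemma CA_inf_le_CAp_inf: "CA_inf \<le> CAp_inf"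
  unfolding CA_inf_def
proof (intro SUP_least, safe)
  fix F assume F: "F \<in> classE" "F \<noteq> (\<lambda>_. 0)"
  hence FA: "F \<in> classA" by (simp add: classE_def)
  have N: "L1norm F > 0" using F by (intro L1norm_pos) (auto simp: classA_def classE_def)
  obtain G where G: "G \<in> classAp" "G 0 = norm (F 0)" "L1norm G \<le> L1norm F"
    "\<And>t. \<bar>ct G t\<bar> \<le> (norm (fourier F t) + norm (fourier F (- t))) / 2"
    using real_even_reduction[OF FA] by blast
  have z: "fourier F t = 0" if "1 < \<bar>t\<bar>" for t
  proof (rule ccontr)
    assume "fourier F t \<noteq> 0"
    hence "t \<in> closure {t. fourier F t \<noteq> 0}" by (intro subsetD[OF closure_subset]) simp
    moreover have "closure {t. fourier F t \<noteq> 0} \<subseteq> {-1..1}" using F(1) by (simp add: classE_def)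
    ultimately have "t \<in> {-1..1}" by blast
    thus False using that by auto
  qed
  have "ct G t \<le> 0" if "1 < \<bar>t\<bar>" for t using G(4)[of t] z[of t] z[of "- t"] that by auto
  hence "ct G t \<le> 0" if "1 \<le> \<bar>t\<bar>" for t
    using nonpos_boundary[OF continuous_ct[OF classApD(1)[OF G(1)]]] that by blast
  hence E: "G \<in> classEp" using G(1) by (simp add: classEp_def Re_rfourier[OF classApD(1)[OF G(1)]])
  show "ereal (norm (F 0) / L1norm F) \<le> CAp_inf"
  proof (cases "F 0 = 0")
    case True
    hence "ereal (norm (F 0) / L1norm F) = 0" by simp
    also have "0 \<le> CAp_inf" using CAp_inf_ge_1 by (rule order_trans[rotated]) simp
    finally show ?thesis .
  next
    case False
    hence nz: "G \<noteq> (\<lambda>_. 0)" using G(2) by auto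
    have "norm (F 0) / L1norm F \<le> G 0 / L1norm G"
      unfolding G(2) using G(3) N L1norm_pos_Ap[OF G(1) nz] by (intro divide_left_mono) auto
    hence "ereal (norm (F 0) / L1norm F) \<le> ratioEp G" by (simp add: ratioEp_def)
    also have "\<dots> \<le> CAp_inf" unfolding CAp_inf_def using E nz by (intro SUP_upper) auto
    finally show ?thesis .
  qed
qed

section \<open>Existence of extremizers\<close>

text \<open>This is A x_+ - x. In this form it is visibly nonnegative for A > 1, so Fatou's lemma
  applies to it, and it controls |x| up to a constant.\<close>

definition outer_cost :: "real \<Rightarrow> real \<Rightarrow> real" where
  "outer_cost A x = max 0 (- x) + (A - 1) * max 0 x"

definition Phi :: "real \<Rightarrow> (real \<Rightarrow> real) \<Rightarrow> real" where
  "Phi A F = F 0 - A * pen F"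

lemma outer_cost_nonneg: "A > 1 \<Longrightarrow> 0 \<le> outer_cost A x"
  by (simp add: outer_cost_def)

lemma outer_cost_measurable [measurable]: "outer_cost A \<in> borel_measurable borel"
  unfolding outer_cost_def by measurable

lemma abs_le_outer_cost:
  assumes "A > 1"
  shows "\<bar>x\<bar> \<le> max 1 (1 / (A - 1)) * outer_cost A x"
proof (cases "x \<ge> 0")
  case True
  have "1 / (A - 1) * ((A - 1) * x) \<le> max 1 (1 / (A - 1)) * ((A - 1) * x)"
    using assms True by (intro mult_right_mono) auto
  thus ?thesis using True assms by (simp add: outer_cost_def)
next
  case False
  have "1 * (- x) \<le> max 1 (1 / (A - 1)) * (- x)"
    using False by (intro mult_right_mono) auto
  thus ?thesis using False by (simp add: outer_cost_def)
qed

lemma integrable_outer_cost: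
  fixes h :: "real \<Rightarrow> real"
  assumes "integrable lborel h"
  shows "integrable lborel (\<lambda>t. outer_cost A (h t) * indicator outer t)"
proof -
  have "integrable lborel (\<lambda>t. outer_cost A (h t))"
    unfolding outer_cost_def using assms by simp
  moreover have "outer \<in> sets lborel" by measurable
  ultimately show ?thesis by (intro integrable_real_mult_indicator)
qed

text \<open>Trades the value at 0, which need not pass to limits, for two integrals of the
  transform: an inner one, continuous under bounded pointwise convergence, and a nonnegative outer
  cost, lower semicontinuous by Fatou's lemma when A > 1.\<close>

lemma Phi_conv:
  assumes F: "F \<in> classAp" and i: "integrable lborel (ct F)"
  shows "Phi A F = (LINT t|lborel. ct F t * indicator {-1..1} t) - (LINT t|lborel. outer_cost A (ct F t) * indicator outer t)"
proof -
  note fin = penalty_finite_if_integrable[OF i classApD(1)[OF F]]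
  have "Phi A F = (LINT t|lborel. ct F t - A * (max 0 (ct F t) * indicator outer t))"
    unfolding Phi_def pen_def using integrable_ct_if_penalty(3)[OF F fin] i integral_ct_eq_at_0[OF F i] by simp
  also have "\<dots> = (LINT t|lborel. ct F t * indicator {-1..1} t - outer_cost A (ct F t) * indicator outer t)"
    by (intro Bochner_Integration.integral_cong refl) (auto simp: outer_cost_def max_def algebra_simps split: split_indicator)
  also have "\<dots> = (LINT t|lborel. ct F t * indicator {-1..1} t) - (LINT t|lborel. outer_cost A (ct F t) * indicator outer t)"
    by (intro Bochner_Integration.integral_diff integrable_outer_cost[OF i] integrable_ct_on_bounded[OF classApD(1)[OF F], of _ 1]) auto
  finally show ?thesis .
qed

lemma L1norm_scale: "L1norm (\<lambda>x. c * F x :: real) = \<bar>c\<bar> * L1norm F"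
  by (simp add: L1norm_def abs_mult)

lemma abs_ct_le_L1norm: "integrable lborel F \<Longrightarrow> \<bar>ct F t\<bar> \<le> L1norm F"
  using abs_ct_le[of F t] by (simp add: L1norm_def)

lemma classAp_comb:
  assumes "F \<in> classAp" "G \<in> classAp"
  shows "(\<lambda>x. a * F x + b * G x) \<in> classAp"
  using assms by (auto simp: classAp_def intro!: continuous_intros)

lemma Phi_concave:
  assumes F: "F \<in> classAp" "integrable lborel (ct F)" and G: "G \<in> classAp" "integrable lborel (ct G)" and A: "A \<ge> 0"
  shows "Phi A (midpoint_fun F G) \<ge> (Phi A F + Phi A G) / 2"
    and "integrable lborel (ct (midpoint_fun F G))"
    and "ct (midpoint_fun F G) t = (ct F t + ct G t) / 2"
proof -
  have c: "ct (midpoint_fun F G) t = (ct F t + ct G t) / 2" for t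
    using classApD(1)[OF F(1)] classApD(1)[OF G(1)]
    by (subst ct_add) (auto simp only: ct_cmult integrable_mult_right, simp add: add_divide_distrib)
  show "ct (midpoint_fun F G) t = (ct F t + ct G t) / 2" by (rule c)
  show i: "integrable lborel (ct (midpoint_fun F G))"
    unfolding c[abs_def] using F G by simp
  have p: "integrable lborel (\<lambda>t. max 0 (ct H t) * indicator outer t)" if "H \<in> classAp" "integrable lborel (ct H)" for H
    using integrable_ct_if_penalty(3)[OF that(1) penalty_finite_if_integrable[OF that(2) classApD(1)[OF that(1)]]] .
  have "pen (midpoint_fun F G) \<le> (LINT t|lborel. (1/2) * (max 0 (ct F t) * indicator outer t) + (1/2) * (max 0 (ct G t) * indicator outer t))"
    unfolding pen_def
  proof (rule integral_mono)
    show "integrable lborel (\<lambda>t. max 0 (ct (midpoint_fun F G) t) * indicator outer t)"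
      by (rule p[OF classAp_comb[OF F(1) G(1)] i])
    show "integrable lborel (\<lambda>t. (1/2) * (max 0 (ct F t) * indicator outer t) + (1/2) * (max 0 (ct G t) * indicator outer t))"
      using p[OF F] p[OF G] by simp
  qed (unfold c, auto split: split_indicator)
  also have "\<dots> = (pen F + pen G) / 2"
    using p[OF F] p[OF G] by (simp add: pen_def add_divide_distrib)
  finally have "A * pen (midpoint_fun F G) \<le> A * ((pen F + pen G) / 2)"
    by (rule mult_left_mono[OF _ A])
  thus "Phi A (midpoint_fun F G) \<ge> (Phi A F + Phi A G) / 2"
    by (simp add: Phi_def field_simps)
qed

lemma Phi_scale:
  assumes "c \<ge> 0"
  shows "Phi A (\<lambda>x. c * F x) = c * Phi A F"
proof -
  have "max 0 (c * y) = c * max 0 y" for y :: real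
    using assms by (simp add: max_mult_distrib_left)
  hence "pen (\<lambda>x. c * F x) = c * pen F"
    unfolding pen_def ct_cmult by (simp add: mult.assoc)
  thus ?thesis by (simp add: Phi_def algebra_simps)
qed

lemma L1norm_midpoint:
  fixes F G :: "real \<Rightarrow> real"
  assumes "integrable lborel F" "integrable lborel G"
  shows "L1norm (midpoint_fun F G) \<le> (L1norm F + L1norm G) / (2::real)"
proof -
  have "L1norm (midpoint_fun F G) \<le> (LINT x|lborel. (1/2) * \<bar>F x\<bar> + (1/2) * \<bar>G x\<bar>)"
    unfolding L1norm_def using assms by (intro integral_mono) auto
  thus ?thesis using assms by (simp add: L1norm_def)
qed

lemma ennreal_half_sum:
  assumes "a \<ge> 0" "b \<ge> 0"
  shows "ennreal ((a + b) / 2) = ennreal (1/2) * (ennreal a + ennreal b)"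
proof -
  have "ennreal ((a + b) / 2) = ennreal (1/2 * (a + b))" by simp
  also have "\<dots> = ennreal (1/2) * ennreal (a + b)" by (rule ennreal_mult) (use assms in auto)
  finally show ?thesis unfolding ennreal_plus[OF assms] .
qed

text \<open>The function on the left is the convolution of \<open>F\<close> with a normal density,
  so Tonelli's theorem gives the bound. It expresses control of the norm through the transform
  alone, in a form that survives bounded pointwise limits of transforms.\<close>

lemma L1_smoothing:
  assumes F: "integrable lborel F" and ev: "\<And>x. F (- x) = F x" and e: "e > 0"
  shows "(\<integral>\<^sup>+x. ennreal \<bar>ct (\<lambda>t. ct F t * gauss e t) x\<bar> \<partial>lborel) \<le> ennreal (L1norm F)"
proof -
  note [measurable] = borel_measurable_integrable[OF F]
  define k where "k = ct (gauss e)"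
  have k: "k = normal_density 0 (e / (2 * pi))" unfolding k_def by (rule ct_gauss[OF e])
  have [measurable]: "k \<in> borel_measurable borel" unfolding k by measurable
  have k0: "k y \<ge> 0" for y unfolding k by (rule normal_density_nonneg)
  have ik: "(\<integral>\<^sup>+y. ennreal (k y) \<partial>lborel) = 1"
    unfolding k using e by (subst nn_integral_eq_integral) (auto intro: normal_density_nonneg)
  have eq: "ct (\<lambda>t. ct F t * gauss e t) x = (LINT y|lborel. F y * sym_shift x k y)" for x
  proof -
    have "ct (\<lambda>t. ct F t * gauss e t) x = (LINT t|lborel. ct F t * (cos (2 * pi * x * t) * gauss e t))"
      unfolding ct_def[of "\<lambda>t. ct F t * gauss e t"] by (simp add: mult_ac)
    also have "\<dots> = (LINT y|lborel. F y * ct (\<lambda>t. cos (2 * pi * x * t) * gauss e t) y)"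
      using integrable_cos_mult[OF integrable_gauss[OF e], of x]
      by (intro ct_mult_formula(1)[OF F]) (simp add: mult_ac)
    finally show ?thesis unfolding k_def ct_gauss_cos[OF e] .
  qed
  have le: "ennreal \<bar>ct (\<lambda>t. ct F t * gauss e t) x\<bar> \<le> (\<integral>\<^sup>+y. ennreal \<bar>F y\<bar> * ennreal (sym_shift x k y) \<partial>lborel)" for x
  proof -
    have "ennreal \<bar>ct (\<lambda>t. ct F t * gauss e t) x\<bar> \<le> (\<integral>\<^sup>+y. ennreal (norm (F y * sym_shift x k y)) \<partial>lborel)"
      unfolding eq using integral_norm_bound_ennreal[of lborel "\<lambda>y. F y * sym_shift x k y"]
      by (cases "integrable lborel (\<lambda>y. F y * sym_shift x k y)") (auto simp: not_integrable_integral_eq)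
    also have "\<dots> = (\<integral>\<^sup>+y. ennreal \<bar>F y\<bar> * ennreal (sym_shift x k y) \<partial>lborel)"
      by (intro nn_integral_cong) (auto simp: abs_mult sym_shift_def k0 ennreal_mult[symmetric])
    finally show ?thesis .
  qed
  have [measurable]: "(\<lambda>(x, y). ennreal (sym_shift x k y)) \<in> borel_measurable (lborel \<Otimes>\<^sub>M lborel)"
    unfolding sym_shift_def by measurable
  have sh: "(\<integral>\<^sup>+x. ennreal (sym_shift x k y) \<partial>lborel) = 1" for y
  proof -
    have 1: "(\<integral>\<^sup>+x. ennreal (k (y + x)) \<partial>lborel) = 1"
      using nn_integral_real_affine[of "\<lambda>x. ennreal (k x)" 1 y] ik by simp
    have 2: "(\<integral>\<^sup>+x. ennreal (k (y - x)) \<partial>lborel) = 1"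
      using nn_integral_real_affine[of "\<lambda>x. ennreal (k x)" "-1" y] ik by simp
    have "(\<integral>\<^sup>+x. ennreal (sym_shift x k y) \<partial>lborel) = (\<integral>\<^sup>+x. ennreal (1/2) * (ennreal (k (y + x)) + ennreal (k (y - x))) \<partial>lborel)"
      unfolding sym_shift_def by (intro nn_integral_cong ennreal_half_sum k0)
    also have "\<dots> = ennreal (1/2) * (1 + 1)"
      by (subst nn_integral_cmult, measurable) (subst nn_integral_add, measurable, simp add: 1 2)
    also have "\<dots> = 1" using ennreal_half_sum[of 1 1] by simp
    finally show ?thesis .
  qed
  have "(\<integral>\<^sup>+x. ennreal \<bar>ct (\<lambda>t. ct F t * gauss e t) x\<bar> \<partial>lborel)
      \<le> (\<integral>\<^sup>+x. \<integral>\<^sup>+y. ennreal \<bar>F y\<bar> * ennreal (sym_shift x k y) \<partial>lborel \<partial>lborel)"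
    by (intro nn_integral_mono le)
  also have "\<dots> = (\<integral>\<^sup>+y. \<integral>\<^sup>+x. ennreal \<bar>F y\<bar> * ennreal (sym_shift x k y) \<partial>lborel \<partial>lborel)"
    by (rule lborel_pair.Fubini'[symmetric]) measurable
  also have "\<dots> = (\<integral>\<^sup>+y. ennreal \<bar>F y\<bar> \<partial>lborel)"
    by (intro nn_integral_cong) (subst nn_integral_cmult, measurable, simp add: sh)
  also have "\<dots> = ennreal (L1norm F)"
    unfolding L1norm_def using F by (subst nn_integral_eq_integral) auto
  finally show ?thesis .
qed

lemma fatou_bound:
  fixes f :: "nat \<Rightarrow> real \<Rightarrow> real"
  assumes m: "\<And>n. f n \<in> borel_measurable borel" and nn: "\<And>n x. 0 \<le> f n x"
    and lim: "AE x in lborel. (\<lambda>n. f n x) \<longlonglongrightarrow> g x"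
    and b: "\<And>n. (\<integral>\<^sup>+x. ennreal (f n x) \<partial>lborel) \<le> ennreal (B n)" "B \<longlonglongrightarrow> b"
  shows "(\<integral>\<^sup>+x. ennreal (g x) \<partial>lborel) \<le> ennreal b"
proof -
  note [measurable] = m
  have "(\<integral>\<^sup>+x. ennreal (g x) \<partial>lborel) = (\<integral>\<^sup>+x. liminf (\<lambda>n. ennreal (f n x)) \<partial>lborel)"
  proof (rule nn_integral_cong_AE)
    show "AE x in lborel. ennreal (g x) = liminf (\<lambda>n. ennreal (f n x))"
      using lim
    proof eventually_elim
      case (elim x)
      hence "(\<lambda>n. ennreal (f n x)) \<longlonglongrightarrow> ennreal (g x)" by (rule tendsto_ennrealI)
      thus ?case by (rule lim_imp_Liminf[symmetric, OF sequentially_bot])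
    qed
  qed
  also have "\<dots> \<le> liminf (\<lambda>n. \<integral>\<^sup>+x. ennreal (f n x) \<partial>lborel)"
    by (rule nn_integral_liminf) measurable
  also have "\<dots> \<le> liminf (\<lambda>n. ennreal (B n))"
    by (intro Liminf_mono always_eventually allI b)
  also have "\<dots> = ennreal b"
    by (rule lim_imp_Liminf[OF sequentially_bot tendsto_ennrealI[OF b(2)]])
  finally show ?thesis .
qed

text \<open>Integrating the sum of the differences term by term shows that the telescoping series
  converges absolutely almost everywhere; the positive weight can be divided out.\<close>

lemma AE_convergent_if_summable_L1:
  fixes h :: "nat \<Rightarrow> real \<Rightarrow> real" and w :: "real \<Rightarrow> real"
  assumes w: "\<And>t. w t > 0" "w \<in> borel_measurable borel"
    and h: "\<And>k. h k \<in> borel_measurable borel"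
    and i: "\<And>k. integrable lborel (\<lambda>t. \<bar>h (Suc k) t - h k t\<bar> * w t)"
    and s: "summable (\<lambda>k. LINT t|lborel. \<bar>h (Suc k) t - h k t\<bar> * w t)"
  shows "AE t in lborel. convergent (\<lambda>k. h k t)"
proof -
  note [measurable] = w(2) h
  define d where "d k t = \<bar>h (Suc k) t - h k t\<bar> * w t" for k t
  have d0: "d k t \<ge> 0" for k t using w(1)[of t] by (simp add: d_def)
  have [measurable]: "d k \<in> borel_measurable borel" for k unfolding d_def by measurable
  have "(\<integral>\<^sup>+t. (\<Sum>k. ennreal (d k t)) \<partial>lborel) = (\<Sum>k. \<integral>\<^sup>+t. ennreal (d k t) \<partial>lborel)"
    by (rule nn_integral_suminf) measurable
  also have "\<dots> = (\<Sum>k. ennreal (LINT t|lborel. d k t))"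
    using i d0 by (intro suminf_cong nn_integral_eq_integral) (auto simp: d_def)
  also have "\<dots> = ennreal (\<Sum>k. LINT t|lborel. d k t)"
    using s d0 by (intro suminf_ennreal2) (auto simp: d_def[symmetric])
  finally have "(\<integral>\<^sup>+t. (\<Sum>k. ennreal (d k t)) \<partial>lborel) \<noteq> \<infinity>" by simp
  hence "AE t in lborel. (\<Sum>k. ennreal (d k t)) \<noteq> \<infinity>"
    by (intro nn_integral_PInf_AE) auto
  thus ?thesis
  proof eventually_elim
    case (elim t)
    have "summable (\<lambda>k. d k t)"
      using elim d0 by (intro summable_suminf_not_top) auto
    hence "summable (\<lambda>k. d k t * (1 / w t))" by (rule summable_mult2)
    hence "summable (\<lambda>k. \<bar>h (Suc k) t - h k t\<bar>)" using w(1)[of t] by (simp add: d_def)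
    hence "summable (\<lambda>k. h (Suc k) t - h k t)" by (rule summable_rabs_cancel)
    hence "convergent (\<lambda>n. \<Sum>k<n. h (Suc k) t - h k t)" by (simp add: summable_iff_convergent)
    hence "convergent (\<lambda>n. h n t - h 0 t)" unfolding sum_lessThan_telescope[of "\<lambda>k. h k t"] .
    hence "convergent (\<lambda>n. (h n t - h 0 t) + h 0 t)" by (intro convergent_add convergent_const)
    thus ?case by simp
  qed
qed

text \<open>Compactness without weak limits: among near-maximisers choose one nearly minimising a
  strictly convex quadratic functional; the parallelogram law then makes the transforms Cauchy.\<close>

lemma parallelogram_selection:
  fixes U :: "nat \<Rightarrow> 'a set" and N :: "'a \<Rightarrow> real"
  assumes ne: "\<And>n. U n \<noteq> {}" and dec: "\<And>m n. m \<le> n \<Longrightarrow> U n \<subseteq> U m"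
    and nn: "\<And>n F. F \<in> U n \<Longrightarrow> 0 \<le> N F" and bd: "\<And>n F. F \<in> U n \<Longrightarrow> N F \<le> B"
  shows "\<exists>(F :: nat \<Rightarrow> 'a) (m :: nat \<Rightarrow> nat). \<forall>k. k \<le> m k \<and> F k \<in> U (m k) \<and> F (Suc k) \<in> U (m k)
    \<and> (\<forall>G \<in> U (m k). 2 * N (F k) + 2 * N (F (Suc k)) - 4 * N G \<le> 8 * (1/4)^k)"
proof -
  define d where "d n = Inf (N ` U n)" for n
  have bb: "bdd_below (N ` U n)" for n using nn by (auto intro!: bdd_belowI[of _ 0])
  have dle: "d n \<le> N F" if "F \<in> U n" for n F
    unfolding d_def using that bb by (intro cInf_lower) auto
  have dB: "d n \<le> B" for n using ne[of n] dle bd by (meson ex_in_conv order_trans)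
  have "mono d"
  proof (rule monoI)
    fix m n :: nat assume "m \<le> n"
    thus "d m \<le> d n"
      unfolding d_def using dec[of m n] ne bb by (intro cInf_superset_mono) auto
  qed
  then obtain D where D: "d \<longlonglongrightarrow> D" "\<And>n. d n \<le> D"
    using incseq_convergent[of d B] dB by auto
  have "\<exists>M. \<forall>n\<ge>M. D - (1/4)^k < d n" for k :: nat
    using order_tendstoD(1)[OF D(1), of "D - (1/4)^k"] by (simp add: eventually_sequentially)
  then obtain M where M: "\<And>k n. M k \<le> n \<Longrightarrow> D - (1/4)^k < d n" by metis
  \<comment> \<open>Summing all thresholds up to k makes \<open>m\<close> monotone and at least
    \<open>M k\<close>; adding k forces it to infinity.\<close>
  define m where "m k = (\<Sum>i\<le>k. M i) + k" for k
  have mM: "M k \<le> m k" and mk: "k \<le> m k" and ms: "m k \<le> m (Suc k)" for k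
    unfolding m_def by (auto intro!: trans_le_add1 member_le_sum)
  have "\<exists>F\<in>U (m k). N F < d (m k) + (1/4)^k" for k
  proof -
    have "Inf (N ` U (m k)) < d (m k) + (1/4)^k" unfolding d_def by simp
    thus ?thesis using ne by (subst (asm) cInf_less_iff) (auto simp: bb)
  qed
  then obtain F where F: "\<And>k. F k \<in> U (m k)" "\<And>k. N (F k) < d (m k) + (1/4)^k" by metis
  show ?thesis
  proof (intro exI[of _ F] exI[of _ m] allI conjI ballI)
    fix k G assume G: "G \<in> U (m k)"
    \<comment> \<open>Both chosen values lie below D + 4^-k and every competitor lies above D -
      4^-k, which accounts for 8 = 2 + 2 + 4.\<close>
    have "N (F k) < D + (1/4)^k" using F(2)[of k] D(2)[of "m k"] by simp
    moreover have "N (F (Suc k)) < D + (1/4)^k"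
    proof -
      have "(1/4 :: real)^Suc k \<le> (1/4)^k" by (rule power_decreasing) auto
      thus ?thesis using F(2)[of "Suc k"] D(2)[of "m (Suc k)"] by linarith
    qed
    moreover have "N G > D - (1/4)^k" using dle[OF G] M[OF mM[of k]] by simp
    ultimately show "2 * N (F k) + 2 * N (F (Suc k)) - 4 * N G \<le> 8 * (1/4)^k" by argo
  next
    show "F (Suc k) \<in> U (m k)" for k by (rule subsetD[OF dec[OF ms] F(1)])
  qed (use F mk in auto)
qed

lemma integrable_bounded_gauss:
  assumes "f \<in> borel_measurable borel" "\<And>t. \<bar>f t\<bar> \<le> (B::real)" "e > 0"
  shows "integrable lborel (\<lambda>t. f t * gauss e t)"
proof (rule Bochner_Integration.integrable_bound)
  show "integrable lborel (\<lambda>t. B * gauss e t)" using integrable_gauss[OF assms(3)] by simp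
  show "AE t in lborel. norm (f t * gauss e t) \<le> norm (B * gauss e t)"
  proof (intro always_eventually allI)
    fix t
    have "\<bar>f t\<bar> * gauss e t \<le> B * gauss e t"
      using assms(2) gauss_bounds(1)[of e t] by (intro mult_right_mono) auto
    also have "\<dots> \<le> \<bar>B * gauss e t\<bar>" by (rule abs_ge_self)
    finally show "norm (f t * gauss e t) \<le> norm (B * gauss e t)"
      using gauss_bounds(1)[of e t] by (simp add: abs_mult)
  qed
qed (use assms(1) in measurable)

text \<open>Formulated for a convex cone \<open>S\<close> closed under almost everywhere limits of
  transforms, so that A+ with integrable transforms and E+ are covered by one argument.\<close>

lemma extremizer_exists:
  fixes S :: "(real \<Rightarrow> real) set"
  assumes A: "A > 1"
    and S: "\<And>F. F \<in> S \<Longrightarrow> F \<in> classAp" "\<And>F. F \<in> S \<Longrightarrow> integrable lborel (ct F)"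
    and mid: "\<And>F G. F \<in> S \<Longrightarrow> G \<in> S \<Longrightarrow> (midpoint_fun F G) \<in> S"
    and scale: "\<And>F c. F \<in> S \<Longrightarrow> c > 0 \<Longrightarrow> (\<lambda>x. c * F x) \<in> S"
    and closed: "\<And>F G. \<lbrakk>\<And>k :: nat. F k \<in> S; G \<in> classAp; integrable lborel (ct G);
        AE t in lborel. (\<lambda>k. ct (F k) t) \<longlonglongrightarrow> ct G t\<rbrakk> \<Longrightarrow> G \<in> S"
    and pos: "F0 \<in> S" "F0 \<noteq> (\<lambda>_. 0)" "Phi A F0 > 0"
  obtains G where "G \<in> S" "G \<noteq> (\<lambda>_. 0)"
    "\<And>F. F \<in> S \<Longrightarrow> F \<noteq> (\<lambda>_. 0) \<Longrightarrow> Phi A F / L1norm F \<le> Phi A G / L1norm G"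
proof -
  define R where "R = (\<lambda>F. Phi A F / L1norm F) ` {F \<in> S. F \<noteq> (\<lambda>_. 0)}"
  have R2: "r \<le> 2" if r: "r \<in> R" for r
  proof -
    obtain F where F: "F \<in> S" "F \<noteq> (\<lambda>_. 0)" "r = Phi A F / L1norm F" using r unfolding R_def by blast
    have "Phi A F < 2 * L1norm F"
      unfolding Phi_def using functional_less_2[of F A] F S A by auto
    thus ?thesis unfolding F(3) using L1norm_pos_Ap[OF S(1)[OF F(1)] F(2)] by (simp add: pos_divide_le_eq)
  qed
  hence bR: "bdd_above R" by (auto intro!: bdd_aboveI)
  define C where "C = Sup R"
  have CR: "Phi A F / L1norm F \<le> C" if "F \<in> S" "F \<noteq> (\<lambda>_. 0)" for F
    unfolding C_def by (rule cSup_upper[OF _ bR]) (use that in \<open>unfold R_def, blast\<close>)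
  have Cpos: "C > 0"
    using CR[OF pos(1,2)] divide_pos_pos[OF pos(3) L1norm_pos_Ap[OF S(1)[OF pos(1)] pos(2)]] by linarith
  \<comment> \<open>Bounding the norm by 1 instead of fixing it makes \<open>U n\<close> stable
    under midpoints.\<close>
  define U where "U n = {F \<in> S. L1norm F \<le> 1 \<and> Phi A F \<ge> C - 1 / real (Suc n)}" for n
  \<comment> \<open>On \<open>U n\<close> the transforms are bounded by 1, so the Gaussian weight
    bounds this squared norm uniformly.\<close>
  define N where "N F = (LINT t|lborel. (ct F t)\<^sup>2 * gauss 1 t)" for F
  define B where "B = (LINT t|lborel. gauss 1 t)"
  have ig: "integrable lborel (gauss 1)" by (simp add: integrable_gauss)
  have m [measurable]: "ct F \<in> borel_measurable borel" if "F \<in> S" for F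
    using that S by (intro borel_measurable_ct classApD)
  have ab: "\<bar>ct F t\<bar> \<le> 1" if "F \<in> U n" for F n t
  proof -
    have "F \<in> S" "L1norm F \<le> 1" using that by (simp_all add: U_def)
    thus ?thesis using abs_ct_le_L1norm[OF classApD(1)[OF S(1)], of F t] by linarith
  qed
  have ne: "U n \<noteq> {}" for n
  proof -
    have "C - 1 / real (Suc n) < Sup R" unfolding C_def by simp
    moreover have "R \<noteq> {}" using pos(1,2) unfolding R_def by blast
    ultimately obtain r where "r \<in> R" "C - 1 / real (Suc n) < r"
      using bR by (subst (asm) less_cSup_iff) auto
    then obtain F where F: "F \<in> S" "F \<noteq> (\<lambda>_. 0)" "C - 1 / real (Suc n) < Phi A F / L1norm F" unfolding R_def by blast
    have Np: "L1norm F > 0" using F S L1norm_pos_Ap by blast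
    have "(\<lambda>x. (1 / L1norm F) * F x) \<in> U n"
    proof -
      have "L1norm (\<lambda>x. (1 / L1norm F) * F x) = 1" unfolding L1norm_scale using Np by simp
      moreover have "Phi A (\<lambda>x. (1 / L1norm F) * F x) = Phi A F / L1norm F"
        by (subst Phi_scale) (use Np in auto)
      moreover have "(\<lambda>x. (1 / L1norm F) * F x) \<in> S" by (rule scale[OF F(1)]) (use Np in simp)
      ultimately show ?thesis unfolding U_def using F(3) by (simp only: mem_Collect_eq) simp
    qed
    thus ?thesis by auto
  qed
  have dec: "U n \<subseteq> U m" if "m \<le> n" for m n
  proof -
    have "1 / real (Suc n) \<le> 1 / real (Suc m)" using that by (intro divide_left_mono) auto
    thus ?thesis unfolding U_def by auto
  qed
  have Nn: "0 \<le> N F" if "F \<in> U n" for n F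
    unfolding N_def by (intro Bochner_Integration.integral_nonneg) (auto simp: gauss_bounds less_imp_le)
  have iN: "integrable lborel (\<lambda>t. (ct F t)\<^sup>2 * gauss 1 t)" if "F \<in> U n" for n F
  proof (rule integrable_bounded_gauss)
    show "(\<lambda>t. (ct F t)\<^sup>2) \<in> borel_measurable borel" using that m by (auto simp: U_def)
    show "\<bar>(ct F t)\<^sup>2\<bar> \<le> 1" for t using ab[OF that, of t] by (simp add: abs_square_le_1)
  qed simp
  have NB: "N F \<le> B" if "F \<in> U n" for n F
    unfolding N_def B_def
  proof (rule integral_mono[OF iN[OF that] ig])
    fix t
    have "(ct F t)\<^sup>2 \<le> 1" using ab[OF that, of t] by (simp add: abs_square_le_1)
    thus "(ct F t)\<^sup>2 * gauss 1 t \<le> gauss 1 t"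
      using gauss_bounds(1)[of 1 t] by (simp add: mult_left_le_one_le)
  qed
  have midU: "(midpoint_fun F G) \<in> U n" if "F \<in> U n" "G \<in> U n" for F G n
  proof -
    have FG: "F \<in> S" "G \<in> S" using that by (auto simp: U_def)
    have "L1norm (midpoint_fun F G) \<le> (L1norm F + L1norm G) / 2"
      using FG S classApD by (intro L1norm_midpoint) auto
    moreover have "Phi A (midpoint_fun F G) \<ge> (Phi A F + Phi A G) / 2"
      using FG S A by (intro Phi_concave) auto
    ultimately show ?thesis using that mid[OF FG] unfolding U_def by auto
  qed
  have "\<exists>F q. \<forall>k. k \<le> q k \<and> F k \<in> U (q k) \<and> F (Suc k) \<in> U (q k)
    \<and> (\<forall>G \<in> U (q k). 2 * N (F k) + 2 * N (F (Suc k)) - 4 * N G \<le> 8 * (1/4)^k)"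
  proof (rule parallelogram_selection[of U N B])
    show "U n \<noteq> {}" for n by (rule ne)
    show "U n \<subseteq> U m" if "m \<le> n" for m n by (rule dec[OF that])
    show "0 \<le> N F" if "F \<in> U n" for n F by (rule Nn[OF that])
    show "N F \<le> B" if "F \<in> U n" for n F by (rule NB[OF that])
  qed
  then obtain F q where Fq: "\<And>k. k \<le> q k" "\<And>k. F k \<in> U (q k)" "\<And>k. F (Suc k) \<in> U (q k)"
    "\<And>k G. G \<in> U (q k) \<Longrightarrow> 2 * N (F k) + 2 * N (F (Suc k)) - 4 * N G \<le> 8 * (1/4)^k"
    by blast
  have FS: "F k \<in> S" for k using Fq(2)[of k] by (simp add: U_def)
  define h where "h k = ct (F k)" for k
  have hm [measurable]: "h k \<in> borel_measurable borel" for k unfolding h_def by (rule m[OF FS])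
  have h1: "\<bar>h k t\<bar> \<le> 1" for k t unfolding h_def by (rule ab[OF Fq(2)])
  have diff2: "(LINT t|lborel. (h (Suc k) t - h k t)\<^sup>2 * gauss 1 t) \<le> 8 * (1/4)^k"
    and idiff2: "integrable lborel (\<lambda>t. (h (Suc k) t - h k t)\<^sup>2 * gauss 1 t)" for k
  proof -
    let ?G = "\<lambda>x. (1/2) * F k x + (1/2) * F (Suc k) x"
    have GU: "?G \<in> U (q k)" by (rule midU[OF Fq(2,3)])
    have cG: "ct ?G t = (h k t + h (Suc k) t) / 2" for t
      unfolding h_def using FS S A by (intro Phi_concave(3)[of _ _ A]) auto
    \<comment> \<open>The parallelogram identity; the midpoint is the competitor in the minimality
      estimate.\<close>
    have eq: "(h (Suc k) t - h k t)\<^sup>2 * gauss 1 t = 2 * ((h k t)\<^sup>2 * gauss 1 t) + 2 * ((h (Suc k) t)\<^sup>2 * gauss 1 t) - 4 * ((ct ?G t)\<^sup>2 * gauss 1 t)" for t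
      unfolding cG by (simp add: power2_eq_square algebra_simps)
    have i: "integrable lborel (\<lambda>t. 2 * ((h k t)\<^sup>2 * gauss 1 t))" "integrable lborel (\<lambda>t. 2 * ((h (Suc k) t)\<^sup>2 * gauss 1 t))"
      "integrable lborel (\<lambda>t. 4 * ((ct ?G t)\<^sup>2 * gauss 1 t))"
      unfolding h_def by (intro integrable_mult_right iN[OF Fq(2)] iN[OF Fq(3)] iN[OF GU])+
    show "integrable lborel (\<lambda>t. (h (Suc k) t - h k t)\<^sup>2 * gauss 1 t)"
      unfolding eq by (intro Bochner_Integration.integrable_diff Bochner_Integration.integrable_add i)
    have "(LINT t|lborel. (h (Suc k) t - h k t)\<^sup>2 * gauss 1 t) = 2 * N (F k) + 2 * N (F (Suc k)) - 4 * N ?G"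
      unfolding eq Bochner_Integration.integral_diff[OF Bochner_Integration.integrable_add[OF i(1,2)] i(3)]
        Bochner_Integration.integral_add[OF i(1,2)]
      unfolding N_def h_def integral_mult_right_zero ..
    thus "(LINT t|lborel. (h (Suc k) t - h k t)\<^sup>2 * gauss 1 t) \<le> 8 * (1/4)^k"
      using Fq(4)[OF GU] by simp
  qed
  have conv: "AE t in lborel. convergent (\<lambda>k. h k t)"
  proof (rule AE_convergent_if_summable_L1[where w = "gauss 1"])
    show i1: "integrable lborel (\<lambda>t. \<bar>h (Suc k) t - h k t\<bar> * gauss 1 t)" for k
    proof (rule integrable_bounded_gauss)
      show "\<bar>\<bar>h (Suc k) t - h k t\<bar>\<bar> \<le> 2" for t using h1[of k t] h1[of "Suc k" t] by simp
    qed auto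
    show "summable (\<lambda>k. LINT t|lborel. \<bar>h (Suc k) t - h k t\<bar> * gauss 1 t)"
    proof (rule summable_comparison_test')
      show "summable (\<lambda>k. (4 + B / 2) * (1/2::real)^k)" by (intro summable_mult summable_geometric) simp
      fix k :: nat
      have "(LINT t|lborel. \<bar>h (Suc k) t - h k t\<bar> * gauss 1 t)
          \<le> (LINT t|lborel. (2^k / 2) * ((h (Suc k) t - h k t)\<^sup>2 * gauss 1 t) + ((1/2)^k / 2) * gauss 1 t)"
      proof (rule integral_mono[OF i1])
        show "integrable lborel (\<lambda>t. (2^k / 2) * ((h (Suc k) t - h k t)\<^sup>2 * gauss 1 t) + ((1/2)^k / 2) * gauss 1 t)"
          using idiff2 ig by simp
        fix t
        define x where "x = \<bar>h (Suc k) t - h k t\<bar>"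
        \<comment> \<open>An AM-GM inequality with scale 2^k: the squared differences integrate to
          O(4^-k), so after multiplication by 2^k they are summable, and so is the added
          2^-k.\<close>
        have "0 \<le> (2^k * x - 1)\<^sup>2 * (1/2)^k / 2" by simp
        also have "\<dots> = (2^k / 2) * x\<^sup>2 - x + (1/2)^k / 2"
          by (simp add: power2_eq_square field_simps power_divide)
        finally have "x \<le> (2^k / 2) * x\<^sup>2 + (1/2)^k / 2" by simp
        hence "x * gauss 1 t \<le> ((2^k / 2) * x\<^sup>2 + (1/2)^k / 2) * gauss 1 t"
          using gauss_bounds(1)[of 1 t] by (intro mult_right_mono) auto
        thus "\<bar>h (Suc k) t - h k t\<bar> * gauss 1 t \<le> (2^k / 2) * ((h (Suc k) t - h k t)\<^sup>2 * gauss 1 t) + ((1/2)^k / 2) * gauss 1 t"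
          by (simp add: x_def algebra_simps)
      qed
      also have "\<dots> = (2^k / 2) * (LINT t|lborel. (h (Suc k) t - h k t)\<^sup>2 * gauss 1 t) + ((1/2)^k / 2) * B"
        using idiff2 ig by (simp add: B_def)
      also have "\<dots> \<le> (2^k / 2) * (8 * (1/4)^k) + ((1/2)^k / 2) * B"
        using diff2 by (intro add_right_mono mult_left_mono) auto
      also have "\<dots> = (4 + B / 2) * (1/2)^k"
      proof -
        have "(2::real)^k * (1/4)^k = (1/2)^k" by (simp flip: power_mult_distrib)
        thus ?thesis by (simp add: algebra_simps)
      qed
      finally have "(LINT t|lborel. \<bar>h (Suc k) t - h k t\<bar> * gauss 1 t) \<le> (4 + B / 2) * (1/2)^k" .
      moreover have "0 \<le> (LINT t|lborel. \<bar>h (Suc k) t - h k t\<bar> * gauss 1 t)"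
        by (intro Bochner_Integration.integral_nonneg) (auto simp: gauss_bounds less_imp_le)
      ultimately show "norm (LINT t|lborel. \<bar>h (Suc k) t - h k t\<bar> * gauss 1 t) \<le> (4 + B / 2) * (1/2)^k" by simp
    qed
  qed (auto simp: gauss_bounds)
  define g where "g t = lim (\<lambda>k. h k t)" for t
  have gm [measurable]: "g \<in> borel_measurable borel"
    unfolding g_def by (rule borel_measurable_lim_metric) measurable
  have gev: "g (- t) = g t" for t unfolding g_def h_def ct_minus ..
  have lim: "AE t in lborel. (\<lambda>k. h k t) \<longlonglongrightarrow> g t"
    using conv by eventually_elim (simp add: g_def convergent_LIMSEQ_iff)
  have g1: "AE t in lborel. \<bar>g t\<bar> \<le> 1"
    using lim
  proof eventually_elim
    case (elim t)
    show ?case by (rule LIMSEQ_le_const2[OF tendsto_rabs[OF elim]]) (use h1 in blast)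
  qed
  define inn where "inn f = (LINT t|lborel. f t * indicator {-1..1} t)" for f :: "real \<Rightarrow> real"
  define out where "out f = (LINT t|lborel. outer_cost A (f t) * indicator outer t)" for f :: "real \<Rightarrow> real"
  have inlim: "(\<lambda>k. inn (h k)) \<longlonglongrightarrow> inn g"
    unfolding inn_def
  proof (rule integral_dominated_convergence[where w = "indicator {-1..1}"])
    show "integrable lborel (indicator {-1..1} :: real \<Rightarrow> real)" by (rule integrable_indicator_Icc)
    show "AE t in lborel. (\<lambda>k. h k t * indicator {-1..1} t) \<longlonglongrightarrow> g t * indicator {-1..1} t"
      using lim by eventually_elim (intro tendsto_intros)
    show "AE t in lborel. norm (h k t * indicator {-1..1} t) \<le> indicator {-1..1} t" for k
      using h1 by (auto split: split_indicator)
  qed measurable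
  have hk: "integrable lborel (h k)" for k unfolding h_def by (rule S(2)[OF FS])
  have outk: "out (h k) \<le> inn (h k) - C + 1 / real (Suc k)" for k
  proof -
    have "C - 1 / real (Suc (q k)) \<le> Phi A (F k)" using Fq(2)[of k] by (simp add: U_def)
    also have "\<dots> = inn (h k) - out (h k)"
      unfolding inn_def out_def h_def by (rule Phi_conv[OF S(1)[OF FS] S(2)[OF FS]])
    finally have "out (h k) \<le> inn (h k) - C + 1 / real (Suc (q k))" by simp
    moreover have "1 / real (Suc (q k)) \<le> 1 / real (Suc k)" using Fq(1)[of k] by (intro divide_left_mono) auto
    ultimately show ?thesis by simp
  qed
  \<comment> \<open>Mass lost in the limit only helps, since the outer cost enters the functional
    with a minus sign.\<close>
  have outg: "(\<integral>\<^sup>+t. ennreal (outer_cost A (g t) * indicator outer t) \<partial>lborel) \<le> ennreal (inn g - C)"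
  proof (rule fatou_bound)
    show "AE t in lborel. (\<lambda>k. outer_cost A (h k t) * indicator outer t) \<longlonglongrightarrow> outer_cost A (g t) * indicator outer t"
      using lim unfolding outer_cost_def by eventually_elim (intro tendsto_intros)
    show "(\<integral>\<^sup>+t. ennreal (outer_cost A (h k t) * indicator outer t) \<partial>lborel) \<le> ennreal (inn (h k) - C + 1 / real (Suc k))" for k
      using outk[of k] outer_cost_nonneg[OF A] unfolding out_def
      by (subst nn_integral_eq_integral[OF integrable_outer_cost[OF hk]]) (auto intro!: ennreal_leI)
    have "(\<lambda>k. inn (h k) - C + 1 / real (Suc k)) \<longlonglongrightarrow> inn g - C + 0"
      by (intro tendsto_intros inlim LIMSEQ_Suc[OF lim_1_over_n])
    thus "(\<lambda>k. inn (h k) - C + 1 / real (Suc k)) \<longlonglongrightarrow> inn g - C" by simp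
  qed (auto simp: outer_cost_nonneg[OF A])
  have iog: "integrable lborel (\<lambda>t. outer_cost A (g t) * indicator outer t)"
  proof (rule integrableI_nonneg)
    show "(\<integral>\<^sup>+t. ennreal (outer_cost A (g t) * indicator outer t) \<partial>lborel) < \<infinity>"
      by (rule le_less_trans[OF outg]) simp
  qed (auto simp: outer_cost_nonneg[OF A])
  have "ennreal (out g) \<le> ennreal (inn g - C)"
    using outg outer_cost_nonneg[OF A] unfolding out_def by (subst (asm) nn_integral_eq_integral[OF iog]) auto
  moreover have "0 \<le> out g" unfolding out_def using outer_cost_nonneg[OF A] by (intro Bochner_Integration.integral_nonneg) auto
  \<comment> \<open>Needed because \<open>ennreal\<close> truncates negative numbers to 0, so the
    preceding inequality alone would not yield one between reals.\<close>
  moreover have "0 \<le> inn g - C"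
  proof (rule LIMSEQ_le_const)
    show "(\<lambda>k. inn (h k) - C + 1 / real (Suc k)) \<longlonglongrightarrow> inn g - C"
      using tendsto_add[OF tendsto_diff[OF inlim tendsto_const[of C]] LIMSEQ_Suc[OF lim_1_over_n]] by simp
    have "0 \<le> inn (h k) - C + 1 / real (Suc k)" for k
    proof -
      have "0 \<le> out (h k)" unfolding out_def using outer_cost_nonneg[OF A] by (intro Bochner_Integration.integral_nonneg) auto
      thus ?thesis using outk[of k] by simp
    qed
    thus "\<exists>N. \<forall>k\<ge>N. 0 \<le> inn (h k) - C + 1 / real (Suc k)" by blast
  qed
  ultimately have og: "C \<le> inn g - out g" by simp
  \<comment> \<open>Here A > 1 enters: the finite outer cost dominates a multiple of |g| outside
    [-1, 1], while inside |g| is at most 1.\<close>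
  have ig': "integrable lborel g"
  proof (rule Bochner_Integration.integrable_bound)
    show "integrable lborel (\<lambda>t. indicator {-1..1} t + max 1 (1 / (A - 1)) * (outer_cost A (g t) * indicator outer t))"
      using iog integrable_indicator_Icc[of 1] by simp
    show "AE t in lborel. norm (g t) \<le> norm (indicator {-1..1} t + max 1 (1 / (A - 1)) * (outer_cost A (g t) * indicator outer t))"
      using g1
    proof eventually_elim
      case (elim t)
      show ?case
        using elim abs_le_outer_cost[OF A, of "g t"] by (auto simp: indicator_def abs_if)
    qed
  qed measurable
  define G where "G = ct g"
  have Gm [measurable]: "G \<in> borel_measurable borel" unfolding G_def by (rule borel_measurable_ct[OF ig'])
  \<comment> \<open>The norm bound survives in two stages, each by Fatou's lemma in x: first k tends
    to infinity with the Gaussian factor fixed, then the Gaussian factor is removed.\<close>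
  have smooth: "(\<integral>\<^sup>+x. ennreal \<bar>ct (\<lambda>t. g t * gauss e t) x\<bar> \<partial>lborel) \<le> ennreal 1" if e: "e > 0" for e
  proof (rule fatou_bound)
    have ih: "integrable lborel (\<lambda>t. h k t * gauss e t)" for k
      by (rule integrable_bounded_gauss[OF hm h1 e])
    show "(\<lambda>x. \<bar>ct (\<lambda>t. h k t * gauss e t) x\<bar>) \<in> borel_measurable borel" for k
      using borel_measurable_ct[OF ih] by measurable
    show "(\<integral>\<^sup>+x. ennreal \<bar>ct (\<lambda>t. h k t * gauss e t) x\<bar> \<partial>lborel) \<le> ennreal 1" for k
    proof -
      have "L1norm (F k) \<le> 1" using Fq(2)[of k] by (simp add: U_def)
      thus ?thesis
        unfolding h_def using L1_smoothing[OF classApD(1,2)[OF S(1)[OF FS]] e, of k]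
        by (meson ennreal_leI order_trans)
    qed
    show "AE x in lborel. (\<lambda>k. \<bar>ct (\<lambda>t. h k t * gauss e t) x\<bar>) \<longlonglongrightarrow> \<bar>ct (\<lambda>t. g t * gauss e t) x\<bar>"
    proof (intro always_eventually allI tendsto_rabs)
      fix x
      show "(\<lambda>k. ct (\<lambda>t. h k t * gauss e t) x) \<longlonglongrightarrow> ct (\<lambda>t. g t * gauss e t) x"
        unfolding ct_def
      proof (rule integral_dominated_convergence[where w = "gauss e"])
        show "integrable lborel (gauss e)" by (rule integrable_gauss[OF e])
        show "AE t in lborel. (\<lambda>k. cos (2 * pi * t * x) * (h k t * gauss e t)) \<longlonglongrightarrow> cos (2 * pi * t * x) * (g t * gauss e t)"
          using lim by eventually_elim (intro tendsto_intros)
        show "AE t in lborel. norm (cos (2 * pi * t * x) * (h k t * gauss e t)) \<le> gauss e t" for k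
        proof (intro always_eventually allI)
          fix t
          have "\<bar>cos (2 * pi * t * x)\<bar> * \<bar>h k t\<bar> \<le> 1 * 1" using h1 by (intro mult_mono) auto
          hence "\<bar>cos (2 * pi * t * x)\<bar> * \<bar>h k t\<bar> * gauss e t \<le> 1 * 1 * gauss e t"
            using gauss_bounds(1)[of e t] by (intro mult_right_mono) auto
          thus "norm (cos (2 * pi * t * x) * (h k t * gauss e t)) \<le> gauss e t"
            using gauss_bounds(1)[of e t] by (simp add: abs_mult mult.assoc)
        qed
      qed measurable
    qed
  qed auto
  have G1: "(\<integral>\<^sup>+x. ennreal \<bar>G x\<bar> \<partial>lborel) \<le> ennreal 1"
  proof (rule fatou_bound)
    have ign: "integrable lborel (\<lambda>t. g t * gauss e t)" for e
      by (rule Bochner_Integration.integrable_bound[OF ig']) (auto simp: abs_mult gauss_bounds less_imp_le mult_left_le)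
    show "(\<lambda>x. \<bar>ct (\<lambda>t. g t * gauss (1 / real (Suc n)) t) x\<bar>) \<in> borel_measurable borel" for n
      using borel_measurable_ct[OF ign] by measurable
    show "(\<integral>\<^sup>+x. ennreal \<bar>ct (\<lambda>t. g t * gauss (1 / real (Suc n)) t) x\<bar> \<partial>lborel) \<le> ennreal 1" for n
      by (rule smooth) simp
    show "AE x in lborel. (\<lambda>n. \<bar>ct (\<lambda>t. g t * gauss (1 / real (Suc n)) t) x\<bar>) \<longlonglongrightarrow> \<bar>G x\<bar>"
    proof (intro always_eventually allI tendsto_rabs)
      fix x
      show "(\<lambda>n. ct (\<lambda>t. g t * gauss (1 / real (Suc n)) t) x) \<longlonglongrightarrow> G x"
        unfolding ct_def G_def
      proof (rule integral_dominated_convergence[where w = "\<lambda>t. \<bar>g t\<bar>"])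
        show "integrable lborel (\<lambda>t. \<bar>g t\<bar>)" using ig' by simp
        show "AE t in lborel. (\<lambda>n. cos (2 * pi * t * x) * (g t * gauss (1 / real (Suc n)) t)) \<longlonglongrightarrow> cos (2 * pi * t * x) * g t"
          using tendsto_mult[OF tendsto_const tendsto_mult[OF tendsto_const gauss_tendsto_1]] by (auto intro!: always_eventually)
        show "AE t in lborel. norm (cos (2 * pi * t * x) * (g t * gauss (1 / real (Suc n)) t)) \<le> \<bar>g t\<bar>" for n
        proof (intro always_eventually allI)
          fix t
          have "\<bar>cos (2 * pi * t * x)\<bar> * gauss (1 / real (Suc n)) t \<le> 1 * 1"
            using gauss_bounds[of "1 / real (Suc n)" t] by (intro mult_mono) auto
          hence "(\<bar>cos (2 * pi * t * x)\<bar> * gauss (1 / real (Suc n)) t) * \<bar>g t\<bar> \<le> 1 * 1 * \<bar>g t\<bar>"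
            by (intro mult_right_mono) auto
          thus "norm (cos (2 * pi * t * x) * (g t * gauss (1 / real (Suc n)) t)) \<le> \<bar>g t\<bar>"
            using gauss_bounds(1)[of "1 / real (Suc n)" t] by (simp add: abs_mult mult_ac)
        qed
      qed measurable
    qed
  qed auto
  have iG: "integrable lborel G"
  proof (rule integrableI_bounded)
    show "(\<integral>\<^sup>+x. ennreal (norm (G x)) \<partial>lborel) < \<infinity>"
      unfolding real_norm_def by (rule le_less_trans[OF G1]) simp
  qed simp
  have nG: "L1norm G \<le> 1"
  proof -
    have "ennreal (L1norm G) \<le> ennreal 1"
      using G1 unfolding L1norm_def by (subst nn_integral_eq_integral[symmetric]) (use iG in auto)
    thus ?thesis by (subst (asm) ennreal_le_iff) auto
  qed
  have GAp: "G \<in> classAp"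
    using iG continuous_ct[OF ig'] by (simp add: classAp_def G_def ct_minus)
  have ctG: "AE t in lborel. ct G t = g t"
    unfolding G_def by (rule ct_inversion_AE[OF ig' gev]) (use iG in \<open>simp add: G_def\<close>)
  have [measurable]: "ct G \<in> borel_measurable borel" by (rule borel_measurable_ct[OF iG])
  have ictG: "integrable lborel (ct G)"
    using ig' ctG by (subst integrable_cong_AE[of _ _ g]) auto
  have "inn (ct G) = inn g" unfolding inn_def using ctG by (intro integral_cong_AE) auto
  moreover have "out (ct G) = out g" unfolding out_def using ctG by (intro integral_cong_AE) auto
  ultimately have PG: "C \<le> Phi A G"
    using og Phi_conv[OF GAp ictG, of A] unfolding inn_def out_def by simp
  have GS: "G \<in> S"
  proof (rule closed[OF FS GAp ictG])
    show "AE t in lborel. (\<lambda>k. ct (F k) t) \<longlonglongrightarrow> ct G t"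
      using lim ctG by eventually_elim (simp add: h_def)
  qed
  have Gnz: "G \<noteq> (\<lambda>_. 0)"
  proof
    assume "G = (\<lambda>_. 0)"
    hence "Phi A G \<le> 0" unfolding Phi_def using pen_nonneg[of G] A by (simp add: mult_nonneg_nonneg)
    thus False using PG Cpos by simp
  qed
  show ?thesis
  proof (rule that[OF GS Gnz])
    fix H assume H: "H \<in> S" "H \<noteq> (\<lambda>_. 0)"
    have "Phi A H / L1norm H \<le> C" by (rule CR[OF H])
    \<comment> \<open>The norm may have dropped below 1 in the limit, which only raises the quotient
      because C > 0.\<close>
    also have "\<dots> \<le> C / L1norm G"
      using nG Cpos L1norm_pos_Ap[OF GAp Gnz] by (simp add: field_simps)
    also have "\<dots> \<le> Phi A G / L1norm G"
      using PG L1norm_pos_Ap[OF GAp Gnz] by (intro divide_right_mono) auto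
    finally show "Phi A H / L1norm H \<le> Phi A G / L1norm G" .
  qed
qed

text \<open>The general existence result is applied to the functions with integrable transform; all
  others have infinite penalty and ratio minus infinity.\<close>

lemma Ap_extremizer_exists:
  assumes A: "A > 1"
  shows "\<exists>G. G \<in> classAp \<and> G \<noteq> (\<lambda>_. 0) \<and> ratioAp A G = CAp A"
proof -
  define S where "S = {F \<in> classAp. integrable lborel (ct F)}"
  have Ep: "ct (tent 1) \<in> S"
    unfolding S_def using fejer_classEp(1) by (auto simp: classEp_def ct_ct_tent integrable_tent)
  have p0: "pen (ct (tent 1)) = 0"
    unfolding pen_def ct_ct_tent by (intro integral_eq_zero_AE always_eventually) (auto simp: tent_def indicator_def)
  obtain G where G: "G \<in> S" "G \<noteq> (\<lambda>_. 0)"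
    "\<And>F. F \<in> S \<Longrightarrow> F \<noteq> (\<lambda>_. 0) \<Longrightarrow> Phi A F / L1norm F \<le> Phi A G / L1norm G"
  proof (rule extremizer_exists[OF A, of S "ct (tent 1)"])
    show "(midpoint_fun F G) \<in> S" if "F \<in> S" "G \<in> S" for F G
      using that A classAp_comb[of F G "1/2" "1/2"] Phi_concave(2)[of F G A] by (simp add: S_def)
    show "(\<lambda>x. c * F x) \<in> S" if "F \<in> S" "c > 0" for F c
      using that classAp_comb[of F F c 0] by (simp add: S_def ct_cmult[abs_def])
    show "0 < Phi A (ct (tent 1))" using fejer_classEp p0 by (simp add: Phi_def)
  qed (use Ep fejer_classEp in \<open>auto simp: S_def\<close>)
  have GA: "G \<in> classAp" and iG: "integrable lborel (ct G)" using G(1) by (auto simp: S_def)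
  have r: "ratioAp A F = ereal (Phi A F / L1norm F)" if "F \<in> S" "F \<noteq> (\<lambda>_. 0)" for F
    unfolding Phi_def using that by (intro ratioAp_finite penalty_finite_if_integrable) (auto simp: S_def classApD)
  have "CAp A \<le> ratioAp A G"
    unfolding CAp_def
  proof (intro SUP_least, safe)
    fix F assume F: "F \<in> classAp" "F \<noteq> (\<lambda>_. 0)"
    show "ratioAp A F \<le> ratioAp A G"
    proof (cases "penalty F = \<infinity>")
      case True
      thus ?thesis using ratioAp_infinite[OF F] A by simp
    next
      case False
      hence "F \<in> S" using F integrable_ct_if_penalty(1) by (simp add: S_def)
      thus ?thesis using F G by (simp add: r)
    qed
  qed
  moreover have "ratioAp A G \<le> CAp A" unfolding CAp_def using GA G(2) by (intro SUP_upper) auto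
  ultimately show ?thesis using GA G(2) by (intro exI[of _ G]) auto
qed

text \<open>The factor \<open>max 0 (\<bar>t\<bar> - 1)\<close> turns the almost everywhere
  statement on the outer region into one about a continuous function on the whole line.\<close>

lemma AE_nonpos_imp_nonpos:
  fixes f :: "real \<Rightarrow> real"
  assumes c: "continuous_on UNIV f" and ae: "AE t in lborel. 1 < \<bar>t\<bar> \<longrightarrow> f t \<le> 0" and t: "1 \<le> \<bar>t\<bar>"
  shows "f t \<le> 0"
proof (rule nonpos_boundary[OF c _ t])
  fix s :: real assume s: "1 < \<bar>s\<bar>"
  let ?g = "\<lambda>t. max 0 (\<bar>t\<bar> - 1) * max 0 (f t)"
  have "?g = (\<lambda>_. 0)"
  proof (rule continuous_AE_0)
    show "continuous_on UNIV ?g" by (intro continuous_intros c)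
    show "AE t in lborel. ?g t = 0" using ae by eventually_elim (auto simp: max_def)
  qed
  from fun_cong[OF this, of s] s show "f s \<le> 0" by (auto simp: max_def split: if_splits)
qed

text \<open>On E+ the penalty vanishes, so the functional is the value at 0 for every A; the
  existence result is applied with A = 2. The sign condition passes to the limit almost everywhere
  and then to all |t| \<ge> 1 by continuity.\<close>

lemma Ep_extremizer_exists: "\<exists>G. G \<in> classEp \<and> G \<noteq> (\<lambda>_. 0) \<and> ratioEp G = CAp_inf"
proof -
  have Ep: "F \<in> classEp \<longleftrightarrow> F \<in> classAp \<and> (\<forall>t. 1 \<le> \<bar>t\<bar> \<longrightarrow> ct F t \<le> 0)" for F
    unfolding classEp_def using Re_rfourier[OF classApD(1), of F] by auto
  have pe: "pen F = 0" if "F \<in> classEp" for F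
    unfolding pen_def using that by (intro integral_eq_zero_AE always_eventually) (auto simp: Ep indicator_def max_absorb1)
  have P: "Phi 2 F = F 0" if "F \<in> classEp" for F
    using pe[OF that] by (simp add: Phi_def)
  obtain G where G: "G \<in> classEp" "G \<noteq> (\<lambda>_. 0)"
    "\<And>F. F \<in> classEp \<Longrightarrow> F \<noteq> (\<lambda>_. 0) \<Longrightarrow> Phi 2 F / L1norm F \<le> Phi 2 G / L1norm G"
  proof (rule extremizer_exists[of 2 classEp "ct (tent 1)"])
    show "F \<in> classAp" if "F \<in> classEp" for F using that by (simp add: Ep)
    show i: "integrable lborel (ct F)" if "F \<in> classEp" for F
      using integrable_ct_if_penalty(1)[of F] penalty_Ep[OF that] that by (simp add: Ep)
    show "(midpoint_fun F G) \<in> classEp" if FG: "F \<in> classEp" "G \<in> classEp" for F G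
      unfolding Ep
    proof (intro conjI allI impI)
      have Ap: "F \<in> classAp" "G \<in> classAp" using FG by (auto simp: Ep)
      thus "(midpoint_fun F G) \<in> classAp" by (rule classAp_comb)
      fix t :: real assume "1 \<le> \<bar>t\<bar>"
      hence a: "ct F t \<le> 0" "ct G t \<le> 0" using FG by (auto simp: Ep)
      have e: "ct (midpoint_fun F G) t = (ct F t + ct G t) / 2"
        by (rule Phi_concave(3)[of F G 2]) (use Ap i FG in auto)
      show "ct (midpoint_fun F G) t \<le> 0" unfolding e using a by simp
    qed
    show "(\<lambda>x. c * F x) \<in> classEp" if "F \<in> classEp" "c > 0" for F c
      using that classAp_comb[of F F c 0] by (simp add: Ep ct_cmult mult_le_0_iff)
    show "G \<in> classEp" if F: "\<And>k :: nat. F k \<in> classEp" and G: "G \<in> classAp"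
      and lim: "AE t in lborel. (\<lambda>k. ct (F k) t) \<longlonglongrightarrow> ct G t" for F G
    proof -
      have ae: "AE t in lborel. 1 < \<bar>t\<bar> \<longrightarrow> ct G t \<le> 0"
        using lim
      proof eventually_elim
        case (elim t)
        have "ct (F k) t \<le> 0" if "1 < \<bar>t\<bar>" for k using F[of k] that by (simp add: Ep)
        thus ?case using LIMSEQ_le_const2[OF elim, of 0] by blast
      qed
      have "ct G t \<le> 0" if "1 \<le> \<bar>t\<bar>" for t
        by (rule AE_nonpos_imp_nonpos[OF continuous_ct[OF classApD(1)[OF G]] ae that])
      thus ?thesis using G by (simp add: Ep)
    qed
    show "0 < Phi 2 (ct (tent 1))" using fejer_classEp P by simp
  qed (use fejer_classEp in auto)
  have "CAp_inf \<le> ratioEp G"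
    unfolding CAp_inf_def
  proof (intro SUP_least, safe)
    fix F assume F: "F \<in> classEp" "F \<noteq> (\<lambda>_. 0)"
    show "ratioEp F \<le> ratioEp G" using G(3)[OF F] F(1) G(1) by (simp add: P ratioEp_def)
  qed
  moreover have "ratioEp G \<le> CAp_inf" unfolding CAp_inf_def using G(1,2) by (intro SUP_upper) auto
  ultimately show ?thesis using G(1,2) by (intro exI[of _ G]) auto
qed

section \<open>A spline lower bound for \<open>A = 36/11\<close>\<close>

definition cub :: "real \<Rightarrow> real \<Rightarrow> real" where
  "cub a u = (max 0 (a - \<bar>u\<bar>)) ^ 3"

lemma cub_conv: "cub a = (\<lambda>t. if \<bar>t\<bar> \<le> a then (a - \<bar>t\<bar>) ^ 3 else 0)"
  by (auto simp: cub_def fun_eq_iff max_def)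

lemma
  assumes "a \<ge> 0" "x \<noteq> 0"
  shows ct_cub: "ct (cub a) x = 6 * a\<^sup>2 / (2 * pi * x)\<^sup>2 - 12 * (1 - cos (2 * pi * x * a)) / (2 * pi * x) ^ 4"
    and integrable_cub: "integrable lborel (cub a)"
proof -
  define s where "s = 2 * pi * x"
  have s: "s \<noteq> 0" using assms by (simp add: s_def)
  define i where "i = 1 / s"
  have si: "s * i = 1" using s by (simp add: i_def)
  \<comment> \<open>The antiderivative produced by repeated integration by parts. Writing i for 1 /
    s turns the check of its derivative into polynomial algebra modulo s i = 1.\<close>
  let ?H = "\<lambda>t. (a - t)^3 * sin (s * t) * i - 3 * (a - t)\<^sup>2 * cos (s * t) * i\<^sup>2 - 6 * (a - t) * sin (s * t) * i^3 + 6 * cos (s * t) * i^4"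
  have d: "(?H has_real_derivative cos (2 * pi * t * x) * (a - t)^3) (at t)" for t
  proof -
    have "(?H has_real_derivative
      (- 3 * (a - t)\<^sup>2 * sin (s * t) + (a - t)^3 * cos (s * t) * s) * i
      - (- 6 * (a - t) * cos (s * t) - 3 * (a - t)\<^sup>2 * sin (s * t) * s) * i\<^sup>2
      - (- 6 * sin (s * t) + 6 * (a - t) * cos (s * t) * s) * i^3
      - 6 * sin (s * t) * s * i^4) (at t)"
      by (auto intro!: derivative_eq_intros simp: algebra_simps)
    also have "(- 3 * (a - t)\<^sup>2 * sin (s * t) + (a - t)^3 * cos (s * t) * s) * i
      - (- 6 * (a - t) * cos (s * t) - 3 * (a - t)\<^sup>2 * sin (s * t) * s) * i\<^sup>2
      - (- 6 * sin (s * t) + 6 * (a - t) * cos (s * t) * s) * i^3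
      - 6 * sin (s * t) * s * i^4 = cos (s * t) * (a - t)^3"
      using si by algebra
    finally show ?thesis by (simp add: s_def mult_ac)
  qed
  have "ct (cub a) x = 2 * (?H a - ?H 0)"
    unfolding cub_conv by (rule ct_radial_compact(1)[OF assms(1) _ d]) (auto intro!: continuous_intros)
  thus "ct (cub a) x = 6 * a\<^sup>2 / (2 * pi * x)\<^sup>2 - 12 * (1 - cos (2 * pi * x * a)) / (2 * pi * x) ^ 4"
    unfolding s_def[symmetric] by (simp add: i_def diff_divide_distrib power_divide algebra_simps)
  show "integrable lborel (cub a)"
    unfolding cub_conv by (rule ct_radial_compact(2)[OF assms(1) _ d]) (auto intro!: continuous_intros)
qed

text \<open>\<open>(cub 2 - 4 cub 1) / 6\<close> is the centred cubic B-spline \<open>tent 1 * tent 1\<close> and the remaining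
  part its second derivative, so the transform is \<open>(1/9 - \<theta>\<^sup>2)\<close> times a square.\<close>

definition spline :: "real \<Rightarrow> real" where
  "spline u = 1/54 * (cub 2 u - 4 * cub 1 u) + (2 * sym_shift 1 (tent 1) u - 2 * tent 1 u)"

lemma spline_minus: "spline (- u) = spline u"
  by (simp add: spline_def cub_def tent_def sym_shift_def abs_minus_commute)

lemma continuous_spline: "continuous_on UNIV spline"
  unfolding spline_def cub_def tent_def sym_shift_def by (intro continuous_intros) auto

lemma integrable_spline: "integrable lborel spline"
  unfolding spline_def using integrable_cub[of 2 1] integrable_cub[of 1 1]
    integrable_tent[of 1] integrable_sym_shift[OF integrable_tent[of 1], of 1] by simp

lemma ct_spline:
  assumes "x \<noteq> 0"
  shows "ct spline x = (ct (tent 1) x)\<^sup>2 * (1/9 - (2 * pi * x)\<^sup>2)"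
proof -
  define s where "s = 2 * pi * x"
  define c where "c = cos s"
  have s: "s \<noteq> 0" using assms by (simp add: s_def)
  have i: "integrable lborel (cub 2)" "integrable lborel (cub 1)" "integrable lborel (tent 1)"
    "integrable lborel (sym_shift 1 (tent 1))"
    using integrable_cub[of 2 1] integrable_cub[of 1 1] integrable_tent[of 1] integrable_sym_shift[OF integrable_tent[of 1], of 1] by simp_all
  have t: "ct (tent 1) x = 2 * (1 - c) / s\<^sup>2"
    using assms by (simp add: ct_tent c_def s_def power_mult_distrib field_simps)
  have sh: "ct (sym_shift 1 (tent 1)) x = c * ct (tent 1) x"
    by (subst ct_sym_shift[OF i(3)]) (auto simp: tent_def c_def s_def)
  have c2: "cos (2 * pi * x * 2) = 2 * c\<^sup>2 - 1"
    using cos_double_cos[of s] by (simp add: c_def s_def mult_ac)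
  have "ct spline x = 1/54 * (ct (cub 2) x - 4 * ct (cub 1) x) + (2 * ct (sym_shift 1 (tent 1)) x - 2 * ct (tent 1) x)"
    unfolding spline_def
    by (simp only: ct_diff ct_add ct_cmult i Bochner_Integration.integrable_diff Bochner_Integration.integrable_add integrable_mult_right)
  also have "\<dots> = 1/54 * ((6 * 2\<^sup>2 / s\<^sup>2 - 12 * (1 - (2 * c\<^sup>2 - 1)) / s^4) - 4 * (6 * 1\<^sup>2 / s\<^sup>2 - 12 * (1 - c) / s^4))
      + (2 * (c * (2 * (1 - c) / s\<^sup>2)) - 2 * (2 * (1 - c) / s\<^sup>2))"
    unfolding sh t using assms ct_cub[of 2 x] ct_cub[of 1 x] c2 by (simp add: s_def[symmetric] c_def)
  also have "\<dots> = (2 * (1 - c) / s\<^sup>2)\<^sup>2 * (1/9 - s\<^sup>2)"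
    using s by (simp add: field_simps eval_nat_numeral)
  finally show ?thesis unfolding t s_def .
qed

lemma spline_values:
  assumes "0 \<le> w" "w \<le> 1"
  shows "spline (1 + w) = 1/54 * (1 - w)^3 + (1 - w)"
    "spline w = 1/54 * ((2 - w)^3 - 4 * (1 - w)^3) + (3 * w - 2)"
  using assms by (auto simp: spline_def cub_def tent_def sym_shift_def max_def abs_if)

lemma spline_zero:
  assumes "2 \<le> \<bar>u\<bar>"
  shows "spline u = 0"
proof -
  have "spline v = 0" if "2 \<le> v" for v
    using that by (auto simp: spline_def cub_def tent_def sym_shift_def max_def abs_if)
  thus ?thesis using assms spline_minus[of u] by (cases "u \<ge> 0") auto
qed

text \<open>\<open>gam\<close> lists the values of \<open>g\<close> at the knots; it was found by numerical optimisation and rounded.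
  \<open>rho\<close> is its autocorrelation.\<close>

definition gam :: "int \<Rightarrow> int" where
  "gam i = (if \<bar>i\<bar> \<le> 18 then [200, 197, 186, 170, 149, 124, 98, 71, 46, 24, 6, -7, -15, -19, -19, -16, -12, -7, -3] ! nat \<bar>i\<bar> else 0)"

definition rho :: "int \<Rightarrow> int" where
  "rho j = (if \<bar>j\<bar> \<le> 36 then [357418, 352804, 339245, 317532, 288914, 254988, 217572, 178574, 139845, 103066, 69638, 40614, 16660, -1946, -15291, -23768, -28012, -28816, -27042, -23556, -19142, -14468, -10045, -6222, -3191, -1002, 399, 1142, 1391, 1316, 1068, 764, 482, 264, 121, 42, 9] ! nat \<bar>j\<bar> else 0)"

lemma gam_minus: "gam (- i) = gam i" by (simp add: gam_def)
lemma rho_minus: "rho (- i) = rho i" by (simp add: rho_def)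

text \<open>A finite check by evaluation. The range extends beyond the support |j| \<le> 36 so that
  the index n + 2 with n \<le> 37 lies inside it when four neighbouring translates are singled
  out.\<close>

lemma rho_autocorrelation:
  assumes "j \<in> {-40..40}"
  shows "rho j = (\<Sum>i\<in>{-18..18}. gam i * gam (i - j))"
proof -
  have "\<forall>j\<in>set [-40..40]. rho j = sum_list (map (\<lambda>i. gam i * gam (i - j)) [-18..18])"
    by code_simp
  moreover have "sum_list (map (\<lambda>i. gam i * gam (i - j)) [-18..18]) = (\<Sum>i\<in>{-18..18}. gam i * gam (i - j))"
    by (simp only: sum_list_distinct_conv_sum_set distinct_upto set_upto)
  ultimately show ?thesis using assms by (metis set_upto)
qed

definition Gtrig :: "real \<Rightarrow> real" where
  "Gtrig \<theta> = (\<Sum>i\<in>{-18..18}. of_int (gam i) * cos (of_int i * \<theta>))"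

text \<open>The Fourier series of an autocorrelation is the squared modulus of the original one;
  since \<open>gam\<close> is even, the sine part vanishes and a real square remains.\<close>

lemma rho_square: "(\<Sum>j\<in>{-40..40}. of_int (rho j) * cos (of_int j * \<theta>)) = (Gtrig \<theta>)\<^sup>2"
proof -
  define g where "g i = real_of_int (gam i)" for i
  let ?I = "{-18..18::int}"
  have sn: "(\<Sum>i\<in>?I. g i * sin (of_int i * \<theta>)) = 0"
  proof -
    have "(\<Sum>i\<in>?I. g i * sin (of_int i * \<theta>)) = (\<Sum>i\<in>?I. g (- i) * sin (of_int (- i) * \<theta>))"
      by (rule sum.reindex_bij_witness[of _ uminus uminus]) auto
    also have "\<dots> = - (\<Sum>i\<in>?I. g i * sin (of_int i * \<theta>))" by (simp add: g_def gam_minus sum_negf)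
    finally show ?thesis by simp
  qed
  have "(\<Sum>j\<in>{-40..40}. of_int (rho j) * cos (of_int j * \<theta>)) = (\<Sum>j\<in>{-40..40}. \<Sum>i\<in>?I. g i * g (i - j) * cos (of_int j * \<theta>))"
    by (rule sum.cong[OF refl]) (simp add: rho_autocorrelation g_def sum_distrib_right)
  also have "\<dots> = (\<Sum>i\<in>?I. \<Sum>j\<in>{-40..40}. g i * g (i - j) * cos (of_int j * \<theta>))" by (rule sum.swap)
  also have "\<dots> = (\<Sum>i\<in>?I. \<Sum>k\<in>?I. g i * g k * cos (of_int (i - k) * \<theta>))"
  proof (rule sum.cong[OF refl])
    fix i assume i: "i \<in> ?I"
    have "(\<Sum>j\<in>{-40..40}. g i * g (i - j) * cos (of_int j * \<theta>)) = (\<Sum>k\<in>{i-40..i+40}. g i * g k * cos (of_int (i - k) * \<theta>))"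
      by (rule sum.reindex_bij_witness[of _ "\<lambda>k. i - k" "\<lambda>j. i - j"]) auto
    also have "\<dots> = (\<Sum>k\<in>?I. g i * g k * cos (of_int (i - k) * \<theta>))"
      using i by (intro sum.mono_neutral_right) (auto simp: g_def gam_def)
    finally show "(\<Sum>j\<in>{-40..40}. g i * g (i - j) * cos (of_int j * \<theta>)) = (\<Sum>k\<in>?I. g i * g k * cos (of_int (i - k) * \<theta>))" .
  qed
  also have "\<dots> = (\<Sum>i\<in>?I. \<Sum>k\<in>?I. (g i * cos (of_int i * \<theta>)) * (g k * cos (of_int k * \<theta>)) + (g i * sin (of_int i * \<theta>)) * (g k * sin (of_int k * \<theta>)))"
    by (intro sum.cong refl) (simp add: left_diff_distrib cos_diff algebra_simps)
  also have "\<dots> = (Gtrig \<theta>)\<^sup>2 + (\<Sum>i\<in>?I. g i * sin (of_int i * \<theta>))\<^sup>2"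
    by (simp add: sum.distrib sum_product power2_eq_square Gtrig_def g_def)
  finally show ?thesis using sn by simp
qed

text \<open>With g the sum of the tents at the integers i weighted by \<open>gam i\<close>, this is
  (1/9 + D^2)(g * g) written in splines. Symmetrised translates make every term a cosine multiple on
  the transform side.\<close>

definition Psi :: "real \<Rightarrow> real" where
  "Psi u = (\<Sum>j\<in>{-40..40}. of_int (rho j) * sym_shift (of_int j) spline u)"

lemma integrable_Psi: "integrable lborel Psi"
  unfolding Psi_def by (intro Bochner_Integration.integrable_sum integrable_mult_right integrable_sym_shift integrable_spline)

lemma continuous_Psi: "continuous_on UNIV Psi"
  unfolding Psi_def sym_shift_def
  by (intro continuous_intros continuous_on_compose2[OF continuous_spline]) auto

lemma Psi_shift: "Psi u = (\<Sum>j\<in>{-40..40}. of_int (rho j) * spline (u - of_int j))"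
proof -
  have "(\<Sum>j\<in>{-40..40}. of_int (rho j) * spline (u + of_int j)) = (\<Sum>j\<in>{-40..40}. of_int (rho j) * spline (u - of_int j))"
    by (rule sum.reindex_bij_witness[of _ uminus uminus]) (auto simp: rho_minus)
  thus ?thesis unfolding Psi_def sym_shift_def by (simp add: distrib_left sum.distrib add_divide_distrib flip: sum_divide_distrib)
qed

lemma Psi_minus: "Psi (- u) = Psi u"
proof -
  have "sym_shift x spline (- u) = sym_shift x spline u" for x
    using spline_minus[of "u + x"] spline_minus[of "u - x"] by (simp add: sym_shift_def add.commute)
  thus ?thesis by (simp add: Psi_def)
qed

lemma ct_Psi:
  assumes "x \<noteq> 0"
  shows "ct Psi x = (ct (tent 1) x)\<^sup>2 * (1/9 - (2 * pi * x)\<^sup>2) * (Gtrig (2 * pi * x))\<^sup>2"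
proof -
  have "ct Psi x = (\<Sum>j\<in>{-40..40}. of_int (rho j) * ct (sym_shift (of_int j) spline) x)"
    unfolding Psi_def by (subst ct_sum) (auto simp: ct_cmult intro!: integrable_sym_shift integrable_spline)
  also have "\<dots> = (\<Sum>j\<in>{-40..40}. of_int (rho j) * cos (of_int j * (2 * pi * x))) * ct spline x"
    unfolding sum_distrib_right
    by (intro sum.cong refl) (simp add: ct_sym_shift[OF integrable_spline spline_minus] mult_ac)
  finally show ?thesis unfolding rho_square ct_spline[OF assms] by (simp only: mult_ac)
qed

text \<open>\<open>spline\<close> vanishes for |u| \<ge> 2, so only four translates contribute on
  the cell [n, n + 1].\<close>

lemma Psi_local:
  assumes n: "0 \<le> n" "n \<le> 37" and w: "0 \<le> w" "w \<le> 1"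
  shows "Psi (of_int n + w) = of_int (rho (n - 1)) * spline (1 + w) + of_int (rho n) * spline w
    + of_int (rho (n + 1)) * spline (1 - w) + of_int (rho (n + 2)) * spline (1 + (1 - w))"
proof -
  have "Psi (of_int n + w) = (\<Sum>j\<in>{n - 1, n, n + 1, n + 2}. of_int (rho j) * spline (of_int n + w - of_int j))"
    unfolding Psi_shift
  proof (rule sum.mono_neutral_right)
    show "\<forall>j\<in>{-40..40} - {n - 1, n, n + 1, n + 2}. of_int (rho j) * spline (of_int n + w - of_int j) = 0"
    proof
      fix j assume "j \<in> {-40..40} - {n - 1, n, n + 1, n + 2}"
      hence "j \<le> n - 2 \<or> j \<ge> n + 3" by auto
      hence "2 \<le> \<bar>of_int n + w - of_int j\<bar>"
      proof
        assume "j \<le> n - 2"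
        hence "real_of_int j \<le> of_int n - 2" by linarith
        thus ?thesis using w by linarith
      next
        assume "j \<ge> n + 3"
        hence "real_of_int j \<ge> of_int n + 3" by linarith
        thus ?thesis using w by linarith
      qed
      thus "of_int (rho j) * spline (of_int n + w - of_int j) = 0" by (simp add: spline_zero)
    qed
  qed (use n in auto)
  also have "\<dots> = of_int (rho (n - 1)) * spline (1 + w) + of_int (rho n) * spline w
    + of_int (rho (n + 1)) * spline (w - 1) + of_int (rho (n + 2)) * spline (w - 2)"
    by (simp add: algebra_simps)
  finally show ?thesis using spline_minus[of "1 - w"] spline_minus[of "2 - w"] by simp
qed

lemma Psi_far:
  assumes "38 \<le> u"
  shows "Psi u = 0"
  unfolding Psi_shift
proof (rule sum.neutral, rule ballI)
  fix j :: int assume "j \<in> {-40..40}"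
  show "of_int (rho j) * spline (u - of_int j) = 0"
  proof (cases "j \<le> 36")
    case True
    hence "real_of_int j \<le> 36" by linarith
    thus ?thesis using assms by (simp add: spline_zero)
  qed (simp add: rho_def)
qed

text \<open>54 times the Bernstein coefficients of \<open>Psi\<close> on the cell [n, n + 1], where
  it is a cubic in w.\<close>

definition bcoef :: "int \<Rightarrow> int list" where
  "bcoef n = (let a = rho (n - 1); b = rho n; c = rho (n + 1); d = rho (n + 2) in
     [55 * a - 104 * b + 55 * c, 36 * a - 50 * b + 2 * c + 18 * d,
      18 * a + 2 * b - 50 * c + 36 * d, 55 * b - 104 * c + 55 * d])"

text \<open>Bernstein basis polynomials are nonnegative on [0, 1], so taking absolute values of the
  coefficients majorises the absolute value of \<open>Psi\<close> without locating its sign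
  changes.\<close>

definition bsum :: "int \<Rightarrow> real \<Rightarrow> real" where
  "bsum n w = (of_int \<bar>bcoef n ! 0\<bar> * (1 - w)^3 + of_int \<bar>bcoef n ! 1\<bar> * (3 * w * (1 - w)\<^sup>2)
     + of_int \<bar>bcoef n ! 2\<bar> * (3 * w\<^sup>2 * (1 - w)) + of_int \<bar>bcoef n ! 3\<bar> * w^3) / 54"

lemma abs_Psi_le_bsum:
  assumes n: "0 \<le> n" "n \<le> 37" and w: "0 \<le> w" "w \<le> 1"
  shows "\<bar>Psi (of_int n + w)\<bar> \<le> bsum n w"
proof -
  have s: "spline (1 + w) = 1/54 * (1 - w)^3 + (1 - w)"
    "spline w = 1/54 * ((2 - w)^3 - 4 * (1 - w)^3) + (3 * w - 2)"
    "spline (1 + (1 - w)) = 1/54 * w^3 + w"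
    "spline (1 - w) = 1/54 * ((1 + w)^3 - 4 * w^3) + (3 * (1 - w) - 2)"
    using spline_values[OF w] spline_values[of "1 - w"] w by simp_all
  have "Psi (of_int n + w) = (of_int (bcoef n ! 0) * (1 - w)^3 + of_int (bcoef n ! 1) * (3 * w * (1 - w)\<^sup>2)
     + of_int (bcoef n ! 2) * (3 * w\<^sup>2 * (1 - w)) + of_int (bcoef n ! 3) * w^3) / 54"
    unfolding Psi_local[OF assms] s bcoef_def Let_def by (simp add: eval_nat_numeral algebra_simps)
  also have "\<bar>\<dots>\<bar> \<le> bsum n w"
  proof -
    have ab: "\<bar>of_int z * r\<bar> \<le> of_int \<bar>z\<bar> * r" if "r \<ge> 0" for z :: int and r :: real
      using that by (simp add: abs_mult)
    have "0 \<le> (1 - w)^3" "0 \<le> 3 * w * (1 - w)\<^sup>2" "0 \<le> 3 * w\<^sup>2 * (1 - w)" "0 \<le> w^3" using w by auto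
    note b = this[THEN ab]
    have tri: "\<bar>p + q + r + t\<bar> \<le> P + Q + R + T" if "\<bar>p\<bar> \<le> P" "\<bar>q\<bar> \<le> Q" "\<bar>r\<bar> \<le> R" "\<bar>t\<bar> \<le> T"
      for p q r t P Q R T :: real using that by linarith
    show ?thesis
      unfolding bsum_def abs_divide abs_numeral
      by (rule divide_right_mono[OF tri[OF b(1) b(2) b(3) b(4)]]) simp
  qed
  finally show ?thesis .
qed

text \<open>Each cubic Bernstein basis polynomial has integral 1/4 over the unit interval; with the
  denominator 54 this gives 216.\<close>

lemma integral_bsum:
  shows "(LINT u|lborel. bsum n (u - of_int n) * indicator {of_int n..of_int n + 1} u) = of_int (\<bar>bcoef n ! 0\<bar> + \<bar>bcoef n ! 1\<bar> + \<bar>bcoef n ! 2\<bar> + \<bar>bcoef n ! 3\<bar>) / 216" (is "?I = _")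
    and "integrable lborel (\<lambda>u. bsum n (u - of_int n) * indicator {of_int n..of_int n + 1} u)"
proof -
  define A where "A = real_of_int \<bar>bcoef n ! 0\<bar>"
  define B where "B = real_of_int \<bar>bcoef n ! 1\<bar>"
  define C where "C = real_of_int \<bar>bcoef n ! 2\<bar>"
  define D where "D = real_of_int \<bar>bcoef n ! 3\<bar>"
  define K where "K w = (A * (w - 3/2 * w\<^sup>2 + w^3 - w^4 / 4) + B * (3/2 * w\<^sup>2 - 2 * w^3 + 3/4 * w^4) + C * (w^3 - 3/4 * w^4) + D * (w^4 / 4)) / 54" for w
  have b: "bsum n w = (A * (1 - 3 * w + 3 * w\<^sup>2 - w^3) + B * (3 * w - 6 * w\<^sup>2 + 3 * w^3) + C * (3 * w\<^sup>2 - 3 * w^3) + D * w^3) / 54" for w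
    unfolding bsum_def A_def B_def C_def D_def by (simp add: eval_nat_numeral algebra_simps)
  have K: "(K has_real_derivative bsum n w) (at w)" for w
    unfolding K_def b by (rule derivative_eq_intros refl | simp)+
  have d: "((\<lambda>u. K (u - of_int n)) has_real_derivative bsum n (u - of_int n)) (at u)" for u
    using DERIV_shift[of K "bsum n (u - of_int n)" u "- of_int n"] K by simp
  have cb: "continuous_on S (\<lambda>u. bsum n (u - of_int n))" for S
    unfolding bsum_def by (auto intro!: continuous_intros)
  have "(\<integral>u. indicator {of_int n..of_int n + 1} u *\<^sub>R bsum n (u - of_int n) \<partial>lborel) = K (of_int n + 1 - of_int n) - K (of_int n - of_int n)"
    by (rule integral_FTC_Icc) (auto intro!: cb has_vector_derivative_at_within DERIV_subset[OF d] simp: has_real_derivative_iff_has_vector_derivative[symmetric])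
  thus "?I = of_int (\<bar>bcoef n ! 0\<bar> + \<bar>bcoef n ! 1\<bar> + \<bar>bcoef n ! 2\<bar> + \<bar>bcoef n ! 3\<bar>) / 216"
    unfolding K_def A_def B_def C_def D_def by (simp add: mult.commute)
  have "set_integrable lborel {of_int n..of_int n + 1} (\<lambda>u. bsum n (u - of_int n))"
    by (rule borel_integrable_atLeastAtMost'[OF cb])
  thus "integrable lborel (\<lambda>u. bsum n (u - of_int n) * indicator {of_int n..of_int n + 1} u)"
    by (simp add: set_integrable_def mult.commute)
qed

lemma bcoef_total: "(\<Sum>n\<in>{0..37}. \<bar>bcoef n ! 0\<bar> + \<bar>bcoef n ! 1\<bar> + \<bar>bcoef n ! 2\<bar> + \<bar>bcoef n ! 3\<bar>) = 61187564"
proof -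
  have "sum_list (map (\<lambda>n. \<bar>bcoef n ! 0\<bar> + \<bar>bcoef n ! 1\<bar> + \<bar>bcoef n ! 2\<bar> + \<bar>bcoef n ! 3\<bar>) [0..37]) = 61187564"
    by code_simp
  thus ?thesis by (simp only: sum_list_distinct_conv_sum_set distinct_upto set_upto)
qed

lemma L1_Psi: "(LINT u|lborel. \<bar>Psi u\<bar>) \<le> 61187564 / 108"
proof -
  have i: "integrable lborel (\<lambda>u. \<bar>Psi u\<bar>)" using integrable_Psi by simp
  have bn: "0 \<le> bsum n w" if "0 \<le> w" "w \<le> 1" for n w
    unfolding bsum_def using that by (intro divide_nonneg_pos add_nonneg_nonneg mult_nonneg_nonneg) auto
  have "(LINT u|lborel. \<bar>Psi u\<bar>) = 2 * (LINT u|lborel. indicator {0..} u * \<bar>Psi u\<bar>)"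
    by (rule integral_even_eq_double[OF i]) (simp add: Psi_minus)
  also have "(LINT u|lborel. indicator {0..} u * \<bar>Psi u\<bar>) \<le> (LINT u|lborel. (\<Sum>n\<in>{0..37}. bsum n (u - of_int n) * indicator {of_int n..of_int n + 1} u))"
  proof (rule integral_mono)
    show "integrable lborel (\<lambda>u. indicator {0..} u * \<bar>Psi u\<bar>)"
      using integrable_real_mult_indicator[OF _ i, of "{0..}"] by (simp add: mult.commute)
    show "integrable lborel (\<lambda>u. \<Sum>n\<in>{0..37}. bsum n (u - of_int n) * indicator {of_int n..of_int n + 1} u)"
      by (intro Bochner_Integration.integrable_sum integral_bsum)
    fix u :: real
    have nn: "0 \<le> bsum n (u - of_int n) * indicator {of_int n..of_int n + 1} u" for n
      using bn[of "u - of_int n" n] by (auto split: split_indicator)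
    show "indicator {0..} u * \<bar>Psi u\<bar> \<le> (\<Sum>n\<in>{0..37}. bsum n (u - of_int n) * indicator {of_int n..of_int n + 1} u)"
    proof (cases "0 \<le> u \<and> u < 38")
      case True
      define n where "n = \<lfloor>u\<rfloor>"
      have n: "0 \<le> n" "n \<le> 37" using True by (auto simp: n_def floor_le_iff)
      have w: "0 \<le> u - of_int n" "u - of_int n \<le> 1" unfolding n_def by linarith+
      have "\<bar>Psi u\<bar> \<le> bsum n (u - of_int n)" using abs_Psi_le_bsum[OF n w] by simp
      also have "\<dots> = bsum n (u - of_int n) * indicator {of_int n..of_int n + 1} u" using w by simp
      also have "\<dots> \<le> (\<Sum>n\<in>{0..37}. bsum n (u - of_int n) * indicator {of_int n..of_int n + 1} u)"
        using n nn by (intro member_le_sum) auto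
      finally show ?thesis using True by simp
    next
      case False
      hence e: "indicator {0..} u * \<bar>Psi u\<bar> = 0" using Psi_far[of u] by (auto simp: indicator_def)
      show ?thesis unfolding e by (intro sum_nonneg nn)
    qed
  qed
  also have "(LINT u|lborel. (\<Sum>n\<in>{0..37}. bsum n (u - of_int n) * indicator {of_int n..of_int n + 1} u))
      = (\<Sum>n\<in>{0..37}. of_int (\<bar>bcoef n ! 0\<bar> + \<bar>bcoef n ! 1\<bar> + \<bar>bcoef n ! 2\<bar> + \<bar>bcoef n ! 3\<bar>) / 216)"
    by (subst Bochner_Integration.integral_sum) (simp_all only: integral_bsum)
  also have "\<dots> = of_int (\<Sum>n\<in>{0..37}. \<bar>bcoef n ! 0\<bar> + \<bar>bcoef n ! 1\<bar> + \<bar>bcoef n ! 2\<bar> + \<bar>bcoef n ! 3\<bar>) / 216"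
    by (simp only: sum_divide_distrib of_int_sum)
  finally show ?thesis unfolding bcoef_total by simp
qed

lemma Psi_0: "Psi 0 = 272828 / 9"
  using Psi_local[of 0 0] spline_values[of 0] spline_values[of 1] by (simp add: rho_def)

section \<open>The trigonometric factor on the penalised range\<close>

lemma gam_moments:
  "map (\<lambda>m. \<Sum>i\<in>{-18..18}. gam i * i ^ (2 * m)) [0..<12] = [2146, 1682, -6692302, -1800230158, -445774025422, -112497886419598, -29321762128536142, -7882620312013965838, -2176802528144439040462, -614941093321431013652878, -177067810119947949812994382, -51811014443774181215096424718]"
proof -
  have "map (\<lambda>m. sum_list (map (\<lambda>i. gam i * i ^ (2 * m)) [-18..18])) [0..<12] = [2146, 1682, -6692302, -1800230158, -445774025422, -112497886419598, -29321762128536142, -7882620312013965838, -2176802528144439040462, -614941093321431013652878, -177067810119947949812994382, -51811014443774181215096424718]"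
    by code_simp
  thus ?thesis by (simp only: sum_list_distinct_conv_sum_set distinct_upto set_upto)
qed

lemma gam_abs_sum: "(\<Sum>i\<in>{-18..18}. \<bar>gam i\<bar>) = 2538"
proof -
  have "sum_list (map (\<lambda>i. \<bar>gam i\<bar>) [-18..18]) = 2538" by code_simp
  thus ?thesis by (simp only: sum_list_distinct_conv_sum_set distinct_upto set_upto)
qed

text \<open>Taylor approximation of \<open>Gtrig\<close> in x = (12 \<theta>)^2, chosen so that 1/4
  \<le> \<theta> \<le> 1/3 becomes the interval [9, 16].\<close>

definition Gpoly :: "real \<Rightarrow> real" where
  "Gpoly x = (\<Sum>i\<in>{-18..18}. of_int (gam i) * cos_poly 12 ((of_int i)\<^sup>2 * (x / 144)))"

lemma Gpoly_expand: "Gpoly x = (2146) * x^0 + (-841/144) * x^1 + (-3346151/248832) * x^2 + (900115079/1074954240) * x^3 + (-222887012711/8668430991360) * x^4 + (56248943209799/112342865648025600) * x^5 + (-14660881064268071/2135413190237670604800) * x^6 + (3941310156006982919/55964908889748871210598400) * x^7 + (-1088401264072219520231/1934147251229720989038280704000) * x^8 + (27951867878246864256949/7747842225289675060089345540096000) * x^9 + (-88533905059973974906497191/4663581192246361212168978867494584320000) * x^10 + (25905507221887090607548212359/310258729557765918723177826096679705640960000) * x^11"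
proof -
  have "Gpoly x = (\<Sum>i\<in>{-18..18}. \<Sum>m<12. (-1)^m / fact (2 * m) * (x / 144)^m * of_int (gam i * i ^ (2 * m)))"
    unfolding Gpoly_def cos_poly_def sum_distrib_left
    by (intro sum.cong refl) (simp only: power_mult_distrib power_mult of_int_mult of_int_power, simp only: mult_ac)
  also have "\<dots> = (\<Sum>m<12. \<Sum>i\<in>{-18..18}. (-1)^m / fact (2 * m) * (x / 144)^m * of_int (gam i * i ^ (2 * m)))"
    by (rule sum.swap)
  also have "\<dots> = (\<Sum>m<12. (-1)^m / fact (2 * m) * (x / 144)^m * of_int ([2146, 1682, -6692302, -1800230158, -445774025422, -112497886419598, -29321762128536142, -7882620312013965838, -2176802528144439040462, -614941093321431013652878, -177067810119947949812994382, -51811014443774181215096424718] ! m))"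
  proof (rule sum.cong[OF refl])
    fix m :: nat assume m: "m \<in> {..<12}"
    have "(\<Sum>i\<in>{-18..18}. gam i * i ^ (2 * m)) = [2146, 1682, -6692302, -1800230158, -445774025422, -112497886419598, -29321762128536142, -7882620312013965838, -2176802528144439040462, -614941093321431013652878, -177067810119947949812994382, -51811014443774181215096424718] ! m"
      using m arg_cong[OF gam_moments, of "\<lambda>l. l ! m"] by (simp only: lessThan_iff length_upt nth_map nth_upt) simp
    thus "(\<Sum>i\<in>{-18..18}. (-1)^m / fact (2 * m) * (x / 144)^m * of_int (gam i * i ^ (2 * m)))
      = (-1)^m / fact (2 * m) * (x / 144)^m * of_int ([2146, 1682, -6692302, -1800230158, -445774025422, -112497886419598, -29321762128536142, -7882620312013965838, -2176802528144439040462, -614941093321431013652878, -177067810119947949812994382, -51811014443774181215096424718] ! m)"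
      by (simp only: sum_distrib_left[symmetric] of_int_sum[symmetric])
  qed
  also have "\<dots> = (2146) * x^0 + (-841/144) * x^1 + (-3346151/248832) * x^2 + (900115079/1074954240) * x^3 + (-222887012711/8668430991360) * x^4 + (56248943209799/112342865648025600) * x^5 + (-14660881064268071/2135413190237670604800) * x^6 + (3941310156006982919/55964908889748871210598400) * x^7 + (-1088401264072219520231/1934147251229720989038280704000) * x^8 + (27951867878246864256949/7747842225289675060089345540096000) * x^9 + (-88533905059973974906497191/4663581192246361212168978867494584320000) * x^10 + (25905507221887090607548212359/310258729557765918723177826096679705640960000) * x^11"
    by (simp add: lessThan_nat_numeral fact_numeral power_divide)
  finally show ?thesis .
qed

text \<open>After clearing denominators, positive Bernstein coefficients on [9, 16] certify both
  bounds. The margins 1/10 absorb the Taylor error. The lower bound makes \<open>Gtrig\<close>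
  nonnegative there, so the quadratic majorant also bounds its absolute value.\<close>

lemma Gpoly_bounds:
  assumes "9 \<le> x" "x \<le> 16"
  shows "1/10 \<le> Gpoly x" "Gpoly x \<le> 2570 - 134 * x + 7/5 * x\<^sup>2 - 1/10"
proof -
  have "613482883203775114425303929485568085469238164193280000 * (Gpoly x - 1/10) = (1316472919066981018045259702283080554608438176542359552000) * x^0 + (-3582910449822047716886670865953908054719647889489920000) * x^1 + (-8249768370286760958837067454957815452839573496791040000) * x^2 + (513701117063470357788594318292016362121630463295488000) * x^3 + (-15774177278784320255971896575387777553791270780928000) * x^4 + (307164710980642189224379943142643997741585478451200) * x^5 + (-4211924711682499490779133728863823922835593625600) * x^6 + (43204328678008045767473917040970908853652684800) * x^7 + (-345224772902439819115658611404709449324625920) * x^8 + (2213260414739117638875323600130860514232320) * x^9 + (-11646422158958930372195815623508270724064) * x^10 + (51223652220816979184769197959293816737) * x^11"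
    unfolding Gpoly_expand by simp
  also have "\<dots> = 456718248314354810068065146423390407759281727503 * ((x - 9)^0 * (16 - x)^11) + 4795511647532388507166933994972864362622248760496 * ((x - 9)^1 * (16 - x)^10) + 22831336198766982504628062280393495891377721724160 * ((x - 9)^2 * (16 - x)^9) + 65067161595167860618757131007354813028122995200000 * ((x - 9)^3 * (16 - x)^8) + 123346145961402202764114202357772758757432743034880 * ((x - 9)^4 * (16 - x)^7) + 163322319169272062088550308137141753290422069755904 * ((x - 9)^5 * (16 - x)^6) + 154142514517676093171719086867407996090401274462208 * ((x - 9)^6 * (16 - x)^5) + 103699528994925655240170669555040751786151420887040 * ((x - 9)^7 * (16 - x)^4) + 48735940314675269402677207567612014124728110284800 * ((x - 9)^8 * (16 - x)^3) + 15239127839275802858179199030631116459178322821120 * ((x - 9)^9 * (16 - x)^2) + 2853354127031604563798983943944006731367100448768 * ((x - 9)^10 * (16 - x)^1) + 242360121743961556402183417597132274528468074496 * ((x - 9)^11 * (16 - x)^0)"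
    by algebra
  also have "\<dots> \<ge> 0" using assms by (intro add_nonneg_nonneg mult_nonneg_nonneg zero_le_power) simp_all
  finally show "1/10 \<le> Gpoly x" by (simp only: zero_le_mult_iff) simp
  have "613482883203775114425303929485568085469238164193280000 * (2570 - 134 * x + 7/5 * x\<^sup>2 - 1/10 - Gpoly x) = (260055394190080271004886335708932311430410057801531392000) * x^0 + (-78623795899483817616104055685112215398158266112409600000) * x^1 + (9108644406772046119032492956237610772496506926661632000) * x^2 + (-513701117063470357788594318292016362121630463295488000) * x^3 + (15774177278784320255971896575387777553791270780928000) * x^4 + (-307164710980642189224379943142643997741585478451200) * x^5 + (4211924711682499490779133728863823922835593625600) * x^6 + (-43204328678008045767473917040970908853652684800) * x^7 + (345224772902439819115658611404709449324625920) * x^8 + (-2213260414739117638875323600130860514232320) * x^9 + (11646422158958930372195815623508270724064) * x^10 + (-51223652220816979184769197959293816737) * x^11"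
    unfolding Gpoly_expand by simp
  also have "\<dots> = 1595946988377005069813138286624853413544384497 * ((x - 9)^0 * (16 - x)^11) + 9651452366466935650154904482072246462683335504 * ((x - 9)^1 * (16 - x)^10) + 34297807418984832983931053975263062773132931840 * ((x - 9)^2 * (16 - x)^9) + 113047190008099990731725503644388243929060864000 * ((x - 9)^3 * (16 - x)^8) + 308587635271812100315723673232885972712172421120 * ((x - 9)^4 * (16 - x)^7) + 585133793242856858289730509386239105816483332096 * ((x - 9)^5 * (16 - x)^6) + 734547862330490944764137972750036793451496865792 * ((x - 9)^6 * (16 - x)^5) + 604367639230499273494655462314979703166819368960 * ((x - 9)^7 * (16 - x)^4) + 318571001735807581174481432012259446635049779200 * ((x - 9)^8 * (16 - x)^3) + 101180681486552120802116131762676234651047034880 * ((x - 9)^9 * (16 - x)^2) + 16725276615464843941644854145938553635164127232 * ((x - 9)^10 * (16 - x)^1) + 944773975238477060532633627883950635172757504 * ((x - 9)^11 * (16 - x)^0)"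
    by algebra
  also have "\<dots> \<ge> 0" using assms by (intro add_nonneg_nonneg mult_nonneg_nonneg zero_le_power) simp_all
  finally show "Gpoly x \<le> 2570 - 134 * x + 7/5 * x\<^sup>2 - 1/10" by (simp only: zero_le_mult_iff) simp
qed

lemma Gtrig_bound:
  assumes "1/4 \<le> \<theta>" "\<theta> \<le> 1/3"
  shows "\<bar>Gtrig \<theta>\<bar> \<le> 2570 - 134 * (144 * \<theta>\<^sup>2) + 7/5 * (144 * \<theta>\<^sup>2)\<^sup>2"
proof -
  define x where "x = 144 * \<theta>\<^sup>2"
  have x: "9 \<le> x" "x \<le> 16"
    using power_mono[OF assms(1), of 2] power_mono[OF assms(2), of 2] assms by (auto simp: x_def power2_eq_square)
  have "Gtrig \<theta> - Gpoly x = (\<Sum>i\<in>{-18..18}. of_int (gam i) * (cos (of_int i * \<theta>) - cos_poly 12 ((of_int i * \<theta>)\<^sup>2)))"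
    unfolding Gtrig_def Gpoly_def x_def by (simp add: sum_subtractf[symmetric] right_diff_distrib power_mult_distrib)
  also have "\<bar>\<dots>\<bar> \<le> (\<Sum>i\<in>{-18..18}. \<bar>of_int (gam i) * (cos (of_int i * \<theta>) - cos_poly 12 ((of_int i * \<theta>)\<^sup>2))\<bar>)"
    by (rule sum_abs)
  also have "\<dots> \<le> (\<Sum>i\<in>{-18..18}. of_int \<bar>gam i\<bar> * (6 ^ 24 / fact 24))"
  proof (rule sum_mono)
    fix i :: int assume i: "i \<in> {-18..18}"
    \<comment> \<open>All arguments of the cosines stay within 18 / 3 = 6, and 2538 * 6^24 / 24! is
      below 1/10.\<close>
    have "\<bar>real_of_int i\<bar> \<le> 18" using i by auto
    hence "\<bar>of_int i * \<theta>\<bar> \<le> 18 * (1/3)" unfolding abs_mult using assms by (intro mult_mono) auto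
    hence "\<bar>of_int i * \<theta>\<bar> ^ 24 \<le> 6 ^ 24" by (intro power_mono) auto
    hence "\<bar>of_int i * \<theta>\<bar> ^ 24 / fact 24 \<le> 6 ^ 24 / (fact 24 :: real)" by (rule divide_right_mono) simp
    moreover have "\<bar>cos (of_int i * \<theta>) - cos_poly 12 ((of_int i * \<theta>)\<^sup>2)\<bar> \<le> \<bar>of_int i * \<theta>\<bar> ^ 24 / fact 24"
      using cos_poly_error[of "of_int i * \<theta>" 12] by simp
    ultimately have "\<bar>cos (of_int i * \<theta>) - cos_poly 12 ((of_int i * \<theta>)\<^sup>2)\<bar> \<le> 6 ^ 24 / fact 24" by (rule order_trans[rotated])
    thus "\<bar>of_int (gam i) * (cos (of_int i * \<theta>) - cos_poly 12 ((of_int i * \<theta>)\<^sup>2))\<bar> \<le> of_int \<bar>gam i\<bar> * (6 ^ 24 / fact 24)"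
      unfolding abs_mult of_int_abs by (intro mult_left_mono) auto
  qed
  also have "\<dots> = 2538 * (6 ^ 24 / fact 24)"
    unfolding sum_distrib_right[symmetric] of_int_sum[symmetric] gam_abs_sum by simp
  also have "\<dots> \<le> 1/10" by (simp add: fact_numeral)
  finally show ?thesis using Gpoly_bounds[OF x] unfolding x_def[symmetric] by linarith
qed

text \<open>With \<theta> = t / 4 the quotient is about 1 - \<theta>^2 / 12, and \<theta> \<ge> 1/4.
  The trivial bound 1 would be too weak: the final comparison has less room than the one percent
  gained here in the square.\<close>

lemma ct_tent_bound:
  assumes "1 \<le> t" "t \<le> 4/3"
  shows "0 \<le> ct (tent 1) (t / (8 * pi))" "ct (tent 1) (t / (8 * pi)) \<le> 199/200"
proof -
  define \<theta> where "\<theta> = t / 4"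
  have th: "1/4 \<le> \<theta>" "\<theta> \<le> 1/3" using assms by (auto simp: \<theta>_def)
  have e: "ct (tent 1) (t / (8 * pi)) = 2 * (1 - cos \<theta>) / \<theta>\<^sup>2"
    using assms by (simp add: ct_tent \<theta>_def field_simps power2_eq_square)
  show "0 \<le> ct (tent 1) (t / (8 * pi))" unfolding e by simp
  define v where "v = \<theta>\<^sup>2"
  have v: "1/16 \<le> v" "v \<le> 1/9"
    using power_mono[OF th(1), of 2] power_mono[OF th(2), of 2] th by (auto simp: v_def power2_eq_square)
  have cp: "cos_poly 3 v = 1 - v / 2 + v\<^sup>2 / 24" by (simp add: cos_poly_def lessThan_nat_numeral fact_numeral)
  have "\<bar>\<theta>\<bar> ^ 6 = v ^ 3" unfolding v_def by (simp add: power_mult[symmetric] power_even_abs)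
  hence "1 - v / 2 + v\<^sup>2 / 24 - v ^ 3 / 720 \<le> cos \<theta>"
  proof -
    assume "\<bar>\<theta>\<bar> ^ 6 = v ^ 3"
    hence "\<bar>cos \<theta> - cos_poly 3 v\<bar> \<le> v ^ 3 / 720"
      using cos_poly_error[of \<theta> 3] by (simp add: fact_numeral v_def)
    thus ?thesis unfolding cp by linarith
  qed
  moreover have "v\<^sup>2 / 24 - v ^ 3 / 720 \<ge> v * (1/400)"
  proof -
    have "v * (1/9) \<ge> v * v" using v by (intro mult_left_mono) auto
    moreover have "v * v \<ge> 1/16 * v" using v by (intro mult_right_mono) auto
    moreover have "v * (v * v) \<le> 1/9 * (v * v)" using v by (intro mult_right_mono) auto
    ultimately show ?thesis unfolding power2_eq_square power3_eq_cube mult.assoc by argo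
  qed
  ultimately have "2 * (1 - cos \<theta>) \<le> 199/200 * v" by argo
  thus "ct (tent 1) (t / (8 * pi)) \<le> 199/200"
    unfolding e v_def[symmetric] using v by (simp add: pos_divide_le_eq)
qed

text \<open>The dilation by 8 pi replaces \<theta> by t / 4. The factor 1/9 - t^2 / 16 then changes
  sign at |t| = 4/3, and the penalised range 1 \<le> |t| \<le> 4/3 corresponds to 1/4 \<le> \<theta>
  \<le> 1/3.\<close>

definition example :: "real \<Rightarrow> real" where
  "example x = Psi (8 * pi * x)"

lemma example_classAp: "example \<in> classAp"
  unfolding classAp_def
proof (intro CollectI conjI allI)
  show "example (- x) = example x" for x using Psi_minus[of "8 * pi * x"] by (simp add: example_def)
  show "continuous_on UNIV example"
    unfolding example_def by (intro continuous_on_compose2[OF continuous_Psi] continuous_intros) auto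
  show "integrable lborel example"
    using lborel_integrable_real_affine[OF integrable_Psi, of "8 * pi" 0] by (simp add: example_def[abs_def])
qed

lemma L1_example: "L1norm example \<le> 61187564 / 108 / (8 * pi)"
proof -
  have "(LINT u|lborel. \<bar>Psi u\<bar>) = 8 * pi * L1norm example"
    using lborel_integral_real_affine[of "8 * pi" "\<lambda>u. \<bar>Psi u\<bar>" 0] by (simp add: L1norm_def example_def)
  thus ?thesis using L1_Psi by (simp add: field_simps)
qed

lemma ct_example:
  assumes "t \<noteq> 0"
  shows "ct example t = (ct (tent 1) (t / (8 * pi)))\<^sup>2 * (1/9 - t\<^sup>2 / 16) * (Gtrig (t / 4))\<^sup>2 / (8 * pi)"
proof -
  have "ct example t = ct Psi (t / (8 * pi)) / (8 * pi)"
    unfolding example_def by (rule ct_dilate) simp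
  moreover have "2 * pi * (t / (8 * pi)) = t / 4" by simp
  ultimately show ?thesis using assms by (simp add: ct_Psi power_divide)
qed

text \<open>Majorant of the transform for 1 \<le> t \<le> 4/3. Since 144 (t / 4)^2 = 9 t^2, the
  majorant of the trigonometric factor has the coefficients 134 * 9 = 1206 and 7/5 * 81 =
  567/5.\<close>

definition pen_bound :: "real \<Rightarrow> real" where
  "pen_bound t = (199/200)\<^sup>2 * ((1/9 - t\<^sup>2 / 16) * (2570 - 1206 * t\<^sup>2 + 567/5 * t ^ 4)\<^sup>2) / (8 * pi)"

lemma ct_example_le:
  assumes "1 < \<bar>t\<bar>"
  shows "max 0 (ct example t) \<le> (if \<bar>t\<bar> \<le> 4/3 then pen_bound \<bar>t\<bar> else 0)"
proof -
  have "ct example \<bar>t\<bar> = ct example t" by (simp add: abs_if ct_minus)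
  moreover have "max 0 (ct example s) \<le> (if s \<le> 4/3 then pen_bound s else 0)" if s: "1 < s" for s
  proof (cases "s \<le> 4/3")
    case True
    have "s\<^sup>2 \<le> (4/3)\<^sup>2" using s True by (intro power_mono) auto
    hence d: "0 \<le> 1/9 - s\<^sup>2 / 16" by (simp add: power2_eq_square)
    have l: "(ct (tent 1) (s / (8 * pi)))\<^sup>2 \<le> (199/200)\<^sup>2"
      using ct_tent_bound[of s] s True by (intro power_mono) auto
    have "\<bar>Gtrig (s / 4)\<bar> \<le> 2570 - 134 * (144 * (s / 4)\<^sup>2) + 7/5 * (144 * (s / 4)\<^sup>2)\<^sup>2"
      using s True by (intro Gtrig_bound) auto
    also have "\<dots> = 2570 - 1206 * s\<^sup>2 + 567/5 * s ^ 4" by (simp add: power2_eq_square eval_nat_numeral)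
    finally have "\<bar>Gtrig (s / 4)\<bar>\<^sup>2 \<le> (2570 - 1206 * s\<^sup>2 + 567/5 * s ^ 4)\<^sup>2" by (intro power_mono) auto
    hence g: "(Gtrig (s / 4))\<^sup>2 \<le> (2570 - 1206 * s\<^sup>2 + 567/5 * s ^ 4)\<^sup>2" by simp
    have "ct example s = (ct (tent 1) (s / (8 * pi)))\<^sup>2 * ((1/9 - s\<^sup>2 / 16) * (Gtrig (s / 4))\<^sup>2) / (8 * pi)"
      using s by (simp only: ct_example mult.assoc)
    also have "\<dots> \<le> pen_bound s"
      unfolding pen_bound_def using d
      by (intro divide_right_mono mult_mono[OF l mult_left_mono[OF g d]]) auto
    finally have "ct example s \<le> pen_bound s" .
    moreover have "0 \<le> pen_bound s" unfolding pen_bound_def using d by simp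
    ultimately show ?thesis using True by simp
  next
    case False
    \<comment> \<open>Beyond 4/3 the quadratic factor is nonpositive and all others are squares or
      positive constants, so nothing is penalised.\<close>
    have "(4/3)\<^sup>2 \<le> s\<^sup>2" using False by (intro power_mono) auto
    hence "1/9 - s\<^sup>2 / 16 \<le> 0" by (simp add: power2_eq_square)
    hence "ct example s \<le> 0"
      using s by (simp add: ct_example divide_le_0_iff mult_le_0_iff)
    thus ?thesis using False by simp
  qed
  ultimately show ?thesis using assms by metis
qed

lemma pen_example:
  shows "penalty example \<noteq> \<infinity>" "pen example \<le> 26569 / (8 * pi)"
proof -
  define B where "B t = (if \<bar>t\<bar> \<le> 4/3 then pen_bound \<bar>t\<bar> else 0) * indicator {t. 1 \<le> \<bar>t\<bar>} t" for t :: real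
  \<comment> \<open>Antiderivative of the majorant, obtained by expanding the square.\<close>
  define K where "K t = (199/200)\<^sup>2 * ((6604900/9) * t^1 + (-1468755/4) * t^3 + (1227591/10) * t^5 + (-788616/35) * t^7 + (205821/100) * t^9 + (-321489/4400) * t^11) / (8 * pi)" for t :: real
  have dK: "(K has_real_derivative pen_bound t) (at t)" for t
    unfolding K_def pen_bound_def
    by (auto intro!: derivative_eq_intros) (simp add: field_simps eval_nat_numeral)
  have cp: "continuous_on S pen_bound" for S
    unfolding pen_bound_def by (auto intro!: continuous_intros)
  have Bi: "B t = indicator {1..4/3} t * pen_bound t + indicator {1..4/3} (- t) * pen_bound (- t)" for t
    by (auto simp: B_def indicator_def)
  have i1: "integrable lborel (\<lambda>t. indicator {1..4/3} t * pen_bound t)"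
    using borel_integrable_atLeastAtMost'[OF cp, of 1 "4/3"] by (simp add: set_integrable_def)
  have i2: "integrable lborel (\<lambda>t. indicator {1..4/3} (- t) * pen_bound (- t))"
    using lborel_integrable_real_affine[OF i1, of "-1" 0] by simp
  have iB: "integrable lborel B" unfolding Bi[abs_def] using i1 i2 by simp
  have "(\<integral>t. indicator {1..4/3} t *\<^sub>R pen_bound t \<partial>lborel) = K (4/3) - K 1"
    by (rule integral_FTC_Icc) (auto intro!: cp has_vector_derivative_at_within DERIV_subset[OF dK] simp: has_real_derivative_iff_has_vector_derivative[symmetric])
  hence v: "(LINT t|lborel. indicator {1..4/3} t * pen_bound t) = K (4/3) - K 1" by simp
  have "(LINT t|lborel. indicator {1..4/3} (- t) * pen_bound (- t)) = (LINT t|lborel. indicator {1..4/3} t * pen_bound t)"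
    using lborel_integral_real_affine[of "-1" "\<lambda>t. indicator {1..4/3} t * pen_bound t" 0] by simp
  hence "(LINT t|lborel. B t) = 2 * (K (4/3) - K 1)" unfolding Bi using i1 i2 v by simp
  also have "\<dots> \<le> 26569 / (8 * pi)" unfolding K_def by (simp add: field_simps)
  finally have Bv: "(LINT t|lborel. B t) \<le> 26569 / (8 * pi)" .
  have ptw: "max 0 (ct example t) * indicator outer t \<le> B t" for t
  proof (cases "1 < \<bar>t\<bar>")
    case True
    thus ?thesis using ct_example_le[of t] by (simp add: B_def)
  next
    case False
    have "0 \<le> pen_bound 1" by (simp add: pen_bound_def)
    thus ?thesis using False by (auto simp: B_def indicator_def)
  qed
  have B0: "0 \<le> B t" for t using ptw[of t] by (rule order_trans[rotated]) simp
  have "penalty example \<le> (\<integral>\<^sup>+ t. ennreal (B t) \<partial>lborel)"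
    unfolding penalty_def
  proof (rule nn_integral_mono)
    fix t
    show "ennreal (max 0 (ct example t)) * indicator outer t \<le> ennreal (B t)"
      using ptw[of t] B0[of t] by (auto simp: indicator_def intro!: ennreal_leI split: if_splits)
  qed
  also have "\<dots> = ennreal (LINT t|lborel. B t)" by (rule nn_integral_eq_integral[OF iB]) (simp add: B0)
  finally have le: "penalty example \<le> ennreal (LINT t|lborel. B t)" .
  show fin: "penalty example \<noteq> \<infinity>" using le by (auto simp: top_unique)
  have "pen example \<le> (LINT t|lborel. B t)"
    unfolding pen_def by (rule integral_mono[OF integrable_ct_if_penalty(3)[OF example_classAp fin] iB ptw])
  thus "pen example \<le> 26569 / (8 * pi)" using Bv by simp
qed

lemma CAp_36_11: "ereal (25/21) < CAp (36/11)"
proof -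
  have F0: "example 0 = 272828 / 9" by (simp add: example_def Psi_0)
  have nz: "example \<noteq> (\<lambda>_. 0)"
  proof
    assume e: "example = (\<lambda>_. 0)"
    have "example 0 = 0" by (simp add: e)
    thus False using F0 by simp
  qed
  have N: "0 < L1norm example" by (rule L1norm_pos_Ap[OF example_classAp nz])
  have "25/21 * L1norm example \<le> 25/21 * (61187564 / 108 / (8 * pi))" using L1_example by simp
  \<comment> \<open>Numerically about 26836 against 26854; the inequality amounts to roughly pi >
    3.1397.\<close>
  also have "\<dots> < 272828 / 9 - 36/11 * (26569 / (8 * pi))"
    using pi_approx by (simp add: field_simps)
  also have "\<dots> \<le> example 0 - 36/11 * pen example" using pen_example(2) F0 by simp
  finally have "25/21 < (example 0 - 36/11 * pen example) / L1norm example"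
    using N by (simp add: pos_less_divide_eq)
  hence "ereal (25/21) < ratioAp (36/11) example"
    using ratioAp_finite[OF example_classAp nz pen_example(1)] by simp
  also have "\<dots> \<le> CAp (36/11)" unfolding CAp_def using example_classAp nz by (intro SUP_upper) auto
  finally show ?thesis .
qed

theorem theorem2:
  shows
    "(\<exists>G. G \<in> classEp \<and> G \<noteq> (\<lambda>_. 0) \<and> ratioEp G = CAp_inf)
   \<and> CA_inf \<le> CAp_inf \<and> CAp_inf < ereal 1.2
   \<and> CAp 1 = 2
   \<and> \<not> (\<exists>F. F \<in> classAp \<and> F \<noteq> (\<lambda>_. 0) \<and> ratioAp 1 F = CAp 1)
   \<and> (\<forall>A::real. 1 < A \<longrightarrow>
        (\<exists>G. G \<in> classAp \<and> G \<noteq> (\<lambda>_. 0) \<and> ratioAp A G = CAp A)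
      \<and> CA A \<le> CAp A \<and> CAp A \<le> 2
      \<and> (1.222 < A \<longrightarrow> CAp A \<le> ereal (1.2 / (1 - 0.222 / (A - 1)))))
   \<and> ereal (25/21) < CAp (36/11)"
proof (intro conjI allI impI)
  show "\<exists>G. G \<in> classEp \<and> G \<noteq> (\<lambda>_. 0) \<and> ratioEp G = CAp_inf" by (rule Ep_extremizer_exists)
  show "CA_inf \<le> CAp_inf" by (rule CA_inf_le_CAp_inf)
  show "CAp_inf < ereal 1.2" by (rule CAp_inf_less)
  show "CAp 1 = 2" by (rule CAp_1)
  show "\<not> (\<exists>F. F \<in> classAp \<and> F \<noteq> (\<lambda>_. 0) \<and> ratioAp 1 F = CAp 1)"
  proof
    assume "\<exists>F. F \<in> classAp \<and> F \<noteq> (\<lambda>_. 0) \<and> ratioAp 1 F = CAp 1"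
    then obtain F where "F \<in> classAp" "F \<noteq> (\<lambda>_. 0)" "ratioAp 1 F = 2" unfolding CAp_1 by blast
    thus False using ratioAp_less_2[of F 1] by simp
  qed
  show "ereal (25/21) < CAp (36/11)" by (rule CAp_36_11)
next
  fix A :: real assume A: "1 < A"
  show "\<exists>G. G \<in> classAp \<and> G \<noteq> (\<lambda>_. 0) \<and> ratioAp A G = CAp A" by (rule Ap_extremizer_exists[OF A])
  show "CA A \<le> CAp A" by (rule CA_le_CAp[OF A])
  show "CAp A \<le> 2" using A by (intro CAp_le_2) simp
  assume A2: "1.222 < A"
  have d: "222/1000 / (A - 1) < 1" using A2 by (simp add: field_simps)
  \<comment> \<open>The dual bound holds with 1.199 in place of the asserted 1.2; condition e < 1
    keeps the denominator positive.\<close>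
  have "1199/1000 / (1 - 222/1000 / (A - 1)) \<le> 1.2 / (1 - 0.222 / (A - 1))"
    by (rule frac_le) (use d in auto)
  moreover have "CAp A \<le> ereal (1199/1000 / (1 - 222/1000 / (A - 1)))" using A2 by (intro CAp_le_dual) simp
  ultimately show "CAp A \<le> ereal (1.2 / (1 - 0.222 / (A - 1)))"
    using order_trans ereal_less_eq(3) by blast
qed

end
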